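(* Let $n\ge 2$ and let $\Omega\subset\mathbb{C}^n$ be a strictly pseudoconvex bounded star-shaped domain with smooth boundary such that the range $R(\square_{\partial\bar\partial})$ is closed in $L^2_{p,q}(\Omega)$ (for every bidegree $(p,q)$ with $1\le p\le n$, $1\le q\le n$). Then for all $1\le p\le n$ and $1\le q\le n$ there exists an operator $$N_{\partial\bar\partial}=N_{p,q}: L^2_{p,q}(\Omega)/\ker(\square_{\partial\bar\partial})\longrightarrow L^2_{p,q}(\Omega)/\ker(\square_{\partial\bar\partial}),$$ extended to $L^2_{p,q}(\Omega)$ by setting $N_{\partial\bar\partial}u=0$ for $u\in\ker(\square_{\partial\bar\partial})$, with the following properties: (1) $R(N_{\partial\bar\partial})\subset \mathrm{Dom}(\square_{\partial\bar\partial})\cap\ker(\square_{\partial\bar\partial})^\perp$. (2) $N_{\partial\bar\partial}\square_{\partial\bar\partial}=\square_{\partial\bar\partial}N_{\partial\bar\partial}=\mathrm{Id}$ on $R(\square_{\partial\bar\partial})$. (3) Every $f\in L^2_{p,q}(\Omega)$ can be written as an orthogonal sum $$f=f_1\oplus\partial\bar\partial(\partial\bar\partial)^*N_{\partial\bar\partial}f_2\oplus(\partial\bar\partial)^*\partial\bar\partial N_{\partial\bar\partial}f_2,$$ where $f_1\in\ker(\square_{\partial\bar\partial})$ and $f_2\in R(\square_{\partial\bar\partial})$. (4) $\partial\bar\partial N_{p,q}=N_{p+1,q+1}\partial\bar\partial$ on $\mathrm{Dom}(\partial\bar\partial)$, for $1\le p\le n-1$, $1\le q\le n-1$. (5) $(\partial\bar\partial)^*N_{p,q}=N_{p-1,q-1}(\partial\bar\partial)^*$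 on $\mathrm{Dom}((\partial\bar\partial)^* )$, for $2\le p\le n$, $2\le q\le n$. (6) There exists a constant $k\ge 0$ such that for all $f\in L^2_{p,q}(\Omega)$, $$\|N_{p,q}f\|\le k\|f\|,\qquad \|\partial\bar\partial N_{p,q}f\|\le\sqrt{k}\,\|f\|,\qquad \|(\partial\bar\partial)^*N_{p,q}f\|\le\sqrt{k}\,\|f\|.$$
   Context: $L^2_{p,q}(\Omega)$ is the Hilbert space of $(p,q)$-forms on $\Omega$ with coefficients in $L^2(\Omega)$. The operator $\partial\bar\partial:L^2_{p,q}(\Omega)\to L^2_{p+1,q+1}(\Omega)$ is taken in the sense of distributions, with domain $\mathrm{Dom}(\partial\bar\partial)=\{f\in L^2_{p,q}(\Omega): \partial\bar\partial f\in L^2_{p+1,q+1}(\Omega)\}$; $(\partial\bar\partial)^*:L^2_{p+1,q+1}(\Omega)\to L^2_{p,q}(\Omega)$ is its Hilbert space adjoint, with domain $\mathrm{Dom}((\partial\bar\partial)^* )$. The Laplacian is $$\square_{\partial\bar\partial}=\partial\bar\partial(\partial\bar\partial)^*+(\partial\bar\partial)^*\partial\bar\partial : L^2_{p,q}(\Omega)\to L^2_{p,q}(\Omega)$$ with domain $\mathrm{Dom}(\square_{\partial\bar\partial})=\{f\in\mathrm{Dom}(\partial\bar\partial)\cap\mathrm{Dom}((\partial\bar\partial)^* ) : \partial\bar\partial f\in\mathrm{Dom}((\partial\bar\partial)^* ),\ (\partial\bar\partial)^*f\in\mathrm{Dom}(\partial\bar\partial)\}$. $R(T)$ denotes the range of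 an operator $T$. The quotient $L^2_{p,q}(\Omega)/\ker(\square_{\partial\bar\partial})$ is identified with $\ker(\square_{\partial\bar\partial})^\perp$. $N_{p,q}$ denotes $N_{\partial\bar\partial}$ acting on $(p,q)$-forms. *)

theory Defs
  imports "HOL-Analysis.Analysis"
begin

section \<open>Smooth functions and Wirtinger derivatives\<close>

fun Ck_on :: "nat \<Rightarrow> 'a::real_normed_vector set \<Rightarrow> ('a \<Rightarrow> 'b::real_normed_vector) \<Rightarrow> bool" where
  "Ck_on 0 S f \<longleftrightarrow> continuous_on S f"
| "Ck_on (Suc k) S f \<longleftrightarrow>
     (\<forall>x\<in>S. f differentiable (at x)) \<and> (\<forall>v. Ck_on k S (\<lambda>x. frechet_derivative f (at x) v))"

(* Meant for open S; for S in C^n this is C-infinity in the real sense. *)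
definition smooth_on :: "'a::real_normed_vector set \<Rightarrow> ('a \<Rightarrow> 'b::real_normed_vector) \<Rightarrow> bool" where
  "smooth_on S f \<longleftrightarrow> (\<forall>k. Ck_on k S f)"

(* d/dz_j = (d/dx_j - i d/dy_j) / 2  and  d/dzbar_j = (d/dx_j + i d/dy_j) / 2 *)
definition wirt :: "'n::finite \<Rightarrow> (complex^'n \<Rightarrow> complex) \<Rightarrow> complex^'n \<Rightarrow> complex" where
  "wirt j f z =
     (frechet_derivative f (at z) (axis j 1) - \<i> * frechet_derivative f (at z) (axis j \<i>)) / 2"

definition wirt_bar :: "'n::finite \<Rightarrow> (complex^'n \<Rightarrow> complex) \<Rightarrow> complex^'n \<Rightarrow> complex" where
  "wirt_bar j f z =
     (frechet_derivative f (at z) (axis j 1) + \<i> * frechet_derivative f (at z) (axis j \<i>)) / 2"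

definition test_function :: "(complex^'n::finite) set \<Rightarrow> (complex^'n \<Rightarrow> complex) \<Rightarrow> bool" where
  "test_function \<Omega> \<phi> \<longleftrightarrow>
     smooth_on UNIV \<phi> \<and> compact (closure {z. \<phi> z \<noteq> 0}) \<and> closure {z. \<phi> z \<noteq> 0} \<subseteq> \<Omega>"

section \<open>Domains\<close>

definition defining_function ::
    "(complex^'n::finite) set \<Rightarrow> (complex^'n) set \<Rightarrow> (complex^'n \<Rightarrow> real) \<Rightarrow> bool" where
  "defining_function \<Omega> U \<rho> \<longleftrightarrow>
     open U \<and> frontier \<Omega> \<subseteq> U \<and> smooth_on U \<rho> \<and>
     \<Omega> \<inter> U = {z\<in>U. \<rho> z < 0} \<and> frontier \<Omega> = {z\<in>U. \<rho> z = 0} \<and>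
     (\<forall>z\<in>frontier \<Omega>. \<exists>v. frechet_derivative \<rho> (at z) v \<noteq> 0)"

definition smooth_boundary :: "(complex^'n::finite) set \<Rightarrow> bool" where
  "smooth_boundary \<Omega> \<longleftrightarrow> (\<exists>U \<rho>. defining_function \<Omega> U \<rho>)"

definition levi_form ::
    "(complex^'n::finite \<Rightarrow> real) \<Rightarrow> complex^'n \<Rightarrow> complex^'n \<Rightarrow> complex" where
  "levi_form \<rho> z w =
     (\<Sum>j\<in>UNIV. \<Sum>k\<in>UNIV.
        wirt j (wirt_bar k (\<lambda>x. complex_of_real (\<rho> x))) z * (w $ j) * cnj (w $ k))"

(* Positivity of the Levi form (a real number, as the complex Hessian of a real function is
   Hermitian) on the nonzero vectors of the complex tangent space. *)
definition strictly_pseudoconvex :: "(complex^'n::finite) set \<Rightarrow> bool" where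
  "strictly_pseudoconvex \<Omega> \<longleftrightarrow>
     (\<exists>U \<rho>. defining_function \<Omega> U \<rho> \<and>
        (\<forall>z\<in>frontier \<Omega>. \<forall>w. w \<noteq> 0 \<longrightarrow>
           (\<Sum>j\<in>UNIV. wirt j (\<lambda>x. complex_of_real (\<rho> x)) z * (w $ j)) = 0 \<longrightarrow>
           Re (levi_form \<rho> z w) > 0))"

section \<open>Differential forms\<close>

text \<open>
  The coordinates of \<open>\<complex>\<^sup>n\<close> are indexed by a finite linearly ordered type, so that
  increasing multi-indices are the same as subsets of the index type.  A form
  \<open>f = \<Sum> f\<^sub>K\<^sub>L dz\<^sup>K \<and> dzbar\<^sup>L\<close> (sum over increasing multi-indices) is the function sending \<open>z\<close>
  to the vector of its coefficients \<open>f z $ (K, L)\<close>.  The forms \<open>dz\<^sup>K \<and> dzbar\<^sup>L\<close> are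
  taken to be orthonormal.
\<close>

type_synonym 'n covec = "complex ^ ('n set \<times> 'n set)"
type_synonym 'n form = "complex ^ 'n \<Rightarrow> 'n covec"

definition dz_wedge :: "'n::{finite,linorder} \<Rightarrow> 'n covec \<Rightarrow> 'n covec" where
  "dz_wedge j w =
     (\<chi> I. case I of (K, L) \<Rightarrow>
        if j \<in> K then (-1) ^ card {i\<in>K. i < j} * w $ (K - {j}, L) else 0)"

(* The additional sign (-1)^(card K) comes from moving dzbar_k past dz^K. *)
definition dzbar_wedge :: "'n::{finite,linorder} \<Rightarrow> 'n covec \<Rightarrow> 'n covec" where
  "dzbar_wedge k w =
     (\<chi> I. case I of (K, L) \<Rightarrow>
        if k \<in> L then (-1) ^ (card K + card {i\<in>L. i < k}) * w $ (K, L - {k}) else 0)"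

section \<open>The Hilbert spaces of square-integrable forms\<close>

text \<open>
  Elements of \<open>L\<^sup>2\<^sub>p\<^sub>q(\<Omega>)\<close> are represented by functions, of which only the restriction to \<open>\<Omega>\<close>
  matters; equality in \<open>L\<^sup>2\<^sub>p\<^sub>q(\<Omega>)\<close> is \<open>ae_eq \<Omega>\<close>.
\<close>

definition ae_eq :: "(complex^'n::finite) set \<Rightarrow> 'n form \<Rightarrow> 'n form \<Rightarrow> bool" where
  "ae_eq \<Omega> f g \<longleftrightarrow> (AE z in lebesgue_on \<Omega>. f z = g z)"

definition L2 :: "(complex^'n::finite) set \<Rightarrow> nat \<Rightarrow> nat \<Rightarrow> 'n form set" where
  "L2 \<Omega> p q =
     {f. f \<in> borel_measurable (lebesgue_on \<Omega>) \<and>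
         integrable (lebesgue_on \<Omega>) (\<lambda>z. (norm (f z))\<^sup>2) \<and>
         (\<forall>z\<in>\<Omega>. \<forall>K L. \<not> (card K = p \<and> card L = q) \<longrightarrow> f z $ (K, L) = 0)}"

definition L2_inner :: "(complex^'n::finite) set \<Rightarrow> 'n form \<Rightarrow> 'n form \<Rightarrow> complex" where
  "L2_inner \<Omega> f g = (LINT z|lebesgue_on \<Omega>. (\<Sum>I\<in>UNIV. f z $ I * cnj (g z $ I)))"

definition L2_norm :: "(complex^'n::finite) set \<Rightarrow> 'n form \<Rightarrow> real" where
  "L2_norm \<Omega> f = sqrt (LINT z|lebesgue_on \<Omega>. (norm (f z))\<^sup>2)"

definition L2_closed :: "(complex^'n::finite) set \<Rightarrow> nat \<Rightarrow> nat \<Rightarrow> 'n form set \<Rightarrow> bool" where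
  "L2_closed \<Omega> p q V \<longleftrightarrow>
     (\<forall>u f. (\<forall>m. u m \<in> V) \<and> f \<in> L2 \<Omega> p q \<and>
        (\<lambda>m. L2_norm \<Omega> (\<lambda>z. u m z - f z)) \<longlonglongrightarrow> 0 \<longrightarrow> f \<in> V)"

definition L2_perp :: "(complex^'n::finite) set \<Rightarrow> nat \<Rightarrow> nat \<Rightarrow> 'n form set \<Rightarrow> 'n form set" where
  "L2_perp \<Omega> p q V = {f \<in> L2 \<Omega> p q. \<forall>u\<in>V. L2_inner \<Omega> f u = 0}"

section \<open>The operator and its adjoint\<close>

text \<open>
  The operators below are determined only up to \<open>ae_eq \<Omega>\<close>, and only on their domains.
\<close>

(* g = ddbar f in the sense of distributions, where
   ddbar f = sum over j, k of dz_j \<and> dzbar_k \<and> (d^2 f / dz_j dzbar_k).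
   Both derivatives are moved to the test function, so the two signs cancel. *)
definition weak_ddbar :: "(complex^'n::{finite,linorder}) set \<Rightarrow> 'n form \<Rightarrow> 'n form \<Rightarrow> bool" where
  "weak_ddbar \<Omega> f g \<longleftrightarrow>
     (\<forall>\<phi>. test_function \<Omega> \<phi> \<longrightarrow>
        (LINT z|lebesgue_on \<Omega>. \<phi> z *s g z) =
        (\<Sum>j\<in>UNIV. \<Sum>k\<in>UNIV.
           dz_wedge j (dzbar_wedge k (LINT z|lebesgue_on \<Omega>. wirt j (wirt_bar k \<phi>) z *s f z))))"

(* ddbar : L2 p q \<rightarrow> L2 (p+1) (q+1) *)
definition dom_ddbar :: "(complex^'n::{finite,linorder}) set \<Rightarrow> nat \<Rightarrow> nat \<Rightarrow> 'n form set" where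
  "dom_ddbar \<Omega> p q = {f \<in> L2 \<Omega> p q. \<exists>g \<in> L2 \<Omega> (p + 1) (q + 1). weak_ddbar \<Omega> f g}"

definition ddbar :: "(complex^'n::{finite,linorder}) set \<Rightarrow> nat \<Rightarrow> nat \<Rightarrow> 'n form \<Rightarrow> 'n form" where
  "ddbar \<Omega> p q f = (SOME g. g \<in> L2 \<Omega> (p + 1) (q + 1) \<and> weak_ddbar \<Omega> f g)"

(* The adjoint of ddbar : L2 p q \<rightarrow> L2 (p+1) (q+1); it acts on forms of bidegree (p+1,q+1). *)
definition is_ddbar_adj ::
    "(complex^'n::{finite,linorder}) set \<Rightarrow> nat \<Rightarrow> nat \<Rightarrow> 'n form \<Rightarrow> 'n form \<Rightarrow> bool" where
  "is_ddbar_adj \<Omega> p q g h \<longleftrightarrow>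
     (\<forall>f \<in> dom_ddbar \<Omega> p q. L2_inner \<Omega> (ddbar \<Omega> p q f) g = L2_inner \<Omega> f h)"

definition dom_ddbar_adj :: "(complex^'n::{finite,linorder}) set \<Rightarrow> nat \<Rightarrow> nat \<Rightarrow> 'n form set" where
  "dom_ddbar_adj \<Omega> p q = {g \<in> L2 \<Omega> (p + 1) (q + 1). \<exists>h \<in> L2 \<Omega> p q. is_ddbar_adj \<Omega> p q g h}"

definition ddbar_adj :: "(complex^'n::{finite,linorder}) set \<Rightarrow> nat \<Rightarrow> nat \<Rightarrow> 'n form \<Rightarrow> 'n form" where
  "ddbar_adj \<Omega> p q g = (SOME h. h \<in> L2 \<Omega> p q \<and> is_ddbar_adj \<Omega> p q g h)"

section \<open>The Laplacian\<close>

(* On L2 p q, for p, q \<ge> 1. *)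
definition dom_laplacian :: "(complex^'n::{finite,linorder}) set \<Rightarrow> nat \<Rightarrow> nat \<Rightarrow> 'n form set" where
  "dom_laplacian \<Omega> p q =
     {f \<in> dom_ddbar \<Omega> p q \<inter> dom_ddbar_adj \<Omega> (p - 1) (q - 1).
        ddbar \<Omega> p q f \<in> dom_ddbar_adj \<Omega> p q \<and>
        ddbar_adj \<Omega> (p - 1) (q - 1) f \<in> dom_ddbar \<Omega> (p - 1) (q - 1)}"

definition laplacian :: "(complex^'n::{finite,linorder}) set \<Rightarrow> nat \<Rightarrow> nat \<Rightarrow> 'n form \<Rightarrow> 'n form" where
  "laplacian \<Omega> p q f =
     (\<lambda>z. ddbar \<Omega> (p - 1) (q - 1) (ddbar_adj \<Omega> (p - 1) (q - 1) f) z
        + ddbar_adj \<Omega> p q (ddbar \<Omega> p q f) z)"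

definition ker_laplacian :: "(complex^'n::{finite,linorder}) set \<Rightarrow> nat \<Rightarrow> nat \<Rightarrow> 'n form set" where
  "ker_laplacian \<Omega> p q = {f \<in> dom_laplacian \<Omega> p q. ae_eq \<Omega> (laplacian \<Omega> p q f) (\<lambda>z. 0)}"

definition range_laplacian :: "(complex^'n::{finite,linorder}) set \<Rightarrow> nat \<Rightarrow> nat \<Rightarrow> 'n form set" where
  "range_laplacian \<Omega> p q = {g \<in> L2 \<Omega> p q. \<exists>f \<in> dom_laplacian \<Omega> p q. ae_eq \<Omega> g (laplacian \<Omega> p q f)}"

(* A linear operator on the Hilbert space L2 p q, i.e. compatible with ae_eq. *)
definition L2_operator ::
    "(complex^'n::finite) set \<Rightarrow> nat \<Rightarrow> nat \<Rightarrow> ('n form \<Rightarrow> 'n form) \<Rightarrow> bool" where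
  "L2_operator \<Omega> p q T \<longleftrightarrow>
     (\<forall>f\<in>L2 \<Omega> p q. T f \<in> L2 \<Omega> p q) \<and>
     (\<forall>f\<in>L2 \<Omega> p q. \<forall>g\<in>L2 \<Omega> p q. ae_eq \<Omega> f g \<longrightarrow> ae_eq \<Omega> (T f) (T g)) \<and>
     (\<forall>f\<in>L2 \<Omega> p q. \<forall>g\<in>L2 \<Omega> p q. ae_eq \<Omega> (T (\<lambda>z. f z + g z)) (\<lambda>z. T f z + T g z)) \<and>
     (\<forall>f\<in>L2 \<Omega> p q. \<forall>c. ae_eq \<Omega> (T (\<lambda>z. c *s f z)) (\<lambda>z. c *s T f z))"

end

theory Submission
  imports Defs
begin

text \<open>
  The statement is a fact about Hilbert complexes.  Let \<open>S\<close> and \<open>T\<close> be two consecutive closed, densely defined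
  operators between Hilbert spaces with \<open>T S = 0\<close>, and let \<open>\<box> = S S\<^sup>* + T\<^sup>* T\<close>.  By von Neumann's graph
  argument \<open>1 + T\<^sup>* T\<close> and \<open>1 + S S\<^sup>*\<close> are onto, and since the two summands of \<open>\<box>\<close> annihilate each other,
  so is \<open>1 + \<box>\<close> (\<open>resolvent\<close>).  As \<open>\<box>\<close> is symmetric and nonnegative, this implies that the orthogonal
  complement of its range is its kernel (\<open>perp_range_in_kernel\<close>).  If the range is closed, every
  vector is therefore the sum of a harmonic one and one in the range, and \<open>N\<close> inverts \<open>\<box>\<close> between the
  orthogonal complement of the kernel and the range.  Extended by zero, \<open>N\<close> is symmetric and everywhere defined,
  hence bounded (\<open>hellinger_toeplitz\<close>); the bounds for \<open>T N\<close> and \<open>S\<^sup>* N\<close> follow from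
  \<open>(norm (S\<^sup>* u))\<^sup>2 + (norm (T u))\<^sup>2 = u \<bullet> \<box> u\<close>.  That \<open>N\<close> commutes with \<open>T\<close> and \<open>S\<^sup>*\<close> follows from the Hodge
  decomposition and from the uniqueness of \<open>N\<close> (\<open>green_commutes\<close>, \<open>green_commutes_adjoint\<close>).

  It remains to see that the operator of the theorem, in its consecutive bidegrees, forms such a complex.
  The square-integrable functions modulo null sets are made into a complete real inner product space.  Real
  inner products suffice: all spaces and operators are stable under multiplication by complex scalars, and
  the complex inner product is recovered from the real one (\<open>L2_inner_eq\<close>).  The graph is
  closed since it is defined by testing (\<open>weak_rel_closed\<close>).  The square of the operator is zero since wedge products
  are alternating and derivatives of test functions commute (\<open>weak_rel_square\<close>).  The domain is dense since it contains
  the forms with test functions as coefficients, on which the operator acts by classical differentiation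
  (\<open>test_form_in_domain\<close>, \<open>domain_dense\<close>).  Density makes the adjoint single-valued, and likewise the separation
  of forms by test functions makes the weak operator single-valued; so the operators of the theorem, which
  are chosen representatives, are determined up to null sets.  The analytic input is the fundamental lemma of
  the calculus of variations (\<open>test_functions_separate\<close>) and integration by parts
  (\<open>integral_wirt_wirt_bar_mult\<close>).
\<close>

section \<open>Orthogonal projections and symmetric operators\<close>

text \<open>
  The usual minimising sequence: by the parallelogram law its members are Cauchy, and the first
  variation of the distance at the limit gives orthogonality.
\<close>

lemma orthogonal_projection_exists:
  fixes V :: "'h::{real_inner,complete_space} set"
  assumes V: "subspace V" "closed V"
  shows "\<exists>v\<in>V. \<forall>w\<in>V. (x - v) \<bullet> w = 0"
proof -
  define F where "F y = (norm (x - y))\<^sup>2" for y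
  define d where "d = Inf (F ` V)"
  have ne: "V \<noteq> {}" using V(1) subspace_0 by blast
  have bdd: "bdd_below (F ` V)" by (rule bdd_belowI[of _ 0]) (auto simp: F_def)
  have d_le: "d \<le> F y" if "y \<in> V" for y
    unfolding d_def by (rule cInf_lower) (use that bdd in auto)
  have "\<exists>y\<in>V. F y < d + e" if "e > 0" for e
    using cInf_lessD[of "F ` V" "d + e"] ne that unfolding d_def by auto
  then have "\<exists>y\<in>V. F y < d + 1 / Suc n" for n by simp
  then obtain y where y: "\<And>n. y n \<in> V" "\<And>n. F (y n) < d + 1 / Suc n" by metis
  (* parallelogram law for the vectors x - a and x - b *)
  have par: "(norm (a - b))\<^sup>2 = 2 * F a + 2 * F b - 4 * F ((1/2) *\<^sub>R (a + b))" for a b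
    unfolding F_def power2_norm_eq_inner
    by (simp add: algebra_simps inner_commute)
  have close: "(norm (y m - y n))\<^sup>2 \<le> 2 / Suc m + 2 / Suc n" for m n
  proof -
    have "(1/2) *\<^sub>R (y m + y n) \<in> V" using V(1) y(1) by (simp add: subspace_add subspace_scale)
    from d_le[OF this] show ?thesis using par[of "y m" "y n"] y(2)[of m] y(2)[of n] by simp
  qed
  have "Cauchy y"
  proof (rule CauchyI)
    fix e :: real assume e: "e > 0"
    obtain N where N: "1 / real (Suc N) < e\<^sup>2 / 4"
      using reals_Archimedean[of "e\<^sup>2/4"] e by (auto simp: inverse_eq_divide)
    have "norm (y m - y n) < e" if "m \<ge> N" "n \<ge> N" for m n
    proof -
      have "1 / real (Suc m) \<le> 1 / real (Suc N)" "1 / real (Suc n) \<le> 1 / real (Suc N)"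
        using that by (auto intro!: divide_left_mono)
      then have "(norm (y m - y n))\<^sup>2 < e\<^sup>2" using close[of m n] N by simp
      then show ?thesis using e by (simp add: power2_less_imp_less)
    qed
    then show "\<exists>M. \<forall>m\<ge>M. \<forall>n\<ge>M. norm (y m - y n) < e" by blast
  qed
  then obtain v where v: "y \<longlonglongrightarrow> v" using Cauchy_convergent_iff convergent_def by blast
  have vV: "v \<in> V" using V(2) y(1) v closed_sequentially by blast
  have "(\<lambda>n. F (y n)) \<longlonglongrightarrow> F v" unfolding F_def by (intro tendsto_intros v)
  moreover have "(\<lambda>n. d + 1 / Suc n) \<longlonglongrightarrow> d"
    using tendsto_add[OF tendsto_const LIMSEQ_inverse_real_of_nat, of d] by (simp add: inverse_eq_divide)
  ultimately have Fv: "F v \<le> d" by (rule LIMSEQ_le) (use y(2) less_imp_le in blast)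
  have "(x - v) \<bullet> w = 0" if w: "w \<in> V" for w
  proof (cases "w = 0")
    case False
    (* the point of the line v + t w that is closest to x *)
    define t where "t = (x - v) \<bullet> w / (w \<bullet> w)"
    have "v + t *\<^sub>R w \<in> V" using V(1) vV w by (simp add: subspace_add subspace_scale)
    from d_le[OF this] Fv have "F v \<le> F (v + t *\<^sub>R w)" by simp
    also have "F (v + t *\<^sub>R w) = F v - 2 * t * ((x - v) \<bullet> w) + t\<^sup>2 * (w \<bullet> w)"
      unfolding F_def power2_norm_eq_inner by (simp add: algebra_simps inner_commute power2_eq_square)
    also have "\<dots> = F v - ((x - v) \<bullet> w)\<^sup>2 / (w \<bullet> w)"
      using False by (simp add: t_def power2_eq_square)
    finally have "((x - v) \<bullet> w)\<^sup>2 / (w \<bullet> w) \<le> 0" by simp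
    then show ?thesis using False
      by (smt (verit) divide_pos_pos inner_gt_zero_iff zero_less_power2)
  qed simp
  then show ?thesis using vV by blast
qed

text \<open>
  The Hellinger--Toeplitz theorem.  By symmetry, \<open>norm (N x) \<le> m\<close> is a family of conditions on the
  continuous functionals \<open>x \<mapsto> x \<bullet> N y\<close>, so the sublevel sets of \<open>norm (N x)\<close> are closed; they cover the
  space, hence one of them contains a ball by Baire, and linearity turns this into a bound.
\<close>

lemma hellinger_toeplitz:
  fixes N :: "'h::{real_inner,complete_space} \<Rightarrow> 'h"
  assumes lin: "linear N" and sym: "\<And>x y. N x \<bullet> y = x \<bullet> N y"
  shows "bounded_linear N"
proof -
  define F where "F m = {x. norm (N x) \<le> real m}" for m :: nat
  have F_eq: "F m = (\<Inter>y\<in>{y. norm y \<le> 1}. {x. \<bar>x \<bullet> N y\<bar> \<le> real m})" for m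
  proof (rule set_eqI)
    fix x
    have "norm (N x) \<le> real m \<longleftrightarrow> (\<forall>y. norm y \<le> 1 \<longrightarrow> \<bar>x \<bullet> N y\<bar> \<le> real m)"
    proof (intro iffI allI impI)
      fix y :: 'h assume "norm (N x) \<le> real m" "norm y \<le> 1"
      then show "\<bar>x \<bullet> N y\<bar> \<le> real m"
        using Cauchy_Schwarz_ineq2[of "N x" y] mult_mono[of "norm (N x)" "real m" "norm y" 1]
        by (simp add: sym)
    next
      assume *: "\<forall>y. norm y \<le> 1 \<longrightarrow> \<bar>x \<bullet> N y\<bar> \<le> real m"
      show "norm (N x) \<le> real m"
      proof (cases "N x = 0")
        case False
        (* the unit vector in the direction of N x attains the norm *)
        have "x \<bullet> N (sgn (N x)) = N x \<bullet> sgn (N x)" by (simp add: sym)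
        also have "\<dots> = norm (N x)"
          using False by (simp add: sgn_div_norm power2_norm_eq_inner[symmetric] power2_eq_square)
        finally have "x \<bullet> N (sgn (N x)) = norm (N x)" .
        with *[rule_format, of "sgn (N x)"] False show ?thesis by (simp add: norm_sgn)
      qed simp
    qed
    then show "x \<in> F m \<longleftrightarrow> x \<in> (\<Inter>y\<in>{y. norm y \<le> 1}. {x. \<bar>x \<bullet> N y\<bar> \<le> real m})"
      by (auto simp: F_def)
  qed
  have "closed (F m)" for m
    unfolding F_eq by (intro closed_INT ballI closed_Collect_le continuous_intros)
  moreover have "\<Union>(range F) = UNIV"
    using real_arch_simple by (fastforce simp: F_def)
  ultimately obtain m where "interior (F m) \<noteq> {}"
    using Baire_category_alt[of "euclidean :: 'h topology" "range F"]
      completely_metrizable_space_euclidean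
    by (auto simp: closed_closedin[symmetric])
  then obtain x e where e: "e > 0" "cball x e \<subseteq> F m"
    by (meson ex_in_conv mem_interior_cball)
  have "norm (N z) \<le> norm z * (2 * m / e)" for z
  proof (cases "z = 0")
    case True then show ?thesis using lin by (simp add: linear_0)
  next
    case False
    define s where "s = e / norm z"
    have s: "s > 0" using e False by (simp add: s_def)
    have "x + s *\<^sub>R z \<in> cball x e" using False e by (simp add: s_def dist_norm)
    then have 1: "norm (N (x + s *\<^sub>R z)) \<le> m" using e by (auto simp: F_def)
    have "x \<in> F m" by (rule subsetD[OF e(2)]) (use e(1) in simp)
    then have 2: "norm (N x) \<le> m" by (simp add: F_def)
    have "s *\<^sub>R N z = N (x + s *\<^sub>R z) - N x" using lin by (simp add: linear_add linear_scale)
    then have "s * norm (N z) = norm (N (x + s *\<^sub>R z) - N x)" using s by (metis abs_of_pos norm_scaleR)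
    also have "\<dots> \<le> 2 * m" using 1 2 norm_triangle_ineq4[of "N (x + s *\<^sub>R z)" "N x"] by linarith
    finally have "s * norm (N z) \<le> 2 * m" .
    then show ?thesis using s e False by (simp add: s_def field_simps)
  qed
  with lin show ?thesis
    by (intro bounded_linear_intro[where K = "2 * m / e"]) (auto simp: linear_add linear_scale)
qed

section \<open>The Laplacian of a Hilbert complex\<close>

text \<open>
  Unbounded operators are represented by their graphs, i.e. as linear relations, and the adjoint is taken
  relative to a source \<open>H\<close> and a target \<open>K\<close> inside one ambient space.  It is single-valued
  exactly when no nonzero vector of \<open>H\<close> is orthogonal to the domain of \<open>T\<close>.
\<close>

definition adj_rel :: "'h::real_inner set \<Rightarrow> 'h set \<Rightarrow> ('h \<times> 'h) set \<Rightarrow> ('h \<times> 'h) set" where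
  "adj_rel H K T = {(y, x). y \<in> K \<and> x \<in> H \<and> (\<forall>a b. (a, b) \<in> T \<longrightarrow> b \<bullet> y = a \<bullet> x)}"

lemma adj_rel_iff:
  "(y, x) \<in> adj_rel H K T \<longleftrightarrow> y \<in> K \<and> x \<in> H \<and> (\<forall>a b. (a, b) \<in> T \<longrightarrow> b \<bullet> y = a \<bullet> x)"
  by (simp add: adj_rel_def)

lemma adj_relD: "(y, x) \<in> adj_rel H K T \<Longrightarrow> (a, b) \<in> T \<Longrightarrow> b \<bullet> y = a \<bullet> x"
  by (simp add: adj_rel_iff)

lemma subspace_adj_rel:
  assumes H: "subspace H" and K: "subspace K"
  shows "subspace (adj_rel H K T)"
proof (rule subspaceI)
  show "0 \<in> adj_rel H K T"
    using H K by (simp add: adj_rel_iff zero_prod_def subspace_0)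
next
  fix p q assume pq: "p \<in> adj_rel H K T" "q \<in> adj_rel H K T"
  obtain y x where p: "p = (y, x)" by (cases p)
  obtain y' x' where q: "q = (y', x')" by (cases q)
  show "p + q \<in> adj_rel H K T"
    using pq H K unfolding p q add_Pair adj_rel_iff by (simp add: subspace_add inner_add_right)
next
  fix c p assume "p \<in> adj_rel H K T"
  then show "c *\<^sub>R p \<in> adj_rel H K T"
    using H K by (cases p) (simp add: adj_rel_iff subspace_scale)
qed

text \<open>
  Two consecutive maps \<open>H0 \<rightarrow> H1 \<rightarrow> H2\<close> whose composition vanishes; \<open>exact\<close> says that the range of \<open>S\<close> lies in the
  kernel of \<open>T\<close>.  The Laplacian is \<open>S S\<^sup>* + T\<^sup>* T\<close>.
\<close>

locale hilbert_complex =
  fixes H0 H1 H2 :: "'h::{real_inner,complete_space} set" and S T :: "('h \<times> 'h) set"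
  assumes subspaces: "subspace H0" "subspace H1" "subspace H2"
    and S: "S \<subseteq> H0 \<times> H1" "subspace S" "closed S"
    and T: "T \<subseteq> H1 \<times> H2" "subspace T" "closed T"
    and exact: "(a, b) \<in> S \<Longrightarrow> (b, 0) \<in> T"
begin

abbreviation "Sa \<equiv> adj_rel H0 H1 S"
abbreviation "Ta \<equiv> adj_rel H1 H2 T"

definition lap :: "('h \<times> 'h) set" where
  "lap = {(u, a + b) | u a b. \<exists>s t. (u, s) \<in> Sa \<and> (s, a) \<in> S \<and> (u, t) \<in> T \<and> (t, b) \<in> Ta}"

lemma lapI: "(u, s) \<in> Sa \<Longrightarrow> (s, a) \<in> S \<Longrightarrow> (u, t) \<in> T \<Longrightarrow> (t, b) \<in> Ta \<Longrightarrow> w = a + b \<Longrightarrow> (u, w) \<in> lap"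
  unfolding lap_def by blast

lemma lapE:
  assumes "(u, w) \<in> lap"
  obtains s a t b where "(u, s) \<in> Sa" "(s, a) \<in> S" "(u, t) \<in> T" "(t, b) \<in> Ta" "w = a + b"
  using assms unfolding lap_def by blast

lemma subspace_lap: "subspace lap"
proof -
  have Sa: "subspace Sa" and Ta: "subspace Ta" using subspaces by (auto intro: subspace_adj_rel)
  have z: "(0,0) \<in> X" if "subspace X" for X :: "('h\<times>'h) set"
    using subspace_0[OF that] by (simp add: zero_prod_def)
  have p: "(a + c, b + d) \<in> X" if "subspace X" "(a,b) \<in> X" "(c,d) \<in> X" for X :: "('h\<times>'h) set" and a b c d
    using subspace_add[OF that] by simp
  have m: "(c *\<^sub>R a, c *\<^sub>R b) \<in> X" if "subspace X" "(a,b) \<in> X" for X :: "('h\<times>'h) set" and a b c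
    using subspace_scale[OF that] by simp
  show ?thesis
  proof (rule subspaceI)
    show "0 \<in> lap" unfolding zero_prod_def
      by (rule lapI[of 0 0 0 0 0]) (auto intro: z Sa Ta S T)
  next
    fix x y assume "x \<in> lap" "y \<in> lap"
    then obtain u w u' w' where xy: "x = (u,w)" "(u,w) \<in> lap" "y = (u',w')" "(u',w') \<in> lap"
      by (metis surj_pair)
    from xy(2) obtain s a t b where 1: "(u, s) \<in> Sa" "(s, a) \<in> S" "(u, t) \<in> T" "(t, b) \<in> Ta" "w = a + b"
      by (rule lapE)
    from xy(4) obtain s' a' t' b' where 2: "(u', s') \<in> Sa" "(s', a') \<in> S" "(u', t') \<in> T" "(t', b') \<in> Ta" "w' = a' + b'"
      by (rule lapE)
    have "(u + u', w + w') \<in> lap"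
      by (rule lapI[of _ "s + s'" "a + a'" "t + t'" "b + b'"])
        (use 1 2 in \<open>auto intro!: p Sa Ta S T\<close>)
    then show "x + y \<in> lap" using xy by simp
  next
    fix c x assume "x \<in> lap"
    then obtain u w where xy: "x = (u,w)" "(u,w) \<in> lap" by (metis surj_pair)
    from xy(2) obtain s a t b where 1: "(u, s) \<in> Sa" "(s, a) \<in> S" "(u, t) \<in> T" "(t, b) \<in> Ta" "w = a + b"
      by (rule lapE)
    have "(c *\<^sub>R u, c *\<^sub>R w) \<in> lap"
      by (rule lapI[of _ "c *\<^sub>R s" "c *\<^sub>R a" "c *\<^sub>R t" "c *\<^sub>R b"])
        (use 1 in \<open>auto intro!: m Sa Ta S T simp: scaleR_add_right\<close>)
    then show "c *\<^sub>R x \<in> lap" using xy by simp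
  qed
qed

lemma lap_diff: "(u, w) \<in> lap \<Longrightarrow> (u', w') \<in> lap \<Longrightarrow> (u - u', w - w') \<in> lap"
  using subspace_diff[OF subspace_lap] by fastforce

text \<open>
The adjoint complex: \<open>S\<^sup>* T\<^sup>* = 0\<close> is dual to \<open>T S = 0\<close>.
\<close>

lemma Ta_range_Sa: assumes "(t, b) \<in> Ta" shows "(b, 0) \<in> Sa"
proof -
  have "y \<bullet> b = 0" if "(x, y) \<in> S" for x y
    using adj_relD[OF assms exact[OF that]] by simp
  then show ?thesis using assms subspaces by (auto simp: adj_rel_iff subspace_0)
qed

lemma lap_in_H1: assumes "(u, w) \<in> lap" shows "u \<in> H1" "w \<in> H1"
  using assms subspaces S T by (auto elim!: lapE intro!: subspace_add simp: adj_rel_iff)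

lemma lap_symmetric:
  assumes "(u, w) \<in> lap" "(u', w') \<in> lap"
  shows "u \<bullet> w' = w \<bullet> u'"
proof -
  from assms(1) obtain s a t b where 1: "(u, s) \<in> Sa" "(s, a) \<in> S" "(u, t) \<in> T" "(t, b) \<in> Ta" "w = a + b"
    by (rule lapE)
  from assms(2) obtain s' a' t' b' where 2: "(u', s') \<in> Sa" "(s', a') \<in> S" "(u', t') \<in> T" "(t', b') \<in> Ta" "w' = a' + b'"
    by (rule lapE)
  show ?thesis
    using adj_relD[OF 1(1) 2(2)] adj_relD[OF 2(1) 1(2)] adj_relD[OF 1(4) 2(3)] adj_relD[OF 2(4) 1(3)] 1(5) 2(5)
    by (simp add: inner_add inner_commute)
qed

lemma lap_energy:
  assumes "(u, s) \<in> Sa" "(s, a) \<in> S" "(u, t) \<in> T" "(t, b) \<in> Ta"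
  shows "u \<bullet> (a + b) = (norm s)\<^sup>2 + (norm t)\<^sup>2"
  using adj_relD[OF assms(1,2)] adj_relD[OF assms(4,3)]
  by (simp add: inner_add inner_commute power2_norm_eq_inner)

text \<open>
  A form is harmonic exactly when both \<open>S\<^sup>*\<close> and \<open>T\<close> annihilate it, because
  \<open>lap_energy\<close> expresses the quadratic form of the Laplacian through their values.
\<close>

lemma lap_kernel_iff: "(u, 0) \<in> lap \<longleftrightarrow> (u, 0) \<in> Sa \<and> (u, 0) \<in> T"
proof
  assume "(u, 0) \<in> lap"
  then obtain s a t b where 1: "(u, s) \<in> Sa" "(s, a) \<in> S" "(u, t) \<in> T" "(t, b) \<in> Ta" "0 = a + b"
    by (rule lapE)
  from lap_energy[OF 1(1-4)] 1(5) have "(norm s)\<^sup>2 + (norm t)\<^sup>2 = 0" by simp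
  then show "(u, 0) \<in> Sa \<and> (u, 0) \<in> T" using 1 by (simp add: add_nonneg_eq_0_iff)
next
  assume "(u, 0) \<in> Sa \<and> (u, 0) \<in> T"
  moreover have "(0, 0) \<in> S" "(0, 0) \<in> Ta"
    using subspace_0[OF S(2)] subspace_0[OF subspace_adj_rel[OF subspaces(2,3), of T]]
    by (auto simp: zero_prod_def)
  ultimately show "(u, 0) \<in> lap" by (intro lapI[of u 0 0 0 0]) auto
qed

lemma range_S_in_kernel_T: "(x, y) \<in> T \<Longrightarrow> (a, b) \<in> S \<Longrightarrow> (x - b, y) \<in> T"
  using subspace_diff[OF T(2), of "(x,y)" "(b,0)"] exact by simp

lemma Sa_diff: "(x, y) \<in> Sa \<Longrightarrow> (x', y') \<in> Sa \<Longrightarrow> (x - x', y - y') \<in> Sa"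
  using subspace_diff[OF subspace_adj_rel[OF subspaces(1,2)], of "(x,y)" S "(x',y')"] by simp

text \<open>
  The surjectivity of \<open>1 + \<box>\<close>, which stands in for the self-adjointness of \<open>\<box>\<close>.  With \<open>A = T\<^sup>* T\<close>
  and \<open>B = S S\<^sup>*\<close> one has \<open>A B = B A = 0\<close>, hence \<open>1 + A + B = (1 + A) (1 + B)\<close> and
  \<open>(1 + A + B)\<^sup>-\<^sup>1 = (1 + A)\<^sup>-\<^sup>1 + (1 + B)\<^sup>-\<^sup>1 - 1\<close>.  The two inverses on the right come from von Neumann's
  argument: the projection of \<open>(u, 0)\<close> to the graph of \<open>T\<close> is \<open>(v1, T v1)\<close> with
  \<open>v1 + T\<^sup>* T v1 = u\<close>, and the projection of \<open>(0, u)\<close> to the graph of \<open>S\<close> leaves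
  the remainder \<open>u - a\<close> with \<open>(1 + S S\<^sup>*) (u - a) = u\<close>.
\<close>

lemma resolvent:
  assumes u: "u \<in> H1" shows "\<exists>v. (v, u - v) \<in> lap"
proof -
  obtain v1 t where 1: "(v1, t) \<in> T" "\<forall>w\<in>T. ((u, 0) - (v1, t)) \<bullet> w = 0"
    using orthogonal_projection_exists[OF T(2,3), of "(u, 0)"] by auto
  have v1: "v1 \<in> H1" "t \<in> H2" using 1 T by auto
  have Ta: "(t, u - v1) \<in> Ta"
    using 1(2) u v1 subspaces
    by (auto simp: adj_rel_iff subspace_diff inner_diff_left inner_commute)
  obtain s' a where 2: "(s', a) \<in> S" "\<forall>w\<in>S. ((0, u) - (s', a)) \<bullet> w = 0"
    using orthogonal_projection_exists[OF S(2,3), of "(0, u)"] by auto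
  have s': "s' \<in> H0" "a \<in> H1" using 2 S by auto
  have Sa: "(u - a, s') \<in> Sa"
    using 2(2) u s' subspaces
    by (auto simp: adj_rel_iff subspace_diff inner_diff_left inner_commute)
  have "(v1 - a, t) \<in> T" by (rule range_S_in_kernel_T[OF 1(1) 2(1)])
  moreover have "(v1 - a, s') \<in> Sa"
    using Sa_diff[OF Sa Ta_range_Sa[OF Ta]] by (simp add: algebra_simps)
  ultimately have "(v1 - a, u - (v1 - a)) \<in> lap"
    by (rule_tac lapI[OF _ 2(1) _ Ta]) auto
  then show ?thesis by blast
qed

text \<open>
  Write \<open>u = v + \<box> v\<close>.  Pairing with \<open>\<box> v\<close> gives
  \<open>0 = v \<bullet> \<box> v + (norm (\<box> v))\<^sup>2\<close> with both terms nonnegative, so \<open>\<box> v = 0\<close> and \<open>u = v\<close>.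
\<close>

lemma perp_range_in_kernel:
  assumes u: "u \<in> H1" "\<And>w. w \<in> Range lap \<Longrightarrow> u \<bullet> w = 0"
  shows "(u, 0) \<in> lap"
proof -
  obtain v where v: "(v, u - v) \<in> lap" using resolvent[OF u(1)] by blast
  have "v \<bullet> (u - v) \<ge> 0" using v lap_energy by (auto elim!: lapE)
  moreover have "u \<bullet> (u - v) = 0" using v u by blast
  ultimately have "(u - v) \<bullet> (u - v) \<le> 0" by (simp add: algebra_simps inner_commute)
  then have "u = v" by (metis inner_eq_zero_iff inner_ge_zero order_antisym eq_iff_diff_eq_0)
  then show ?thesis using v by simp
qed

section \<open>The Green operator\<close>

text \<open>
  \<open>u\<close> is the solution, orthogonal to the kernel, of \<open>\<box> u = w\<close>, where \<open>w\<close> is the projection of \<open>f\<close> to the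
  range of \<open>\<box>\<close>.  The projection makes sense for every vector of the ambient space, not only for
  those in \<open>H1\<close>, so the Green operator is a total symmetric operator and Hellinger--Toeplitz applies to it.
\<close>

definition is_green :: "'h \<Rightarrow> 'h \<Rightarrow> bool" where
  "is_green f u \<longleftrightarrow> (\<forall>k. (k, 0) \<in> lap \<longrightarrow> u \<bullet> k = 0) \<and>
     (\<exists>w. (u, w) \<in> lap \<and> (\<forall>v\<in>Range lap. (f - w) \<bullet> v = 0))"

definition green :: "'h \<Rightarrow> 'h" where "green f = (THE u. is_green f u)"

lemma subspace_range_lap: "subspace (Range lap)"
proof -
  have "Range lap = snd ` lap" by force
  then show ?thesis using linear_subspace_image[OF bounded_linear.linear[OF bounded_linear_snd] subspace_lap] by metis
qed

lemma is_green_unique: assumes "is_green f u" "is_green f u'" shows "u = u'"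
proof -
  from assms obtain w w' where w: "(u, w) \<in> lap" "\<forall>v\<in>Range lap. (f - w) \<bullet> v = 0"
      "(u', w') \<in> lap" "\<forall>v\<in>Range lap. (f - w') \<bullet> v = 0" unfolding is_green_def by blast
  have d: "(u - u', w - w') \<in> lap" using w lap_diff by blast
  then have "(f - w) \<bullet> (w - w') = 0" "(f - w') \<bullet> (w - w') = 0" using w by blast+
  then have "(w - w') \<bullet> (w - w') = 0" by (simp add: algebra_simps)
  with d have k: "(u - u', 0) \<in> lap" by simp
  then have "u \<bullet> (u - u') = 0" "u' \<bullet> (u - u') = 0" using assms unfolding is_green_def by blast+
  then have "(u - u') \<bullet> (u - u') = 0" by (simp add: algebra_simps)
  then show ?thesis by simp
qed

lemma green_eqI: "is_green f u \<Longrightarrow> green f = u"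
  unfolding green_def using is_green_unique by blast

end

locale hilbert_complex_closed_range = hilbert_complex +
  assumes closed_range: "closed (Range lap)"
begin

text \<open>
  Closedness of the range enters here: it allows projecting to the range, and what remains is
  orthogonal to the range, hence harmonic.
\<close>

lemma hodge_decomposition:
  assumes f: "f \<in> H1"
  shows "\<exists>w\<in>Range lap. (f - w, 0) \<in> lap"
proof -
  obtain w where w: "w \<in> Range lap" "\<forall>v\<in>Range lap. (f - w) \<bullet> v = 0"
    using orthogonal_projection_exists[OF subspace_range_lap closed_range] by blast
  then have "f - w \<in> H1" using f lap_in_H1 subspaces by (auto intro: subspace_diff)
  then show ?thesis using perp_range_in_kernel w by blast
qed

lemma range_perp_kernel: assumes "w \<in> Range lap" "(k, 0) \<in> lap" shows "w \<bullet> k = 0"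
  using assms lap_symmetric by fastforce

text \<open>
A preimage of the projection exists, and its harmonic part can be removed.
\<close>

lemma is_green_exists: "\<exists>u. is_green f u"
proof -
  obtain w where w: "w \<in> Range lap" "\<forall>v\<in>Range lap. (f - w) \<bullet> v = 0"
    using orthogonal_projection_exists[OF subspace_range_lap closed_range] by blast
  then obtain u where u: "(u, w) \<in> lap" by blast
  then obtain v where v: "v \<in> Range lap" "(u - v, 0) \<in> lap" using hodge_decomposition lap_in_H1 by blast
  have "(v, w) \<in> lap" using lap_diff[OF u v(2)] by simp
  then have "is_green f v" unfolding is_green_def using w v range_perp_kernel by blast
  then show ?thesis by blast
qed

lemma is_green_green: "is_green f (green f)"
  using is_green_exists green_eqI by metis

lemma green_range: "green f \<in> Range lap"
proof -
  have g: "\<And>k. (k, 0) \<in> lap \<Longrightarrow> green f \<bullet> k = 0" "\<exists>w. (green f, w) \<in> lap"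
    using is_green_green[of f] unfolding is_green_def by blast+
  then obtain v where v: "v \<in> Range lap" "(green f - v, 0) \<in> lap"
    using hodge_decomposition lap_in_H1 by blast
  have "(green f - v) \<bullet> (green f - v) = 0"
    using g(1)[OF v(2)] range_perp_kernel[OF v] by (simp add: inner_diff_left)
  then show ?thesis using v by simp
qed

lemma green_lap: assumes "(u, w) \<in> lap" "\<And>k. (k, 0) \<in> lap \<Longrightarrow> u \<bullet> k = 0" shows "green w = u"
  by (rule green_eqI) (use assms in \<open>auto simp: is_green_def\<close>)

lemma green_kernel: assumes "(k, 0) \<in> lap" shows "green k = 0"
proof (rule green_eqI)
  have "(0, 0) \<in> lap" using subspace_0[OF subspace_lap] by (simp add: zero_prod_def)
  then show "is_green k 0" unfolding is_green_def
    using range_perp_kernel assms by (metis diff_zero inner_commute inner_zero_left)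
qed

lemma green_decomposition:
  assumes f: "f \<in> H1"
  obtains w where "(green f, w) \<in> lap" "(f - w, 0) \<in> lap"
proof -
  obtain w where w: "(green f, w) \<in> lap" "\<forall>v\<in>Range lap. (f - w) \<bullet> v = 0"
    using is_green_green[of f] unfolding is_green_def by blast
  then have "f - w \<in> H1" using f lap_in_H1 subspaces by (auto intro: subspace_diff)
  then show ?thesis using that perp_range_in_kernel w by blast
qed

lemma linear_green: "linear green"
proof (rule linearI)
  fix f g
  obtain w where w: "(green f, w) \<in> lap" "\<forall>v\<in>Range lap. (f - w) \<bullet> v = 0"
    using is_green_green[of f] unfolding is_green_def by blast
  obtain w' where w': "(green g, w') \<in> lap" "\<forall>v\<in>Range lap. (g - w') \<bullet> v = 0"
    using is_green_green[of g] unfolding is_green_def by blast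
  show "green (f + g) = green f + green g"
    using is_green_green[of f] is_green_green[of g] w w' subspace_add[OF subspace_lap w(1) w'(1)]
    by (intro green_eqI) (force simp: is_green_def inner_add_left inner_diff_left)
next
  fix c f
  obtain w where w: "(green f, w) \<in> lap" "\<forall>v\<in>Range lap. (f - w) \<bullet> v = 0"
    using is_green_green[of f] unfolding is_green_def by blast
  show "green (c *\<^sub>R f) = c *\<^sub>R green f"
    using is_green_green[of f] w subspace_scale[OF subspace_lap w(1), of c]
    by (intro green_eqI) (force simp: is_green_def inner_diff_left)
qed

lemma green_symmetric: "green f \<bullet> g = f \<bullet> green g"
proof -
  obtain w where w: "(green f, w) \<in> lap" "\<forall>v\<in>Range lap. (f - w) \<bullet> v = 0"
    using is_green_green[of f] unfolding is_green_def by blast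
  obtain w' where w': "(green g, w') \<in> lap" "\<forall>v\<in>Range lap. (g - w') \<bullet> v = 0"
    using is_green_green[of g] unfolding is_green_def by blast
  have "(g - w') \<bullet> green f = 0" "(f - w) \<bullet> green g = 0" using w w' green_range by blast+
  with lap_symmetric[OF w(1) w'(1)] show ?thesis by (simp add: inner_diff_left inner_commute)
qed

lemma green_bounded: "bounded_linear green"
  using hellinger_toeplitz[OF linear_green] green_symmetric by blast

text \<open>
  The Hodge decomposition of \<open>f\<close> together with the estimate
  \<open>(norm (S\<^sup>* u))\<^sup>2 + (norm (T u))\<^sup>2 = u \<bullet> f \<le> norm u * norm f\<close> for the Green potential \<open>u\<close> of \<open>f\<close>.
\<close>

lemma green_energy:
  assumes f: "f \<in> H1"
  obtains s a t b where "(green f, s) \<in> Sa" "(s, a) \<in> S" "(green f, t) \<in> T" "(t, b) \<in> Ta"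
    "(f - (a + b), 0) \<in> lap" "(norm s)\<^sup>2 + (norm t)\<^sup>2 \<le> norm (green f) * norm f"
proof -
  obtain w where w: "(green f, w) \<in> lap" "(f - w, 0) \<in> lap"
    using green_decomposition[OF f] by blast
  from w(1) obtain s a t b where 1: "(green f, s) \<in> Sa" "(s, a) \<in> S" "(green f, t) \<in> T" "(t, b) \<in> Ta"
    "w = a + b" by (rule lapE)
  have "green f \<bullet> (f - w) = 0" using range_perp_kernel[OF green_range w(2)] .
  then have "(norm s)\<^sup>2 + (norm t)\<^sup>2 = green f \<bullet> f"
    using lap_energy[OF 1(1-4)] 1(5) by (simp add: inner_diff_right)
  also have "\<dots> \<le> norm (green f) * norm f" by (rule norm_cauchy_schwarz)
  finally show ?thesis using that 1 w by blast
qed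

end

text \<open>
  Let \<open>u\<close> be the Green potential of \<open>f\<close>.  Applying \<open>T\<close> to \<open>f = harmonic + S S\<^sup>* u + T\<^sup>* T u\<close> kills the first two
  terms, so \<open>T f = T T\<^sup>* (T u)\<close>.  As \<open>T u\<close> is in the kernel of the next operator, the right-hand
  side is the next Laplacian applied to \<open>T u\<close>; and \<open>T u\<close> is orthogonal to its kernel.
\<close>

lemma green_commutes:
  assumes 1: "hilbert_complex_closed_range H0 H1 H2 S T"
    and 2: "hilbert_complex_closed_range H1 H2 H3 T U"
    and f: "(f, g) \<in> T"
  shows "(hilbert_complex.green H0 H1 H2 S T f, hilbert_complex.green H1 H2 H3 T U g) \<in> T"
proof -
  interpret A: hilbert_complex_closed_range H0 H1 H2 S T by fact
  interpret B: hilbert_complex_closed_range H1 H2 H3 T U by fact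
  have "f \<in> H1" using f A.T by auto
  then obtain s a t b where 1: "(A.green f, s) \<in> A.Sa" "(s, a) \<in> S" "(A.green f, t) \<in> T" "(t, b) \<in> A.Ta"
    "(f - (a + b), 0) \<in> A.lap" by (rule A.green_energy)
  have "(f - (a + b), 0) \<in> T" using 1(5) A.lap_kernel_iff by blast
  from subspace_diff[OF A.T(2) f this] have "(a + b, g) \<in> T" by (simp add: add.commute)
  then have "(b, g) \<in> T" using A.range_S_in_kernel_T[OF _ 1(2)] by fastforce
  moreover have "(t, 0) \<in> U" by (rule B.exact[OF 1(3)])
  moreover have "(0, 0) \<in> B.Ta"
    using subspace_0[OF subspace_adj_rel[OF B.subspaces(2,3), of U]] by (simp add: zero_prod_def)
  ultimately have "(t, g) \<in> B.lap" using 1(4) by (intro B.lapI[of t b g 0 0]) auto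
  moreover have "t \<bullet> k = 0" if "(k, 0) \<in> B.lap" for k
    using adj_relD[of k 0 H1 H2 T, OF _ 1(3)] that B.lap_kernel_iff by simp
  ultimately have "B.green g = t" by (rule B.green_lap)
  then show ?thesis using 1 by simp
qed

text \<open>
The dual argument, with \<open>S\<^sup>*\<close> in the role of \<open>T\<close>: \<open>T\<^sup>* f = T\<^sup>* T (T\<^sup>* u)\<close>.
\<close>

lemma green_commutes_adjoint:
  assumes 1: "hilbert_complex_closed_range H0 H1 H2 S T"
    and 2: "hilbert_complex_closed_range H1 H2 H3 T U"
    and f: "(f, g) \<in> adj_rel H1 H2 T"
  shows "(hilbert_complex.green H1 H2 H3 T U f, hilbert_complex.green H0 H1 H2 S T g) \<in> adj_rel H1 H2 T"
proof -
  interpret A: hilbert_complex_closed_range H0 H1 H2 S T by fact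
  interpret B: hilbert_complex_closed_range H1 H2 H3 T U by fact
  have "f \<in> H2" using f by (auto simp: adj_rel_iff)
  then obtain s a t b where 1: "(B.green f, s) \<in> B.Sa" "(s, a) \<in> T" "(B.green f, t) \<in> U" "(t, b) \<in> B.Ta"
    "(f - (a + b), 0) \<in> B.lap" by (rule B.green_energy)
  have "(f - (a + b), 0) \<in> B.Sa" using 1(5) B.lap_kernel_iff by blast
  from B.Sa_diff[OF f this] have "(a + b, g) \<in> B.Sa" by (simp add: add.commute)
  from B.Sa_diff[OF this B.Ta_range_Sa[OF 1(4)]] have "(a, g) \<in> B.Sa" by simp
  moreover have "(s, 0) \<in> A.Sa" by (rule A.Ta_range_Sa[OF 1(1)])
  moreover have "(0, 0) \<in> S" using subspace_0[OF A.S(2)] by (simp add: zero_prod_def)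
  ultimately have "(s, g) \<in> A.lap" using 1(2) by (intro A.lapI[of s 0 0 a g]) auto
  moreover have "s \<bullet> k = 0" if "(k, 0) \<in> A.lap" for k
    using adj_relD[OF 1(1), of k 0] that A.lap_kernel_iff by (simp add: inner_commute)
  ultimately have "A.green g = s" by (rule A.green_lap)
  then show ?thesis using 1 by simp
qed

section \<open>The Hilbert space of square-integrable functions\<close>

definition sqint :: "('a::euclidean_space \<Rightarrow> 'b::euclidean_space) \<Rightarrow> bool" where
  "sqint f \<longleftrightarrow> f \<in> borel_measurable lebesgue \<and> integrable lebesgue (\<lambda>x. (norm (f x))\<^sup>2)"

lemma sqint_zero: "sqint (\<lambda>x. 0)" by (simp add: sqint_def)

lemma sqint_scale: assumes "sqint f" shows "sqint (\<lambda>x. c *\<^sub>R f x)"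
  using assms by (auto simp: sqint_def power_mult_distrib)

lemma sqint_add: assumes "sqint f" "sqint g" shows "sqint (\<lambda>x. f x + g x)"
  unfolding sqint_def
proof
  show m: "(\<lambda>x. f x + g x) \<in> borel_measurable lebesgue" using assms by (auto simp: sqint_def)
  show "integrable lebesgue (\<lambda>x. (norm (f x + g x))\<^sup>2)"
  proof (rule Bochner_Integration.integrable_bound)
    show "integrable lebesgue (\<lambda>x. 2 * (norm (f x))\<^sup>2 + 2 * (norm (g x))\<^sup>2)"
      using assms by (auto simp: sqint_def)
    have "(norm (f x + g x))\<^sup>2 \<le> 2 * (norm (f x))\<^sup>2 + 2 * (norm (g x))\<^sup>2" for x
    proof -
      have "(norm (f x + g x))\<^sup>2 + (norm (f x - g x))\<^sup>2 = 2 * (norm (f x))\<^sup>2 + 2 * (norm (g x))\<^sup>2"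
        unfolding power2_norm_eq_inner by (simp add: algebra_simps inner_commute)
      then show ?thesis by (smt (verit) zero_le_power2)
    qed
    then show "AE x in lebesgue. norm ((norm (f x + g x))\<^sup>2) \<le> norm (2 * (norm (f x))\<^sup>2 + 2 * (norm (g x))\<^sup>2)"
      by simp
  qed (use m in measurable)
qed

lemma sqint_uminus: "sqint f \<Longrightarrow> sqint (\<lambda>x. - f x)"
  using sqint_scale[of f "-1"] by simp

lemma sqint_diff: "sqint f \<Longrightarrow> sqint g \<Longrightarrow> sqint (\<lambda>x. f x - g x)"
  using sqint_add[of f "\<lambda>x. - g x"] sqint_uminus by auto

lemma sqint_inner: assumes "sqint f" "sqint g" shows "integrable lebesgue (\<lambda>x. f x \<bullet> g x)"
proof (rule Bochner_Integration.integrable_bound)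
  show "integrable lebesgue (\<lambda>x. (norm (f x))\<^sup>2 + (norm (g x))\<^sup>2)" using assms by (auto simp: sqint_def)
  have "\<bar>f x \<bullet> g x\<bar> \<le> (norm (f x))\<^sup>2 + (norm (g x))\<^sup>2" for x
    using Cauchy_Schwarz_ineq2[of "f x" "g x"] sum_squares_bound[of "norm (f x)" "norm (g x)"]
      mult_nonneg_nonneg[of "norm (f x)" "norm (g x)"] norm_ge_zero by linarith
  then show "AE x in lebesgue. norm (f x \<bullet> g x) \<le> norm ((norm (f x))\<^sup>2 + (norm (g x))\<^sup>2)" by simp
qed (use assms in \<open>auto simp: sqint_def\<close>)

text \<open>
  Square-integrable functions on the whole space modulo equality almost everywhere.  Only the real inner
  product is made part of the type; multiplication by complex scalars is added below as an operation.
  Functions on a domain enter through extension by zero.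
\<close>

quotient_type (overloaded) ('a, 'b) lsq =
  "'a::euclidean_space \<Rightarrow> 'b::euclidean_space" / partial: "\<lambda>f g. sqint f \<and> sqint g \<and> (AE x in lebesgue. f x = g x)"
  morphisms rep_lsq_class abs_lsq
proof (rule part_equivpI)
  show "\<exists>f :: 'a \<Rightarrow> 'b. sqint f \<and> sqint f \<and> (AE x in lebesgue. f x = f x)" using sqint_zero by auto
  show "symp (\<lambda>f g :: 'a \<Rightarrow> 'b. sqint f \<and> sqint g \<and> (AE x in lebesgue. f x = g x))"
    by (rule sympI) (auto elim: AE_mp)
  show "transp (\<lambda>f g :: 'a \<Rightarrow> 'b. sqint f \<and> sqint g \<and> (AE x in lebesgue. f x = g x))"
    by (rule transpI) (auto elim: AE_mp)
qed

instantiation lsq :: (euclidean_space, euclidean_space) real_vector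
begin

lift_definition zero_lsq :: "('a, 'b) lsq" is "\<lambda>x. 0" by (simp add: sqint_zero)

lift_definition plus_lsq :: "('a, 'b) lsq \<Rightarrow> ('a, 'b) lsq \<Rightarrow> ('a, 'b) lsq" is "\<lambda>f g x. f x + g x"
  by (auto simp: sqint_add)

lift_definition minus_lsq :: "('a, 'b) lsq \<Rightarrow> ('a, 'b) lsq \<Rightarrow> ('a, 'b) lsq" is "\<lambda>f g x. f x - g x"
  by (auto simp: sqint_diff)

lift_definition uminus_lsq :: "('a, 'b) lsq \<Rightarrow> ('a, 'b) lsq" is "\<lambda>f x. - f x"
  by (auto simp: sqint_uminus)

lift_definition scaleR_lsq :: "real \<Rightarrow> ('a, 'b) lsq \<Rightarrow> ('a, 'b) lsq" is "\<lambda>c f x. c *\<^sub>R f x"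
  by (auto simp: sqint_scale)

instance
proof
  fix a b c :: "('a, 'b) lsq" and r s :: real
  show "a + b + c = a + (b + c)" by transfer (auto simp: sqint_add add.assoc)
  show "a + b = b + a" by transfer (auto simp: sqint_add add.commute)
  show "0 + a = a" by transfer (auto simp: sqint_add)
  show "- a + a = 0" by transfer (auto simp: sqint_zero)
  show "a - b = a + - b" by transfer (auto simp: sqint_diff)
  show "r *\<^sub>R (a + b) = r *\<^sub>R a + r *\<^sub>R b" by transfer (auto simp: sqint_add sqint_scale scaleR_add_right)
  show "(r + s) *\<^sub>R a = r *\<^sub>R a + s *\<^sub>R a" by transfer (auto simp: sqint_add sqint_scale scaleR_add_left)
  show "r *\<^sub>R s *\<^sub>R a = (r * s) *\<^sub>R a" by transfer (auto simp: sqint_scale)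
  show "1 *\<^sub>R a = a" by transfer auto
qed

end

instantiation lsq :: (euclidean_space, euclidean_space) real_inner
begin

lift_definition inner_lsq :: "('a, 'b) lsq \<Rightarrow> ('a, 'b) lsq \<Rightarrow> real" is "\<lambda>f g. LINT x|lebesgue. f x \<bullet> g x"
  by (intro integral_cong_AE) (auto simp: sqint_def)

definition norm_lsq :: "('a, 'b) lsq \<Rightarrow> real" where "norm_lsq x = sqrt (x \<bullet> x)"
definition sgn_lsq :: "('a, 'b) lsq \<Rightarrow> ('a, 'b) lsq" where "sgn_lsq x = x /\<^sub>R norm x"
definition dist_lsq :: "('a, 'b) lsq \<Rightarrow> ('a, 'b) lsq \<Rightarrow> real" where "dist_lsq x y = norm (x - y)"
definition uniformity_lsq :: "(('a, 'b) lsq \<times> ('a, 'b) lsq) filter" where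
  "uniformity_lsq = (INF e\<in>{0 <..}. principal {(x, y). dist x y < e})"
definition open_lsq :: "('a, 'b) lsq set \<Rightarrow> bool" where
  "open_lsq U = (\<forall>x\<in>U. eventually (\<lambda>(x', y). x' = x \<longrightarrow> y \<in> U) uniformity)"

instance
proof
  fix a b c :: "('a, 'b) lsq" and r s :: real
  show "dist a b = norm (a - b)" by (rule dist_lsq_def)
  show "sgn a = a /\<^sub>R norm a" by (rule sgn_lsq_def)
  show "uniformity = (INF e\<in>{0 <..}. principal {(x, y). dist (x :: ('a, 'b) lsq) y < e})" by (rule uniformity_lsq_def)
  show "open U = (\<forall>x\<in>U. eventually (\<lambda>(x', y). x' = x \<longrightarrow> y \<in> U) uniformity)" for U :: "('a, 'b) lsq set"
    by (rule open_lsq_def)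
  show "a \<bullet> b = b \<bullet> a" by transfer (simp add: inner_commute)
  show "(a + b) \<bullet> c = a \<bullet> c + b \<bullet> c" by transfer (simp add: inner_add_left sqint_inner)
  show "(r *\<^sub>R a) \<bullet> b = r * (a \<bullet> b)" by transfer simp
  show "0 \<le> a \<bullet> a" by transfer simp
  show "(a \<bullet> a = 0) = (a = 0)"
    by transfer (auto simp: sqint_inner integral_nonneg_eq_0_iff_AE sqint_zero)
  show "norm a = sqrt (a \<bullet> a)" by (rule norm_lsq_def)
qed

end

text \<open>
  The sum of \<open>2\<^sup>n (norm (f\<^sub>n\<^sub>+\<^sub>1 - f\<^sub>n))\<^sup>2\<close> has finite integral, so almost everywhere its terms are
  bounded, and then \<open>norm (f\<^sub>n\<^sub>+\<^sub>1 - f\<^sub>n)\<close> decays geometrically.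
\<close>

lemma AE_convergent_of_fast_Cauchy:
  fixes f :: "nat \<Rightarrow> 'a::euclidean_space \<Rightarrow> 'b::euclidean_space"
  assumes sq: "\<And>n. sqint (f n)"
    and fast: "\<And>n. (LINT x|lebesgue. (norm (f (Suc n) x - f n x))\<^sup>2) \<le> (1/16)^n"
  shows "AE x in lebesgue. convergent (\<lambda>n. f n x)"
proof -
  define h where "h n x = 2^n * (norm (f (Suc n) x - f n x))\<^sup>2" for n x
  have i: "integrable lebesgue (h n)" for n
    using sqint_diff[OF sq sq, of "Suc n" n] by (auto simp: h_def[abs_def] sqint_def)
  then have [measurable]: "h n \<in> borel_measurable lebesgue" for n by auto
  have "(\<integral>\<^sup>+x. ennreal (h n x) \<partial>lebesgue) \<le> ennreal ((1/8)^n)" for n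
  proof -
    have "(\<integral>\<^sup>+x. ennreal (h n x) \<partial>lebesgue) = ennreal (LINT x|lebesgue. h n x)"
      by (rule nn_integral_eq_integral[OF i]) (simp add: h_def)
    also have "(LINT x|lebesgue. h n x) \<le> 2^n * (1/16)^n"
      unfolding h_def using fast[of n] by simp
    also have "2^n * (1/16)^n = ((1/8)^n :: real)" by (simp flip: power_mult_distrib)
    finally show ?thesis by (simp add: ennreal_leI)
  qed
  then have "(\<integral>\<^sup>+x. (\<Sum>n. ennreal (h n x)) \<partial>lebesgue) \<le> (\<Sum>n. ennreal ((1/8)^n))"
    by (subst nn_integral_suminf) (auto intro!: suminf_le)
  also have "\<dots> < \<infinity>"
    by (subst suminf_ennreal2) (auto simp: summable_geometric)
  finally have "AE x in lebesgue. (\<Sum>n. ennreal (h n x)) \<noteq> \<infinity>"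
    by (intro nn_integral_noteq_infinite) auto
  then show ?thesis
  proof (eventually_elim)
    case (elim x)
    have nn: "h n x \<ge> 0" for n by (simp add: h_def)
    have "summable (\<lambda>n. h n x)"
      using elim nn by (intro summable_suminf_not_top) auto
    then have "Bseq (\<lambda>n. h n x)"
      using convergent_imp_Bseq summable_LIMSEQ_zero convergentI by blast
    then obtain B where B: "B > 0" "\<And>n. norm (h n x) \<le> B" by (auto elim: BseqE)
    have "norm (f (Suc n) x - f n x) \<le> sqrt B * (sqrt (1/2))^n" for n
    proof (rule power2_le_imp_le)
      have "2^n * (norm (f (Suc n) x - f n x))\<^sup>2 \<le> B" using B(2)[of n] nn[of n] by (simp add: h_def)
      then have "(norm (f (Suc n) x - f n x))\<^sup>2 \<le> B * (1/2)^n" by (simp add: field_simps)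
      also have "\<dots> = (sqrt B * (sqrt (1/2))^n)\<^sup>2"
      proof -
        have "((sqrt (1/2))^n)\<^sup>2 = ((sqrt (1/2))\<^sup>2)^n"
          by (metis power_mult mult.commute)
        moreover have "(sqrt (1/2))\<^sup>2 = (1/2 :: real)" by (rule real_sqrt_pow2) simp
        moreover have "(sqrt B)\<^sup>2 = B" using B by simp
        ultimately show ?thesis by (simp only: power_mult_distrib)
      qed
      finally show "(norm (f (Suc n) x - f n x))\<^sup>2 \<le> (sqrt B * (sqrt (1/2))^n)\<^sup>2" .
    qed (use B in auto)
    moreover have "summable (\<lambda>n. sqrt B * (sqrt (1/2))^n)"
      by (intro summable_mult summable_geometric) (simp add: real_sqrt_divide)
    ultimately have "summable (\<lambda>n. f (Suc n) x - f n x)"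
      by (rule summable_comparison_test'[of _ 0, rotated]) 
    then have "convergent (\<lambda>n. \<Sum>i<n. f (Suc i) x - f i x)"
      by (simp add: summable_iff_convergent)
    then have "convergent (\<lambda>n. f n x - f 0 x)" by (simp only: sum_lessThan_telescope[of "\<lambda>i. f i x"])
    from convergent_add[OF this convergent_const[of "f 0 x"]] show ?case by simp
  qed
qed

definition rep_lsq :: "('a::euclidean_space, 'b::euclidean_space) lsq \<Rightarrow> 'a \<Rightarrow> 'b" where
  "rep_lsq x = (SOME f. sqint f \<and> abs_lsq f = x)"

lemma rep_lsq: "sqint (rep_lsq x)" "abs_lsq (rep_lsq x) = x"
proof -
  have "\<exists>f. sqint f \<and> abs_lsq f = x" by (rule lsq.abs_induct) blast
  from someI_ex[OF this] show "sqint (rep_lsq x)" "abs_lsq (rep_lsq x) = x"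
    unfolding rep_lsq_def by blast+
qed

lemma abs_lsq_eq_iff: "sqint f \<Longrightarrow> sqint g \<Longrightarrow> abs_lsq f = abs_lsq g \<longleftrightarrow> (AE x in lebesgue. f x = g x)"
  using Quotient_rel[OF Quotient_lsq, of f g] by simp

lemma inner_abs_lsq: "sqint f \<Longrightarrow> sqint g \<Longrightarrow> abs_lsq f \<bullet> abs_lsq g = (LINT x|lebesgue. f x \<bullet> g x)"
  by (rule inner_lsq.abs_eq) simp_all

lemma diff_abs_lsq: "sqint f \<Longrightarrow> sqint g \<Longrightarrow> abs_lsq f - abs_lsq g = abs_lsq (\<lambda>x. f x - g x)"
  by (rule minus_lsq.abs_eq) simp_all

lemma add_abs_lsq: "sqint f \<Longrightarrow> sqint g \<Longrightarrow> abs_lsq f + abs_lsq g = abs_lsq (\<lambda>x. f x + g x)"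
  by (rule plus_lsq.abs_eq) simp_all

lemma scaleR_abs_lsq: "sqint f \<Longrightarrow> c *\<^sub>R abs_lsq f = abs_lsq (\<lambda>x. c *\<^sub>R f x)"
  by (rule scaleR_lsq.abs_eq) simp_all

lemma norm_abs_lsq: "sqint f \<Longrightarrow> norm (abs_lsq f) = sqrt (LINT x|lebesgue. (norm (f x))\<^sup>2)"
  by (simp add: norm_lsq_def inner_abs_lsq power2_norm_eq_inner)

lemma norm2_abs_lsq: "sqint f \<Longrightarrow> (norm (abs_lsq f))\<^sup>2 = (LINT x|lebesgue. (norm (f x))\<^sup>2)"
  by (simp add: norm_abs_lsq)

text \<open>
  The Riesz--Fischer theorem: a fast subsequence converges almost everywhere, and by Fatou's lemma
  its limit is also the limit in the norm.
\<close>

instance lsq :: (euclidean_space, euclidean_space) complete_space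
proof
  fix X :: "nat \<Rightarrow> ('a, 'b) lsq" assume X: "Cauchy X"
  have "\<exists>M. \<forall>m\<ge>M. \<forall>n\<ge>M. norm (X m - X n) < (1/4)^k" for k :: nat
    by (rule CauchyD[OF X]) simp
  then obtain M where M: "\<And>k m n. m \<ge> M k \<Longrightarrow> n \<ge> M k \<Longrightarrow> norm (X m - X n) < (1/4)^k" by metis
  (* summing makes the indices nondecreasing in n *)
  define r where "r n = (\<Sum>i\<le>n. M i)" for n
  have r: "M n \<le> r n" "r n \<le> r (Suc n)" for n unfolding r_def by (auto intro: member_le_sum)
  have r_mono: "r m \<le> r n" if "m \<le> n" for m n using lift_Suc_mono_le[of r, OF r(2) that] .
  define f where "f n = rep_lsq (X (r n))" for n
  have sq: "sqint (f n)" and absf: "abs_lsq (f n) = X (r n)" for n by (simp_all add: f_def rep_lsq)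
  have d: "(LINT x|lebesgue. (norm (f m x - f n x))\<^sup>2) = (norm (X (r m) - X (r n)))\<^sup>2" for m n
    by (simp add: absf[symmetric] diff_abs_lsq sq norm2_abs_lsq sqint_diff)
  have sq16: "((1/4)^n)\<^sup>2 = ((1/16)^n :: real)" for n
    by (simp add: power2_eq_square flip: power_mult_distrib)
  have d_le: "(LINT x|lebesgue. (norm (f m x - f n x))\<^sup>2) \<le> (1/16)^n" if "n \<le> m" for m n
  proof -
    have "norm (X (r m) - X (r n)) \<le> (1/4)^n"
      using M[of n "r m" "r n"] r(1)[of n] r_mono[OF that] by simp
    then have "(norm (X (r m) - X (r n)))\<^sup>2 \<le> ((1/4)^n)\<^sup>2" by (intro power_mono) auto
    then show ?thesis by (simp add: d sq16)
  qed
  have conv: "AE x in lebesgue. convergent (\<lambda>n. f n x)"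
    by (rule AE_convergent_of_fast_Cauchy) (use sq d_le in auto)
  define g where "g x = lim (\<lambda>n. f n x)" for x
  have [measurable]: "f n \<in> borel_measurable lebesgue" for n using sq by (simp add: sqint_def)
  have [measurable]: "g \<in> borel_measurable lebesgue"
    unfolding g_def[abs_def] by (rule borel_measurable_lim_metric) simp
  have fg: "(\<integral>\<^sup>+x. ennreal ((norm (f n x - g x))\<^sup>2) \<partial>lebesgue) \<le> ennreal ((1/16)^n)" for n
  proof -
    have "AE x in lebesgue. ennreal ((norm (f n x - g x))\<^sup>2) = liminf (\<lambda>m. ennreal ((norm (f m x - f n x))\<^sup>2))"
      using conv
    proof eventually_elim
      case (elim x)
      then have "(\<lambda>m. f m x) \<longlonglongrightarrow> g x" by (simp add: convergent_LIMSEQ_iff g_def)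
      then have "(\<lambda>m. ennreal ((norm (f m x - f n x))\<^sup>2)) \<longlonglongrightarrow> ennreal ((norm (g x - f n x))\<^sup>2)"
        by (intro tendsto_ennrealI tendsto_intros)
      from lim_imp_Liminf[OF _ this] show ?case by (simp add: norm_minus_commute)
    qed
    then have "(\<integral>\<^sup>+x. ennreal ((norm (f n x - g x))\<^sup>2) \<partial>lebesgue)
        = (\<integral>\<^sup>+x. liminf (\<lambda>m. ennreal ((norm (f m x - f n x))\<^sup>2)) \<partial>lebesgue)"
      by (rule nn_integral_cong_AE)
    also have "\<dots> \<le> liminf (\<lambda>m. \<integral>\<^sup>+x. ennreal ((norm (f m x - f n x))\<^sup>2) \<partial>lebesgue)"
      by (rule nn_integral_liminf) simp
    also have "\<dots> \<le> ennreal ((1/16)^n)"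
    proof (rule Liminf_le)
      show "\<forall>\<^sub>F m in sequentially. (\<integral>\<^sup>+x. ennreal ((norm (f m x - f n x))\<^sup>2) \<partial>lebesgue) \<le> ennreal ((1/16)^n)"
        unfolding eventually_sequentially
      proof (intro exI allI impI)
        fix m assume "n \<le> m"
        have "(\<integral>\<^sup>+x. ennreal ((norm (f m x - f n x))\<^sup>2) \<partial>lebesgue) = ennreal (LINT x|lebesgue. (norm (f m x - f n x))\<^sup>2)"
          by (rule nn_integral_eq_integral) (use sqint_diff[OF sq sq] in \<open>auto simp: sqint_def\<close>)
        then show "(\<integral>\<^sup>+x. ennreal ((norm (f m x - f n x))\<^sup>2) \<partial>lebesgue) \<le> ennreal ((1/16)^n)"
          using d_le[OF \<open>n \<le> m\<close>] by (simp add: ennreal_leI)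
      qed
    qed simp
    finally show ?thesis .
  qed
  have sqd: "sqint (\<lambda>x. f n x - g x)" for n
    unfolding sqint_def
  proof
    show "integrable lebesgue (\<lambda>x. (norm (f n x - g x))\<^sup>2)"
    proof (rule integrableI_nonneg)
      show "(\<integral>\<^sup>+x. ennreal ((norm (f n x - g x))\<^sup>2) \<partial>lebesgue) < \<infinity>"
        using le_less_trans[OF fg[of n]] by simp
    qed auto
  qed simp
  have sqg: "sqint g" using sqint_diff[OF sq[of 0] sqd[of 0]] by simp
  have lim: "norm (X (r n) - abs_lsq g) \<le> (1/4)^n" for n
  proof (rule power2_le_imp_le)
    have "ennreal (LINT x|lebesgue. (norm (f n x - g x))\<^sup>2) \<le> ennreal ((1/16)^n)"
      using fg[of n] nn_integral_eq_integral[of lebesgue "\<lambda>x. (norm (f n x - g x))\<^sup>2"] sqd[of n]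
      by (simp add: sqint_def)
    then have "(LINT x|lebesgue. (norm (f n x - g x))\<^sup>2) \<le> (1/16)^n" by (simp add: ennreal_le_iff)
    then show "(norm (X (r n) - abs_lsq g))\<^sup>2 \<le> ((1/4)^n)\<^sup>2"
      by (simp add: absf[symmetric] diff_abs_lsq sq sqg norm2_abs_lsq sqd sq16)
  qed simp
  have "X \<longlonglongrightarrow> abs_lsq g"
  proof (rule LIMSEQ_I)
    fix e :: real assume e: "e > 0"
    obtain n where n: "(1/4)^n < e/2" using real_arch_pow_inv[of "e/2" "1/4"] e by auto
    have "norm (X m - abs_lsq g) < e" if "m \<ge> r n" for m
    proof -
      have "norm (X m - X (r n)) < (1/4)^n" using M[of n m "r n"] r(1)[of n] that by simp
      with lim[of n] n show ?thesis
        using norm_triangle_ineq[of "X m - X (r n)" "X (r n) - abs_lsq g"] by simp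
    qed
    then show "\<exists>N. \<forall>n\<ge>N. norm (X n - abs_lsq g) < e" by blast
  qed
  then show "convergent X" by (rule convergentI)
qed

section \<open>Smooth functions and test functions\<close>

lemma Ck_on_SucI:
  assumes "\<And>x. (f has_derivative f' x) (at x)" "\<And>v. Ck_on k UNIV (\<lambda>x. f' x v)"
  shows "Ck_on (Suc k) UNIV f"
proof -
  have "frechet_derivative f (at x) = f' x" for x using frechet_derivative_at[OF assms(1)] by simp
  then show ?thesis using assms by (auto simp: differentiable_def)
qed

lemma Ck_on_SucD:
  assumes "Ck_on (Suc k) UNIV f"
  shows "(f has_derivative frechet_derivative f (at x)) (at x)" "Ck_on k UNIV (\<lambda>x. frechet_derivative f (at x) v)"
  using assms frechet_derivative_works by auto

lemma Ck_on_Suc_imp: "Ck_on (Suc k) UNIV f \<Longrightarrow> Ck_on k UNIV f"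
proof (induction k arbitrary: f)
  case 0
  show ?case
    using has_derivative_continuous[OF Ck_on_SucD(1)[OF 0]] by (simp add: continuous_on_eq_continuous_at)
next
  case (Suc k)
  show ?case by (rule Ck_on_SucI[OF Ck_on_SucD(1)[OF Suc.prems] Suc.IH[OF Ck_on_SucD(2)[OF Suc.prems]]])
qed

lemma Ck_on_const: "Ck_on k UNIV (\<lambda>x. c)"
proof (induction k arbitrary: c)
  case (Suc k)
  show ?case by (rule Ck_on_SucI[OF has_derivative_const Suc.IH])
qed simp

lemma Ck_on_bounded_linear: "bounded_linear h \<Longrightarrow> Ck_on k UNIV f \<Longrightarrow> Ck_on k UNIV (\<lambda>x. h (f x))"
proof (induction k arbitrary: f)
  case 0 then show ?case by (simp add: bounded_linear.continuous_on)
next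
  case (Suc k)
  show ?case
    by (rule Ck_on_SucI[OF bounded_linear.has_derivative[OF Suc.prems(1) Ck_on_SucD(1)[OF Suc.prems(2)]]])
      (rule Suc.IH[OF Suc.prems(1) Ck_on_SucD(2)[OF Suc.prems(2)]])
qed

lemma Ck_on_linear: assumes "bounded_linear h" shows "Ck_on k UNIV h"
proof (cases k)
  case 0 then show ?thesis using assms by (simp add: linear_continuous_on)
next
  case (Suc j) then show ?thesis
    using Ck_on_SucI[OF bounded_linear_imp_has_derivative[OF assms] Ck_on_const] by simp
qed

lemma Ck_on_add: "Ck_on k UNIV f \<Longrightarrow> Ck_on k UNIV g \<Longrightarrow> Ck_on k UNIV (\<lambda>x. f x + g x)"
proof (induction k arbitrary: f g)
  case 0 then show ?case by (simp add: continuous_on_add)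
next
  case (Suc k)
  show ?case
    by (rule Ck_on_SucI[OF has_derivative_add[OF Ck_on_SucD(1)[OF Suc.prems(1)] Ck_on_SucD(1)[OF Suc.prems(2)]]])
      (rule Suc.IH[OF Ck_on_SucD(2)[OF Suc.prems(1)] Ck_on_SucD(2)[OF Suc.prems(2)]])
qed

lemma Ck_on_mult:
  fixes f g :: "'a::real_normed_vector \<Rightarrow> 'b::real_normed_algebra"
  shows "Ck_on k UNIV f \<Longrightarrow> Ck_on k UNIV g \<Longrightarrow> Ck_on k UNIV (\<lambda>x. f x * g x)"
proof (induction k arbitrary: f g)
  case 0 then show ?case by (simp add: continuous_on_mult)
next
  case (Suc k)
  note D = Ck_on_SucD[OF Suc.prems(1)] Ck_on_SucD[OF Suc.prems(2)]
  show ?case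
    by (rule Ck_on_SucI[OF has_derivative_mult[OF D(1) D(3)]])
      (intro Ck_on_add Suc.IH D(2,4) Suc.prems[THEN Ck_on_Suc_imp])
qed

lemma Ck_on_diff: "Ck_on k UNIV f \<Longrightarrow> Ck_on k UNIV g \<Longrightarrow> Ck_on k UNIV (\<lambda>x. f x - g x)"
  using Ck_on_add[of k f "\<lambda>x. - g x"] Ck_on_bounded_linear[of uminus k g]
  by (simp add: bounded_linear_minus[OF bounded_linear_ident])

lemma Ck_on_prod:
  fixes f :: "'i \<Rightarrow> 'a::real_normed_vector \<Rightarrow> real"
  assumes "finite I" "\<And>i. i \<in> I \<Longrightarrow> Ck_on k UNIV (f i)"
  shows "Ck_on k UNIV (\<lambda>x. \<Prod>i\<in>I. f i x)"
  using assms by (induction I rule: finite_induct) (auto intro!: Ck_on_mult simp: Ck_on_const)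

text \<open>
  One step of the chain rule, for outer functions whose derivatives form a family that is treated by
  induction: the exponential function and \<open>flat\<close> below.
\<close>

lemma Ck_on_Suc_chain:
  fixes h :: "real \<Rightarrow> real"
  assumes "Ck_on (Suc k) UNIV f" "\<And>t. (h has_real_derivative h' t) (at t)" "Ck_on k UNIV (\<lambda>x. h' (f x))"
  shows "Ck_on (Suc k) UNIV (\<lambda>x. h (f x))"
proof (rule Ck_on_SucI)
  fix x
  show "((\<lambda>x. h (f x)) has_derivative (\<lambda>v. h' (f x) * frechet_derivative f (at x) v)) (at x)"
    using has_derivative_compose[OF Ck_on_SucD(1)[OF assms(1)], of h "(*) (h' (f x))"] assms(2)
    by (simp add: has_field_derivative_def)
qed (intro Ck_on_mult assms Ck_on_SucD(2))

lemma Ck_on_exp: "Ck_on k UNIV f \<Longrightarrow> Ck_on k UNIV (\<lambda>x. exp (f x :: real))"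
proof (induction k)
  case 0 then show ?case by (simp add: continuous_on_exp)
next
  case (Suc k)
  show ?case by (rule Ck_on_Suc_chain[OF Suc.prems DERIV_exp Suc.IH[OF Ck_on_Suc_imp[OF Suc.prems]]])
qed

text \<open>
  The functions \<open>t\<^sup>-\<^sup>k exp (- 1 / t)\<close>, extended by \<open>0\<close> to \<open>t \<le> 0\<close>.  Their derivatives are
  combinations of members of the same family, which makes all of them smooth.
\<close>

definition flat :: "nat \<Rightarrow> real \<Rightarrow> real" where
  "flat k t = (if t > 0 then (1 / t) ^ k * exp (- (1 / t)) else 0)"

lemma flat_tendsto_0: "(flat k \<longlongrightarrow> 0) (at 0)"
proof -
  have "((\<lambda>t. (inverse t) ^ k / exp (inverse t)) \<longlongrightarrow> (0 :: real)) (at_right 0)"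
    by (rule filterlim_compose[OF tendsto_power_div_exp_0 filterlim_inverse_at_top_right])
  then have "(flat k \<longlongrightarrow> 0) (at_right 0)"
    by (rule Lim_transform_eventually)
      (auto simp: flat_def eventually_at_filter exp_minus field_simps)
  moreover have "(flat k \<longlongrightarrow> 0) (at_left 0)"
    by (rule Lim_transform_eventually[OF tendsto_const])
      (auto simp: flat_def eventually_at_filter)
  ultimately show ?thesis by (simp add: filterlim_split_at)
qed

lemma flat_deriv: "(flat k has_real_derivative (flat (k + 2) t - real k * flat (k + 1) t)) (at t)"
proof -
  consider "t > 0" | "t < 0" | "t = 0" by linarith
  then show ?thesis
  proof cases
    case 1
    have "((\<lambda>t. (1 / t) ^ k * exp (- (1 / t))) has_real_derivative
        (real k * (1 / t) ^ (k - 1) * (- 1 / t\<^sup>2) * exp (- (1 / t)) + exp (- (1 / t)) * (1 / t\<^sup>2) * (1 / t) ^ k)) (at t)"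
      using 1 by (auto intro!: derivative_eq_intros simp: power2_eq_square)
    also have "real k * (1 / t) ^ (k - 1) * (- 1 / t\<^sup>2) * exp (- (1 / t)) + exp (- (1 / t)) * (1 / t\<^sup>2) * (1 / t) ^ k
        = flat (k + 2) t - real k * flat (k + 1) t"
      using 1 by (cases k) (auto simp: flat_def power2_eq_square field_simps)
    finally show ?thesis
      by (rule has_field_derivative_transform_within_open[where S = "{0<..}"]) (use 1 in \<open>auto simp: flat_def\<close>)
  next
    case 2
    have "((\<lambda>t. 0) has_real_derivative 0) (at t)" by simp
    then have "(flat k has_real_derivative 0) (at t)"
      by (rule has_field_derivative_transform_within_open[where S = "{..<0}"]) (use 2 in \<open>auto simp: flat_def\<close>)
    then show ?thesis using 2 by (simp add: flat_def)
  next
    case 3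
    have "(\<lambda>h. (flat k (0 + h) - flat k 0) / h) = flat (Suc k)"
      by (auto simp: flat_def fun_eq_iff field_simps)
    then show ?thesis using 3 flat_tendsto_0[of "Suc k"] by (simp add: DERIV_def) (simp add: flat_def)
  qed
qed

lemma Ck_on_flat: "Ck_on k UNIV f \<Longrightarrow> Ck_on k UNIV (\<lambda>x. flat j (f x))"
proof (induction k arbitrary: j)
  case 0
  have "continuous_on UNIV (flat j)"
    using DERIV_isCont[OF flat_deriv] by (simp add: continuous_on_eq_continuous_at)
  from continuous_on_compose2[OF this, of UNIV f] 0 show ?case by simp
next
  case (Suc k)
  show ?case
    by (rule Ck_on_Suc_chain[OF Suc.prems flat_deriv])
      (intro Ck_on_diff Ck_on_mult Ck_on_const Suc.IH Ck_on_Suc_imp[OF Suc.prems])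
qed

text \<open>
  The product is smooth and positive exactly on the open box with corners \<open>a\<close> and \<open>c\<close>.  The function
  \<open>s \<mapsto> 1 - exp (- m s)\<close> leaves its zeros alone and pushes its positive values to \<open>1\<close> as \<open>m\<close> grows, so these
  bumps increase to the indicator function of the box.
\<close>

definition box_bump :: "nat \<Rightarrow> 'a \<Rightarrow> 'a \<Rightarrow> 'a::euclidean_space \<Rightarrow> real" where
  "box_bump m a c z = 1 - exp (- real m * (\<Prod>b\<in>Basis. flat 0 (z \<bullet> b - a \<bullet> b) * flat 0 (c \<bullet> b - z \<bullet> b)))"

lemma Ck_on_box_bump: "Ck_on k UNIV (box_bump m a c)"
  unfolding box_bump_def[abs_def]
  by (intro Ck_on_diff Ck_on_const Ck_on_exp Ck_on_mult Ck_on_prod finite_Basis Ck_on_flat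
      Ck_on_linear bounded_linear_inner_left)

lemma flat_nonneg: "flat k t \<ge> 0" by (simp add: flat_def)
lemma flat_0_pos_iff: "flat 0 t = 0 \<longleftrightarrow> t \<le> 0" by (simp add: flat_def)

lemma box_bump_eq_0: "z \<notin> box a c \<Longrightarrow> box_bump m a c z = 0"
  by (fastforce simp: box_bump_def mem_box flat_0_pos_iff not_less)

lemma box_bump_bound: "\<bar>box_bump m a c z\<bar> \<le> 1"
proof -
  have "(\<Prod>b\<in>Basis. flat 0 (z \<bullet> b - a \<bullet> b) * flat 0 (c \<bullet> b - z \<bullet> b)) \<ge> 0"
    by (intro prod_nonneg ballI mult_nonneg_nonneg flat_nonneg)
  then have "real m * (\<Prod>b\<in>Basis. flat 0 (z \<bullet> b - a \<bullet> b) * flat 0 (c \<bullet> b - z \<bullet> b)) \<ge> 0" by simp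
  then show ?thesis by (simp add: box_bump_def)
qed

lemma box_bump_tendsto: "(\<lambda>m. box_bump m a c z) \<longlonglongrightarrow> indicator (box a c) z"
proof (cases "z \<in> box a c")
  case True
  define s where "s = (\<Prod>b\<in>Basis. flat 0 (z \<bullet> b - a \<bullet> b) * flat 0 (c \<bullet> b - z \<bullet> b))"
  have "s > 0" unfolding s_def
    by (intro prod_pos ballI mult_pos_pos) (use True in \<open>auto simp: mem_box flat_def\<close>)
  then have "(\<lambda>m. 1 - (exp (- s)) ^ m) \<longlonglongrightarrow> 1 - 0"
    by (intro tendsto_intros LIMSEQ_power_zero) simp
  moreover have "box_bump m a c z = 1 - (exp (- s)) ^ m" for m
    by (simp add: box_bump_def s_def exp_of_nat_mult[symmetric])
  ultimately show ?thesis using True by simp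
qed (simp add: box_bump_eq_0)

lemma test_function_box_bump:
  assumes "cbox a c \<subseteq> \<Omega>"
  shows "test_function \<Omega> (\<lambda>z. complex_of_real (box_bump m a c z))"
proof -
  have "{z. complex_of_real (box_bump m a c z) \<noteq> 0} \<subseteq> cbox a c"
    using box_bump_eq_0 box_subset_cbox by fastforce
  then have c: "closure {z. complex_of_real (box_bump m a c z) \<noteq> 0} \<subseteq> cbox a c"
    by (rule closure_minimal[OF _ closed_cbox])
  moreover have "compact (closure {z. complex_of_real (box_bump m a c z) \<noteq> 0})"
    using c compact_cbox closed_closure by (metis compact_Int_closed inf.absorb_iff2)
  moreover have "smooth_on UNIV (\<lambda>z. complex_of_real (box_bump m a c z))"
    unfolding smooth_on_def by (intro allI Ck_on_bounded_linear[OF bounded_linear_of_real] Ck_on_box_bump)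
  ultimately show ?thesis using assms by (auto simp: test_function_def)
qed

text \<open>
  Boxes are a generator of the Borel sets that is closed under intersection, so by a Dynkin-system argument
  the integral over every Borel set vanishes, and then over every Lebesgue set.
\<close>

lemma AE_zero_of_box_integrals:
  fixes f :: "'a::euclidean_space \<Rightarrow> real"
  assumes f: "integrable lebesgue f" and total: "(LINT x|lebesgue. f x) = 0"
    and box: "\<And>a b. (LINT x:box a b|lebesgue. f x) = 0"
  shows "AE x in lebesgue. f x = 0"
proof -
  have si: "set_integrable lebesgue A f" if "A \<in> sets lebesgue" for A
    using f that integrable_mult_indicator unfolding set_integrable_def by blast
  have borel: "(LINT x:A|lebesgue. f x) = 0" if "A \<in> sets borel" for A
  proof -
    have "Int_stable (range (\<lambda>(a, b). box a b :: 'a set))"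
      unfolding Int_stable_def by (auto simp: box_Int_box)
    moreover have "range (\<lambda>(a, b). box a b :: 'a set) \<subseteq> Pow UNIV" by simp
    moreover have sigma: "sigma_sets UNIV (range (\<lambda>(a, b). box a b :: 'a set)) = sets borel"
      by (simp add: borel_eq_box)
    then have "A \<in> sigma_sets UNIV (range (\<lambda>(a, b). box a b :: 'a set))" using that by simp
    ultimately show ?thesis
    proof (induction rule: sigma_sets_induct_disjoint)
      case (basic A) then show ?case using box by auto
    next
      case empty show ?case by (simp add: set_lebesgue_integral_def)
    next
      case (compl A)
      then have A: "A \<in> sets lebesgue" unfolding sigma by simp
      have "(LINT x:A \<union> (UNIV - A)|lebesgue. f x) = (LINT x:A|lebesgue. f x) + (LINT x:UNIV - A|lebesgue. f x)"
        by (rule set_integral_Un) (use A in \<open>auto intro!: si\<close>)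
      then show ?case using compl total by (simp add: set_lebesgue_integral_def)
    next
      case (union A)
      have A: "A i \<in> sets lebesgue" for i
        using union(2) unfolding sigma by auto
      have "(LINT x:(\<Union>i. A i)|lebesgue. f x) = (\<Sum>i. (LINT x:A i|lebesgue. f x))"
        by (rule lebesgue_integral_countable_add)
          (use A union(1) in \<open>auto intro!: si simp: disjoint_family_on_def\<close>)
      then show ?case using union by simp
    qed
  qed
  have leb: "(LINT x:A|lebesgue. f x) = 0" if A: "A \<in> sets lebesgue" for A
  proof -
    obtain S N N' where S: "A = S \<union> N" "N \<subseteq> N'" "N' \<in> null_sets lborel" "S \<in> sets lborel"
      by (rule sets_completionE[OF A])
    have "AE x in lebesgue. x \<notin> N'" using S(3) by (intro AE_not_in) (simp add: null_sets_completionI)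
    then have "AE x in lebesgue. indicator A x *\<^sub>R f x = indicator S x *\<^sub>R f x"
      by eventually_elim (use S in \<open>auto simp: indicator_def\<close>)
    then have "(LINT x:A|lebesgue. f x) = (LINT x:S|lebesgue. f x)"
      unfolding set_lebesgue_integral_def
      by (intro integral_cong_AE) (use f A sets_completionI_sets[OF S(4)] in \<open>auto intro!: borel_measurable_scaleR borel_measurable_indicator\<close>)
    with borel S(4) show ?thesis by simp
  qed
  show ?thesis
    using density_unique_real[OF f, of "\<lambda>_. 0"] leb by (simp add: set_lebesgue_integral_def)
qed

lemma continuous_lebesgue_measurable:
  fixes f :: "'a::euclidean_space \<Rightarrow> 'b::topological_space"
  assumes "continuous_on UNIV f" shows "f \<in> borel_measurable lebesgue"
  by (rule measurable_completion) (simp add: borel_measurable_continuous_onI assms)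

text \<open>
  The fundamental lemma of the calculus of variations.  Testing with bumps that tend to the indicator
  function of a box shows that the integral over every box inside \<open>\<Omega>\<close> vanishes; \<open>\<Omega>\<close> is a countable union
  of such boxes.
\<close>

lemma test_functions_separate:
  fixes g :: "complex^'n::finite \<Rightarrow> complex"
  assumes \<Omega>: "open \<Omega>" and g: "integrable (lebesgue_on \<Omega>) g"
    and zero: "\<And>\<phi>. test_function \<Omega> \<phi> \<Longrightarrow> (LINT z|lebesgue_on \<Omega>. \<phi> z * g z) = 0"
  shows "AE z in lebesgue_on \<Omega>. g z = 0"
proof -
  have \<Omega>_leb[simp]: "\<Omega> \<in> sets lebesgue" using \<Omega> by simp
  define h where "h z = indicator \<Omega> z *\<^sub>R g z" for z
  have h: "integrable lebesgue h"
    using g by (simp add: h_def[abs_def] integrable_restrict_space)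
  have h_zero: "(LINT z|lebesgue. \<phi> z * h z) = 0" if "test_function \<Omega> \<phi>" for \<phi>
    using zero[OF that] by (simp add: integral_restrict_space h_def)
  have box_zero: "(LINT z:box a c|lebesgue. h z) = 0" if ac: "cbox a c \<subseteq> \<Omega>" for a c
  proof -
    have "(\<lambda>m. LINT z|lebesgue. complex_of_real (box_bump m a c z) * h z)
        \<longlonglongrightarrow> (LINT z|lebesgue. indicator (box a c) z *\<^sub>R h z)"
    proof (rule integral_dominated_convergence[where w = "\<lambda>z. norm (h z)"])
      show "AE z in lebesgue. (\<lambda>m. complex_of_real (box_bump m a c z) * h z) \<longlonglongrightarrow> indicator (box a c) z *\<^sub>R h z"
        unfolding scaleR_conv_of_real
        by (intro AE_I2 tendsto_intros tendsto_of_real box_bump_tendsto)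
      show "AE z in lebesgue. norm (complex_of_real (box_bump m a c z) * h z) \<le> norm (h z)" for m
        using box_bump_bound[of m a c] by (intro AE_I2) (simp add: norm_mult mult_left_le_one_le)
      have "continuous_on UNIV (box_bump m a c)" for m using Ck_on_box_bump[of 0] by simp
      then have "box_bump m a c \<in> borel_measurable lebesgue" for m
        by (rule continuous_lebesgue_measurable)
      then show "(\<lambda>z. complex_of_real (box_bump m a c z) * h z) \<in> borel_measurable lebesgue" for m
        using h by auto
      show "(\<lambda>z. indicator (box a c) z *\<^sub>R h z) \<in> borel_measurable lebesgue"
        by (rule borel_measurable_integrable, rule integrable_mult_indicator[OF _ h]) simp
    qed (use h in auto)
    then have "(LINT z|lebesgue. indicator (box a c) z *\<^sub>R h z) = 0"
      using h_zero[OF test_function_box_bump[OF ac]] by (simp add: LIMSEQ_const_iff)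
    then show ?thesis by (simp add: set_lebesgue_integral_def)
  qed
  have real_part: "AE z in lebesgue. z \<in> box a c \<longrightarrow> T (h z) = 0"
    if T: "bounded_linear T" and ac: "cbox a c \<subseteq> \<Omega>" for T :: "complex \<Rightarrow> real" and a c
  proof -
    define f where "f z = indicator (box a c) z *\<^sub>R T (h z)" for z
    have Th: "integrable lebesgue (\<lambda>z. T (h z))" by (rule integrable_bounded_linear[OF T h])
    then have f: "integrable lebesgue f" unfolding f_def[abs_def] by (intro integrable_mult_indicator) auto
    have T_box: "(LINT z:box a c|lebesgue. T (h z)) = 0" if "cbox a c \<subseteq> \<Omega>" for a c
    proof -
      have "(LINT z:box a c|lebesgue. T (h z)) = (LINT z|lebesgue. T (indicator (box a c) z *\<^sub>R h z))"
        using T by (simp add: set_lebesgue_integral_def linear_simps)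
      also have "\<dots> = T (LINT z|lebesgue. indicator (box a c) z *\<^sub>R h z)"
        by (rule integral_bounded_linear[OF T]) (intro integrable_mult_indicator h, simp)
      also have "\<dots> = 0" using box_zero[OF that] T by (simp add: set_lebesgue_integral_def linear_simps)
      finally show ?thesis .
    qed
    have "AE z in lebesgue. f z = 0"
    proof (rule AE_zero_of_box_integrals[OF f])
      show "(LINT z|lebesgue. f z) = 0" using T_box[OF ac] by (simp add: f_def set_lebesgue_integral_def)
      fix a' c'
      obtain a'' c'' where b: "box a c \<inter> box a' c' = box a'' c''"
        by (rule that[OF box_Int_box])
      have "(LINT z:box a' c'|lebesgue. f z) = (LINT z:box a'' c''|lebesgue. T (h z))"
        unfolding f_def set_lebesgue_integral_def b[symmetric]
        by (intro Bochner_Integration.integral_cong) (auto simp: indicator_def)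
      also have "\<dots> = 0"
      proof (cases "box a'' c'' = {}")
        case False
        then have "cbox a'' c'' = closure (box a c \<inter> box a' c')" by (simp add: b)
        also have "\<dots> \<subseteq> cbox a c" by (rule closure_minimal) (use box_subset_cbox in auto)
        finally show ?thesis using T_box ac by blast
      qed (simp add: set_lebesgue_integral_def)
      finally show "(LINT z:box a' c'|lebesgue. f z) = 0" .
    qed
    then show ?thesis by eventually_elim (auto simp: f_def)
  qed
  have box_ae: "AE z in lebesgue. z \<in> cbox a c \<longrightarrow> h z = 0" if ac: "cbox a c \<subseteq> \<Omega>" for a c
  proof -
    have "AE z in lebesgue. z \<notin> cbox a c - box a c"
      by (rule AE_not_in[OF negligible_frontier_interval[unfolded negligible_iff_null_sets]])
    with real_part[OF bounded_linear_Re ac] real_part[OF bounded_linear_Im ac]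
    show ?thesis by eventually_elim (auto simp: complex_eq_iff)
  qed
  obtain \<D> where \<D>: "countable \<D>" "\<D> \<subseteq> Pow \<Omega>" "\<And>X. X \<in> \<D> \<Longrightarrow> \<exists>a b. X = cbox a b" "\<Union>\<D> = \<Omega>"
    by (rule open_countable_Union_open_cbox[OF \<Omega>]) (rule that)
  have "AE z in lebesgue. \<forall>X\<in>\<D>. z \<in> X \<longrightarrow> h z = 0"
  proof (subst AE_ball_countable[OF \<D>(1)], intro ballI)
    fix X assume X: "X \<in> \<D>"
    then obtain a c where "X = cbox a c" using \<D>(3) by blast
    then show "AE z in lebesgue. z \<in> X \<longrightarrow> h z = 0" using box_ae[of a c] X \<D>(2) by auto
  qed
  then have "AE z in lebesgue. z \<in> \<Omega> \<longrightarrow> g z = 0"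
  proof eventually_elim
    case (elim z)
    show ?case
    proof
      assume z: "z \<in> \<Omega>"
      then obtain X where "X \<in> \<D>" "z \<in> X" unfolding \<D>(4)[symmetric] by blast
      with elim have "h z = 0" by blast
      with z show "g z = 0" by (simp add: h_def)
    qed
  qed
  then show ?thesis by (simp add: AE_restrict_space_iff)
qed

section \<open>Symmetry of second derivatives and integration by parts\<close>

lemma has_real_derivative_along:
  fixes f :: "'a::real_normed_vector \<Rightarrow> real"
  assumes "Ck_on (Suc k) UNIV f"
  shows "((\<lambda>t. f (p + t *\<^sub>R v)) has_real_derivative frechet_derivative f (at (p + t *\<^sub>R v)) v) (at t)"
proof -
  have "((\<lambda>t. p + t *\<^sub>R v) has_derivative (\<lambda>t. t *\<^sub>R v)) (at t)"
    by (auto intro!: derivative_eq_intros)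
  from has_derivative_compose[OF this Ck_on_SucD(1)[OF assms]]
  have "((\<lambda>t. f (p + t *\<^sub>R v)) has_derivative (\<lambda>s. frechet_derivative f (at (p + t *\<^sub>R v)) (s *\<^sub>R v))) (at t)" .
  moreover have "frechet_derivative f (at (p + t *\<^sub>R v)) (s *\<^sub>R v) = s * frechet_derivative f (at (p + t *\<^sub>R v)) v" for s
    using linear_scale[OF has_derivative_linear[OF Ck_on_SucD(1)[OF assms]]] by simp
  ultimately show ?thesis by (simp add: has_field_derivative_def mult_commute_abs)
qed

text \<open>
  Two applications of the mean value theorem, the first in the direction \<open>v\<close> and the second in the direction \<open>w\<close>.
\<close>

lemma second_difference_mean_value:
  fixes f :: "'a::real_normed_vector \<Rightarrow> real"
  assumes f: "Ck_on (Suc (Suc k)) UNIV f" and s: "s > 0"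
  shows "\<exists>y. norm (y - x) \<le> s * (norm v + norm w) \<and>
    f (x + s *\<^sub>R v + s *\<^sub>R w) - f (x + s *\<^sub>R v) - f (x + s *\<^sub>R w) + f x
      = s\<^sup>2 * frechet_derivative (\<lambda>x. frechet_derivative f (at x) v) (at y) w"
proof -
  define g where "g x = frechet_derivative f (at x) v" for x
  have g: "Ck_on (Suc k) UNIV g" unfolding g_def[abs_def] by (rule Ck_on_SucD(2)[OF f])
  define d where "d t = f ((x + s *\<^sub>R w) + t *\<^sub>R v) - f (x + t *\<^sub>R v)" for t
  have "(d has_real_derivative g ((x + s *\<^sub>R w) + t *\<^sub>R v) - g (x + t *\<^sub>R v)) (at t)" for t
    unfolding d_def[abs_def] g_def by (intro DERIV_diff has_real_derivative_along[OF f])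
  from MVT2[OF s this] obtain z where z: "0 < z" "z < s"
    "d s - d 0 = s * (g ((x + s *\<^sub>R w) + z *\<^sub>R v) - g (x + z *\<^sub>R v))" by auto
  from MVT2[OF s has_real_derivative_along[OF g, of "x + z *\<^sub>R v" w]] obtain z' where z': "0 < z'" "z' < s"
    "g ((x + z *\<^sub>R v) + s *\<^sub>R w) - g (x + z *\<^sub>R v) = s * frechet_derivative g (at (x + z *\<^sub>R v + z' *\<^sub>R w)) w" by auto
  have "norm ((x + z *\<^sub>R v + z' *\<^sub>R w) - x) \<le> norm (z *\<^sub>R v) + norm (z' *\<^sub>R w)"
    using norm_triangle_ineq[of "z *\<^sub>R v" "z' *\<^sub>R w"] by (simp add: add.assoc)
  also have "\<dots> \<le> s * (norm v + norm w)"
    using z z' by (auto simp: distrib_left intro!: add_mono mult_right_mono)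
  finally have "norm ((x + z *\<^sub>R v + z' *\<^sub>R w) - x) \<le> s * (norm v + norm w)" .
  moreover have "d s - d 0 = s\<^sup>2 * frechet_derivative g (at (x + z *\<^sub>R v + z' *\<^sub>R w)) w"
    using z(3) z'(3) by (simp add: power2_eq_square algebra_simps)
  ultimately show ?thesis
    by (intro exI[of _ "x + z *\<^sub>R v + z' *\<^sub>R w"]) (simp add: d_def g_def[abs_def] algebra_simps)
qed

text \<open>
  The second difference is symmetric in \<open>v\<close> and \<open>w\<close>, and divided by the square of the step it tends to either
  mixed derivative.
\<close>

lemma mixed_derivatives_commute_real:
  fixes f :: "'a::real_normed_vector \<Rightarrow> real"
  assumes f: "Ck_on (Suc (Suc 0)) UNIV f"
  shows "frechet_derivative (\<lambda>x. frechet_derivative f (at x) v) (at x) w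
    = frechet_derivative (\<lambda>x. frechet_derivative f (at x) w) (at x) v"
proof -
  define D where "D v w y = frechet_derivative (\<lambda>x. frechet_derivative f (at x) v) (at y) w" for v w y
  define \<Delta> where "\<Delta> v w s = f (x + s *\<^sub>R v + s *\<^sub>R w) - f (x + s *\<^sub>R v) - f (x + s *\<^sub>R w) + f x" for v w s
  have lim: "(\<lambda>n. \<Delta> v w (1 / Suc n) / (1 / Suc n)\<^sup>2) \<longlonglongrightarrow> D v w x" for v w
  proof -
    have "\<exists>y. norm (y - x) \<le> 1 / Suc n * (norm v + norm w) \<and> \<Delta> v w (1 / Suc n) = (1 / Suc n)\<^sup>2 * D v w y" for n
      using second_difference_mean_value[OF f, of "1 / Suc n" x v w] by (simp add: D_def \<Delta>_def)
    then obtain y where y: "\<And>n. norm (y n - x) \<le> 1 / Suc n * (norm v + norm w)"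
      "\<And>n. \<Delta> v w (1 / Suc n) = (1 / Suc n)\<^sup>2 * D v w (y n)" by metis
    have "(\<lambda>n. 1 / real (Suc n) * (norm v + norm w)) \<longlonglongrightarrow> 0"
      using tendsto_mult_left_zero[OF LIMSEQ_inverse_real_of_nat] by (simp add: inverse_eq_divide)
    then have "(\<lambda>n. y n - x) \<longlonglongrightarrow> 0" by (rule Lim_null_comparison[rotated]) (use y(1) in auto)
    then have "y \<longlonglongrightarrow> x" by (simp add: LIM_zero_iff)
    moreover have "isCont (D v w) x"
      using Ck_on_SucD(2)[OF Ck_on_SucD(2)[OF f], of v w] unfolding D_def[abs_def]
      by (simp add: continuous_on_eq_continuous_at)
    ultimately have "(\<lambda>n. D v w (y n)) \<longlonglongrightarrow> D v w x" by (rule isCont_tendsto_compose[rotated])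
    moreover have "\<Delta> v w (1 / Suc n) / (1 / Suc n)\<^sup>2 = D v w (y n)" for n
      unfolding y(2) by simp
    ultimately show ?thesis by (simp only:)
  qed
  have "\<Delta> v w s = \<Delta> w v s" for s by (simp add: \<Delta>_def algebra_simps)
  then have "D v w x = D w v x" using LIMSEQ_unique[OF lim[of v w]] lim[of w v] by simp
  then show ?thesis by (simp add: D_def)
qed

lemma frechet_derivative_bounded_linear:
  assumes "bounded_linear h" "Ck_on (Suc k) UNIV f"
  shows "frechet_derivative (\<lambda>x. h (f x)) (at x) v = h (frechet_derivative f (at x) v)"
  using frechet_derivative_at[OF bounded_linear.has_derivative[OF assms(1) Ck_on_SucD(1)[OF assms(2)]], of x] by metis

lemma mixed_derivatives_commute:
  fixes f :: "'a::real_normed_vector \<Rightarrow> complex"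
  assumes f: "Ck_on (Suc (Suc 0)) UNIV f"
  shows "frechet_derivative (\<lambda>x. frechet_derivative f (at x) v) (at x) w
    = frechet_derivative (\<lambda>x. frechet_derivative f (at x) w) (at x) v"
proof -
  have "T (frechet_derivative (\<lambda>x. frechet_derivative f (at x) v) (at x) w)
    = T (frechet_derivative (\<lambda>x. frechet_derivative f (at x) w) (at x) v)" if T: "bounded_linear T" for T :: "complex \<Rightarrow> real"
    using mixed_derivatives_commute_real[OF Ck_on_bounded_linear[OF T f], of v x w]
    by (simp add: frechet_derivative_bounded_linear[OF T f] frechet_derivative_bounded_linear[OF T Ck_on_SucD(2)[OF f]])
  from this[OF bounded_linear_Re] this[OF bounded_linear_Im] show ?thesis by (rule complex_eqI)
qed

lemma integrable_compact_support:
  fixes f :: "'a::euclidean_space \<Rightarrow> 'b::{banach, second_countable_topology}"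
  assumes "continuous_on UNIV f" "compact K" "\<And>z. z \<notin> K \<Longrightarrow> f z = 0"
  shows "integrable lborel f"
proof -
  have "(\<lambda>x. indicator K x *\<^sub>R f x) = f" using assms(3) by (auto simp: indicator_def fun_eq_iff)
  then show ?thesis using borel_integrable_compact[OF assms(2), of f] continuous_on_subset[OF assms(1)] by simp
qed

lemma derivative_zero_off_support:
  assumes f: "Ck_on (Suc k) UNIV f" and K: "compact K" "\<And>z. z \<notin> K \<Longrightarrow> f z = 0" and z: "z \<notin> K"
  shows "frechet_derivative f (at z) v = 0"
proof -
  have "((\<lambda>x. 0) has_derivative frechet_derivative f (at z)) (at z)"
    by (rule has_derivative_transform_within_open[OF Ck_on_SucD(1)[OF f], of "- K"])
      (use K z compact_imp_closed in auto)
  from has_derivative_unique[OF this has_derivative_const] show ?thesis by simp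
qed

text \<open>
  The integral of a difference quotient of \<open>f\<close> is \<open>0\<close> by translation invariance.  The difference quotients are
  dominated, because they are values of the derivative (mean value theorem) and vanish outside a fixed ball.
\<close>

lemma integral_derivative_eq_0_real:
  fixes f :: "'a::euclidean_space \<Rightarrow> real"
  assumes f: "Ck_on (Suc k) UNIV f" and K: "compact K" "\<And>z. z \<notin> K \<Longrightarrow> f z = 0"
  shows "(LINT z|lborel. frechet_derivative f (at z) v) = 0"
proof -
  define D where "D z = frechet_derivative f (at z) v" for z
  have "Ck_on 0 UNIV D" unfolding D_def[abs_def]
    using Ck_on_SucD(2)[OF f] by (induction k) (auto dest: Ck_on_Suc_imp simp del: Ck_on.simps)
  then have D: "continuous_on UNIV D" by simp
  have "Ck_on 0 UNIV f" using f by (induction k) (auto dest: Ck_on_Suc_imp simp del: Ck_on.simps)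
  then have cf: "continuous_on UNIV f" by simp
  have Doff: "D z = 0" if "z \<notin> K" for z unfolding D_def by (rule derivative_zero_off_support[OF f K that])
  have "bounded (D ` K)" using K(1) D by (meson compact_continuous_image compact_imp_bounded continuous_on_subset subset_UNIV)
  then obtain M where M: "M > 0" "\<And>z. z \<in> K \<Longrightarrow> \<bar>D z\<bar> \<le> M" by (auto simp: bounded_pos)
  have M': "\<bar>D z\<bar> \<le> M" for z using M Doff[of z] by (cases "z \<in> K") auto
  obtain R where R: "\<And>z. z \<in> K \<Longrightarrow> norm z \<le> R" using compact_imp_bounded[OF K(1)] by (auto simp: bounded_iff)
  define s where "s n z = real (Suc n) * (f ((1 / Suc n) *\<^sub>R v + z) - f z)" for n z
  have lim: "(\<lambda>n. LINT z|lborel. s n z) \<longlonglongrightarrow> (LINT z|lborel. D z)"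
  proof (rule integral_dominated_convergence[where w = "\<lambda>z. M * indicator (cball 0 (R + norm v)) z"])
    show "D \<in> borel_measurable lborel" using D by (simp add: borel_measurable_continuous_onI)
    show "s n \<in> borel_measurable lborel" for n
    proof -
      have "continuous_on UNIV (s n)" unfolding s_def[abs_def]
        by (intro continuous_intros continuous_on_compose2[OF cf]) auto
      then show ?thesis by (simp add: borel_measurable_continuous_onI)
    qed
    show "integrable lborel (\<lambda>z. M * indicator (cball 0 (R + norm v)) z :: real)"
      by (auto intro!: emeasure_bounded_finite)
    show "AE z in lborel. (\<lambda>n. s n z) \<longlonglongrightarrow> D z"
    proof (rule AE_I2)
      fix z
      have "((\<lambda>h. (f (z + (0 + h) *\<^sub>R v) - f (z + 0 *\<^sub>R v)) / h) \<longlongrightarrow> D z) (at 0)"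
        using has_real_derivative_along[OF f, of z v 0] by (simp add: DERIV_def D_def)
      moreover have "filterlim (\<lambda>n. 1 / real (Suc n)) (at 0) sequentially"
        using LIMSEQ_inverse_real_of_nat by (auto simp: filterlim_at inverse_eq_divide)
      ultimately have "(\<lambda>n. (f (z + (0 + 1 / real (Suc n)) *\<^sub>R v) - f (z + 0 *\<^sub>R v)) / (1 / real (Suc n))) \<longlonglongrightarrow> D z"
        by (rule filterlim_compose)
      then show "(\<lambda>n. s n z) \<longlonglongrightarrow> D z" by (simp add: s_def add.commute mult.commute)
    qed
    show "AE z in lborel. norm (s n z) \<le> M * indicator (cball 0 (R + norm v)) z" for n
    proof (rule AE_I2)
      fix z
      show "norm (s n z) \<le> M * indicator (cball 0 (R + norm v)) z"
      proof (cases "z \<in> cball 0 (R + norm v)")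
        case True
        obtain t where "f (z + (1 / Suc n) *\<^sub>R v) - f (z + 0 *\<^sub>R v) = (1 / Suc n) * D (z + t *\<^sub>R v)"
          using MVT2[of 0 "1 / Suc n", OF _ has_real_derivative_along[OF f, of z v]] by (auto simp: D_def)
        then have "s n z = D (z + t *\<^sub>R v)" by (simp add: s_def add.commute)
        then show ?thesis using M' True by simp
      next
        case False
        then have z: "norm z > R + norm v" by simp
        have "norm z \<le> norm ((1 / Suc n) *\<^sub>R v + z) + norm ((1 / Suc n) *\<^sub>R v)"
          using norm_triangle_ineq4[of "(1 / Suc n) *\<^sub>R v + z" "(1 / Suc n) *\<^sub>R v"] by simp
        also have "norm ((1 / Suc n) *\<^sub>R v) \<le> norm v"
          by (simp add: divide_le_eq mult_left_le_one_le) (simp add: distrib_left)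
        finally have "norm ((1 / Suc n) *\<^sub>R v + z) > R" using z by simp
        moreover have "norm z > R" using z norm_ge_zero[of v] by linarith
        ultimately have "(1 / Suc n) *\<^sub>R v + z \<notin> K" "z \<notin> K" using R by force+
        then show ?thesis using K(2) False by (simp add: s_def)
      qed
    qed
  qed
  have "(LINT z|lborel. s n z) = 0" for n
  proof -
    have f_int: "integrable lborel f" by (rule integrable_compact_support[OF cf K])
    have "(LINT z|lborel. f z) = (LINT z|distr lborel borel ((+) ((1 / Suc n) *\<^sub>R v)). f z)"
      by (simp add: lborel_distr_plus)
    also have "\<dots> = (LINT z|lborel. f ((1 / Suc n) *\<^sub>R v + z))"
      by (rule integral_distr) (use f_int in auto)
    finally have shift: "(LINT z|lborel. f ((1 / Suc n) *\<^sub>R v + z)) = (LINT z|lborel. f z)" by simp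
    have "integrable (distr lborel borel ((+) ((1 / Suc n) *\<^sub>R v))) f"
      using f_int by (simp add: lborel_distr_plus)
    then have "integrable lborel (\<lambda>z. f ((1 / Suc n) *\<^sub>R v + z))"
      by (subst (asm) integrable_distr_eq) (use f_int in auto)
    then show ?thesis unfolding s_def using f_int shift by simp
  qed
  then show ?thesis using lim by (simp add: LIMSEQ_const_iff D_def)
qed

lemma integral_derivative_eq_0:
  fixes f :: "'a::euclidean_space \<Rightarrow> complex"
  assumes f: "Ck_on (Suc k) UNIV f" and K: "compact K" "\<And>z. z \<notin> K \<Longrightarrow> f z = 0"
  shows "(LINT z|lborel. frechet_derivative f (at z) v) = 0"
proof -
  have "Ck_on 0 UNIV (\<lambda>z. frechet_derivative f (at z) v)"
    using Ck_on_SucD(2)[OF f] by (induction k) (auto dest: Ck_on_Suc_imp simp del: Ck_on.simps)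
  then have i: "integrable lborel (\<lambda>z. frechet_derivative f (at z) v)"
    by (intro integrable_compact_support[OF _ K(1)] derivative_zero_off_support[OF f K]) auto
  have "T (LINT z|lborel. frechet_derivative f (at z) v) = 0" if T: "bounded_linear T" for T :: "complex \<Rightarrow> real"
  proof -
    have "T (LINT z|lborel. frechet_derivative f (at z) v) = (LINT z|lborel. T (frechet_derivative f (at z) v))"
      by (rule integral_bounded_linear[OF T i, symmetric])
    also have "\<dots> = 0"
      using integral_derivative_eq_0_real[OF Ck_on_bounded_linear[OF T f] K(1), of v] K(2) T
      by (simp add: frechet_derivative_bounded_linear[OF T f] linear_simps)
    finally show ?thesis .
  qed
  from this[OF bounded_linear_Re] this[OF bounded_linear_Im] show ?thesis by (simp add: complex_eq_iff)
qed

section \<open>Exterior algebra and Wirtinger derivatives\<close>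

text \<open>
  Removing \<open>j\<close> from \<open>K\<close> changes the position of \<open>l\<close> exactly if \<open>j < l\<close>, and vice versa; one of the two
  happens.
\<close>

lemma sign_swap:
  fixes K :: "'n::{finite,linorder} set"
  assumes "j \<in> K" "l \<in> K" "j \<noteq> l"
  shows "(-1) ^ card {i\<in>K. i < l} * (-1) ^ card {i\<in>K - {l}. i < j}
    = - ((-1) ^ card {i\<in>K. i < j} * (-1) ^ card {i\<in>K - {j}. i < l} :: complex)"
proof -
  have *: "(-1) ^ card {i\<in>K. i < l} * (-1) ^ card {i\<in>K - {l}. i < j}
    = - ((-1) ^ card {i\<in>K. i < j} * (-1) ^ card {i\<in>K - {j}. i < l} :: complex)"
    if "l < j" "l \<in> K" for j l
  proof -
    have sign: "x * y = - ((- 1 * y) * x)" for x y :: complex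
      by simp
    have 1: "{i\<in>K - {j}. i < l} = {i\<in>K. i < l}" using that by auto
    have "{i\<in>K. i < j} = insert l {i\<in>K - {l}. i < j}" using that by auto
    then have 2: "card {i\<in>K. i < j} = Suc (card {i\<in>K - {l}. i < j})"
      by (simp only:) (rule card_insert_disjoint; simp)
    show ?thesis unfolding 1 2 power_Suc by (rule sign)
  qed
  show ?thesis
  proof (cases "l < j")
    case True
    show ?thesis by (rule *[OF True assms(2)])
  next
    case False
    then have "j < l" using assms by simp
    from *[OF this assms(1)] show ?thesis by (simp only: minus_minus)
  qed
qed

text \<open>
  Exchanging the two outer factors of a threefold wedge product takes three transpositions, hence the sign.
\<close>

lemma wedge_swap:
  "dz_wedge l (dzbar_wedge k (dz_wedge j w)) = - dz_wedge j (dzbar_wedge k (dz_wedge l w))"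
proof (rule vec_eq_iff[THEN iffD2], rule allI)
  fix I :: "'a set \<times> 'a set"
  obtain K L where I: "I = (K, L)" by (cases I)
  show "dz_wedge l (dzbar_wedge k (dz_wedge j w)) $ I = (- dz_wedge j (dzbar_wedge k (dz_wedge l w))) $ I"
  proof (cases "j \<in> K \<and> l \<in> K \<and> j \<noteq> l \<and> k \<in> L")
    case True
    then have jl: "j \<in> K" "l \<in> K" "j \<noteq> l" "l \<noteq> j" "k \<in> L" by auto
    define s where "s i M = (-1 :: complex) ^ card {i'\<in>M. i' < i}" for i and M :: "'a set"
    have eval: "dz_wedge l (dzbar_wedge k (dz_wedge j w)) $ I
        = (s l K * s j (K - {l})) * ((-1) ^ (card (K - {l}) + card {i\<in>L. i < k}) * w $ (K - {l} - {j}, L - {k}))"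
      if "j \<in> K" "l \<in> K" "j \<noteq> l" for j l
    proof -
      have "j \<in> K - {l}" using that by simp
      then show ?thesis using that(2) jl(5) by (simp add: I dz_wedge_def dzbar_wedge_def s_def del: Diff_iff)
    qed
    have "K - {l} - {j} = K - {j} - {l}" "card (K - {l}) = card (K - {j})" using jl by auto
    moreover have "s l K * s j (K - {l}) = - (s j K * s l (K - {j}))"
      unfolding s_def by (rule sign_swap[OF jl(1-3)])
    ultimately show ?thesis
      unfolding vector_uminus_component eval[OF jl(1-3)] eval[OF jl(2,1,4)] by (simp only: mult_minus_left)
  next
    case False
    have "dz_wedge l (dzbar_wedge k (dz_wedge j w)) $ I = 0" if "\<not> (j \<in> K \<and> l \<in> K \<and> j \<noteq> l \<and> k \<in> L)" for j l
      using that by (cases "l \<in> K"; cases "k \<in> L"; cases "j = l"; simp add: I dz_wedge_def dzbar_wedge_def)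
    moreover have "\<not> (l \<in> K \<and> j \<in> K \<and> l \<noteq> j \<and> k \<in> L)" using False by blast
    ultimately show ?thesis using False by (simp only: vector_uminus_component) simp
  qed
qed

lemma dz_wedge_add: "dz_wedge j (v + w) = dz_wedge j v + dz_wedge j w"
  by (auto simp: dz_wedge_def vec_eq_iff algebra_simps)
lemma dzbar_wedge_add: "dzbar_wedge j (v + w) = dzbar_wedge j v + dzbar_wedge j w"
  by (auto simp: dzbar_wedge_def vec_eq_iff algebra_simps)
lemma dz_wedge_cscale: "dz_wedge j (c *s v) = c *s dz_wedge j v"
  by (auto simp: dz_wedge_def vec_eq_iff)
lemma dzbar_wedge_cscale: "dzbar_wedge j (c *s v) = c *s dzbar_wedge j v"
  by (auto simp: dzbar_wedge_def vec_eq_iff)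

lemma scaleR_covec: "r *\<^sub>R (v :: complex ^ 'i::finite) = complex_of_real r *s v"
  by (auto simp: vec_eq_iff scaleR_conv_of_real[where 'a=complex])

lemma bounded_linear_dz_wedge: "bounded_linear (dz_wedge j)"
  unfolding linear_conv_bounded_linear[symmetric]
  by (rule linearI) (simp_all add: dz_wedge_add scaleR_covec dz_wedge_cscale)
lemma bounded_linear_dzbar_wedge: "bounded_linear (dzbar_wedge j)"
  unfolding linear_conv_bounded_linear[symmetric]
  by (rule linearI) (simp_all add: dzbar_wedge_add scaleR_covec dzbar_wedge_cscale)
lemma bounded_linear_cscale: "bounded_linear (\<lambda>v :: complex ^ 'i::finite. c *s v)"
  unfolding linear_conv_bounded_linear[symmetric]
  by (rule linearI) (auto simp add: vec_eq_iff algebra_simps)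
lemma bounded_linear_cscale_left: "bounded_linear (\<lambda>c. c *s (v :: complex ^ 'i::finite))"
  unfolding linear_conv_bounded_linear[symmetric]
  by (rule linearI) (auto simp add: vec_eq_iff algebra_simps)

lemma norm_cscale: "norm (c *s (v :: complex ^ 'i::finite)) = norm c * norm v"
  by (simp add: norm_vec_def L2_set_def norm_mult power_mult_distrib sum_distrib_left[symmetric] real_sqrt_mult)

definition bidegree :: "nat \<Rightarrow> nat \<Rightarrow> ('n::finite) covec \<Rightarrow> bool" where
  "bidegree p q w \<longleftrightarrow> (\<forall>K L. \<not> (card K = p \<and> card L = q) \<longrightarrow> w $ (K, L) = 0)"

lemma bidegree_wedge:
  assumes "bidegree p q w"
  shows "bidegree (p + 1) (q + 1) (dz_wedge j (dzbar_wedge k w))"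
  unfolding bidegree_def
proof (intro allI impI)
  fix K L :: "'a set" assume KL: "\<not> (card K = p + 1 \<and> card L = q + 1)"
  show "dz_wedge j (dzbar_wedge k w) $ (K, L) = 0"
  proof (cases "j \<in> K \<and> k \<in> L")
    case True
    then have "card (K - {j}) + 1 = card K" "card (L - {k}) + 1 = card L"
      using card_Suc_Diff1[of K j] card_Suc_Diff1[of L k] by simp_all
    then have "\<not> (card (K - {j}) = p \<and> card (L - {k}) = q)" using KL by auto
    then have "w $ (K - {j}, L - {k}) = 0" using assms unfolding bidegree_def by blast
    then show ?thesis by (simp add: dz_wedge_def dzbar_wedge_def)
  qed (auto simp: dz_wedge_def dzbar_wedge_def)
qed

text \<open>
  Both Wirtinger derivatives at once: \<open>\<alpha> = - \<i>\<close> gives \<open>\<partial>/\<partial>z\<^sub>j\<close> and \<open>\<alpha> = \<i>\<close> gives its conjugate.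
\<close>

definition wirtinger :: "complex \<Rightarrow> 'n::finite \<Rightarrow> (complex^'n \<Rightarrow> complex) \<Rightarrow> complex^'n \<Rightarrow> complex" where
  "wirtinger \<alpha> j f z =
     (frechet_derivative f (at z) (axis j 1) + \<alpha> * frechet_derivative f (at z) (axis j \<i>)) / 2"

lemma wirt_eq: "wirt = wirtinger (- \<i>)" and wirt_bar_eq: "wirt_bar = wirtinger \<i>"
  by (auto simp: fun_eq_iff wirt_def wirt_bar_def wirtinger_def)

lemma smooth_onD: "smooth_on UNIV f \<Longrightarrow> Ck_on k UNIV f" by (simp add: smooth_on_def)

lemma Ck_on_comb: 
  fixes A B :: "'a::real_normed_vector \<Rightarrow> complex"
  assumes "Ck_on k UNIV A" "Ck_on k UNIV B" shows "Ck_on k UNIV (\<lambda>z. (A z + \<alpha> * B z) / 2)"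
  by (rule Ck_on_bounded_linear[OF bounded_linear_divide])
    (intro Ck_on_add assms Ck_on_bounded_linear[OF bounded_linear_mult_right])

lemma smooth_wirtinger:
  assumes "smooth_on UNIV f" shows "smooth_on UNIV (wirtinger \<alpha> j f)"
  unfolding smooth_on_def wirtinger_def[abs_def]
  by (intro allI Ck_on_comb Ck_on_SucD(2)[OF smooth_onD[OF assms]])

lemma derivative_comb:
  fixes A B :: "'a::real_normed_vector \<Rightarrow> complex"
  assumes "Ck_on (Suc k) UNIV A" "Ck_on (Suc k) UNIV B"
  shows "frechet_derivative (\<lambda>z. (A z + \<alpha> * B z) / 2) (at z) v
    = (frechet_derivative A (at z) v + \<alpha> * frechet_derivative B (at z) v) / 2"
proof -
  have "((\<lambda>z. (A z + \<alpha> * B z) / 2) has_derivative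
      (\<lambda>v. (frechet_derivative A (at z) v + \<alpha> * frechet_derivative B (at z) v) / 2)) (at z)"
    by (rule bounded_linear.has_derivative[OF bounded_linear_divide],
        rule has_derivative_add[OF Ck_on_SucD(1)[OF assms(1)]],
        rule bounded_linear.has_derivative[OF bounded_linear_mult_right Ck_on_SucD(1)[OF assms(2)]])
  from frechet_derivative_at[OF this, symmetric] show ?thesis by simp
qed

lemma wirtinger_commute:
  assumes "smooth_on UNIV f"
  shows "wirtinger \<alpha> j (wirtinger \<beta> k f) = wirtinger \<beta> k (wirtinger \<alpha> j f)"
proof
  fix z
  note D = Ck_on_SucD(2)[OF smooth_onD[OF assms]]
  note c = mixed_derivatives_commute[OF smooth_onD[OF assms], where x = z]
  define d where "d v w = frechet_derivative (\<lambda>x. frechet_derivative f (at x) v) (at z) w" for v w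
  have d_commute: "d v w = d w v" for v w unfolding d_def by (rule c)
  have fw: "frechet_derivative (wirtinger \<beta> k f) (at z) w = (d (axis k 1) w + \<beta> * d (axis k \<i>) w) / 2" for \<beta> k w
    using derivative_comb[OF D[of "Suc 0" "axis k 1"] D[of "Suc 0" "axis k \<i>"], of \<beta> z w]
    by (simp only: wirtinger_def[of \<beta> k f, abs_def] d_def)
  have e: "wirtinger \<alpha> j (wirtinger \<beta> k f) z =
      ((d (axis k 1) (axis j 1) + \<beta> * d (axis k \<i>) (axis j 1)) / 2
     + \<alpha> * ((d (axis k 1) (axis j \<i>) + \<beta> * d (axis k \<i>) (axis j \<i>)) / 2)) / 2"
    for \<alpha> \<beta> j k
    unfolding wirtinger_def[of \<alpha> j "wirtinger \<beta> k f"] fw ..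
  have alg: "((A + \<beta> * B) / 2 + \<alpha> * ((C + \<beta> * E) / 2)) / 2
      = ((A + \<alpha> * C) / 2 + \<beta> * ((B + \<alpha> * E) / 2)) / 2" for A B C E :: complex
    by (simp add: add_divide_distrib distrib_left mult.left_commute)
  show "wirtinger \<alpha> j (wirtinger \<beta> k f) z = wirtinger \<beta> k (wirtinger \<alpha> j f) z"
    unfolding e d_commute[of "axis j _"] by (rule alg)
qed

lemma test_function_support:
  assumes "test_function \<Omega> f"
  obtains K where "compact K" "K \<subseteq> \<Omega>" "\<And>z. z \<notin> K \<Longrightarrow> f z = 0"
proof
  show "compact (closure {z. f z \<noteq> 0})" "closure {z. f z \<noteq> 0} \<subseteq> \<Omega>"
    using assms unfolding test_function_def by simp_all
  fix z assume "z \<notin> closure {z. f z \<noteq> 0}"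
  then have "z \<notin> {z. f z \<noteq> 0}" by (rule contra_subsetD[OF closure_subset])
  then show "f z = 0" by simp
qed

lemma test_functionI:
  assumes "smooth_on UNIV f" "compact K" "K \<subseteq> \<Omega>" "\<And>z. z \<notin> K \<Longrightarrow> f z = 0"
  shows "test_function \<Omega> f"
proof -
  have "{z. f z \<noteq> 0} \<subseteq> K" using assms(4) by auto
  then have sub: "closure {z. f z \<noteq> 0} \<subseteq> K"
    by (rule closure_minimal) (rule compact_imp_closed[OF assms(2)])
  then have "compact (closure {z. f z \<noteq> 0})"
    using compact_Int_closed[OF assms(2) closed_closure[of "{z. f z \<noteq> 0}"]] by (simp add: inf.absorb2)
  with sub show ?thesis using assms(1,3) unfolding test_function_def by simp
qed

lemma test_function_smooth: "test_function \<Omega> f \<Longrightarrow> smooth_on UNIV f" by (simp add: test_function_def)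

lemma test_function_wirtinger:
  assumes "test_function \<Omega> f" shows "test_function \<Omega> (wirtinger \<alpha> j f)"
proof -
  obtain K where K: "compact K" "K \<subseteq> \<Omega>" "\<And>z. z \<notin> K \<Longrightarrow> f z = 0"
    by (rule test_function_support[OF assms]) (rule that)
  show ?thesis
  proof (rule test_functionI[OF smooth_wirtinger[OF test_function_smooth[OF assms]] K(1,2)])
    fix z assume "z \<notin> K"
    then show "wirtinger \<alpha> j f z = 0"
      unfolding wirtinger_def
      using derivative_zero_off_support[OF smooth_onD[OF test_function_smooth[OF assms]] K(1,3)] by simp
  qed
qed

lemma test_function_mult:
  assumes "test_function \<Omega> f" "smooth_on UNIV g" shows "test_function \<Omega> (\<lambda>z. f z * g z)"
proof -
  obtain K where K: "compact K" "K \<subseteq> \<Omega>" "\<And>z. z \<notin> K \<Longrightarrow> f z = 0"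
    by (rule test_function_support[OF assms(1)]) (rule that)
  show ?thesis
  proof (rule test_functionI[OF _ K(1,2)])
    show "smooth_on UNIV (\<lambda>z. f z * g z)"
      unfolding smooth_on_def
      by (intro allI Ck_on_mult smooth_onD assms(2) test_function_smooth[OF assms(1)])
  qed (simp add: K(3))
qed

lemma test_function_continuous: "test_function \<Omega> f \<Longrightarrow> continuous_on UNIV f"
  using smooth_onD[OF test_function_smooth, of \<Omega> f 0] by simp

lemma test_function_integrable:
  assumes "test_function \<Omega> f" shows "integrable lborel f"
  by (rule test_function_support[OF assms]) (rule integrable_compact_support[OF test_function_continuous[OF assms]])

lemma integral_derivative_mult:
  assumes f: "test_function \<Omega> f" and g: "test_function \<Omega> g"
  shows "(LINT z|lborel. frechet_derivative f (at z) v * g z) = - (LINT z|lborel. f z * frechet_derivative g (at z) v)"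
    and "integrable lborel (\<lambda>z. frechet_derivative f (at z) v * g z)"
    and "integrable lborel (\<lambda>z. f z * frechet_derivative g (at z) v)"
proof -
  note sf = smooth_onD[OF test_function_smooth[OF f]] and sg = smooth_onD[OF test_function_smooth[OF g]]
  obtain K where K: "compact K" "\<And>z. z \<notin> K \<Longrightarrow> f z = 0" 
    by (rule test_function_support[OF f]) (rule that)
  have D: "frechet_derivative (\<lambda>z. f z * g z) (at z) v
      = f z * frechet_derivative g (at z) v + frechet_derivative f (at z) v * g z" for z
  proof -
    have "((\<lambda>z. f z * g z) has_derivative
        (\<lambda>v. f z * frechet_derivative g (at z) v + frechet_derivative f (at z) v * g z)) (at z)"
      by (rule has_derivative_mult[OF Ck_on_SucD(1)[OF sf] Ck_on_SucD(1)[OF sg]])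
    from frechet_derivative_at[OF this, symmetric] show ?thesis by simp
  qed
  have cf: "continuous_on UNIV (\<lambda>z. f z * frechet_derivative g (at z) v)"
    and cg: "continuous_on UNIV (\<lambda>z. frechet_derivative f (at z) v * g z)"
    using Ck_on_mult[OF sf Ck_on_SucD(2)[OF sg], of 0] Ck_on_mult[OF Ck_on_SucD(2)[OF sf] sg, of 0] by simp_all
  show i1: "integrable lborel (\<lambda>z. frechet_derivative f (at z) v * g z)"
    by (rule integrable_compact_support[OF cg K(1)]) (simp add: derivative_zero_off_support[OF sf K])
  show i2: "integrable lborel (\<lambda>z. f z * frechet_derivative g (at z) v)"
    by (rule integrable_compact_support[OF cf K(1)]) (simp add: K(2))
  have "(LINT z|lborel. frechet_derivative (\<lambda>z. f z * g z) (at z) v) = 0"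
    by (rule integral_derivative_eq_0[OF Ck_on_mult[OF sf sg] K(1)]) (simp add: K(2))
  then show "(LINT z|lborel. frechet_derivative f (at z) v * g z) = - (LINT z|lborel. f z * frechet_derivative g (at z) v)"
    unfolding D using i1 i2 by (simp add: eq_neg_iff_add_eq_0 add.commute)
qed

lemma integral_wirtinger_mult:
  assumes f: "test_function \<Omega> f" and g: "test_function \<Omega> g"
  shows "(LINT z|lborel. wirtinger \<alpha> j f z * g z) = - (LINT z|lborel. f z * wirtinger \<alpha> j g z)"
proof -
  note i = integral_derivative_mult[OF f g]
  have "(LINT z|lborel. wirtinger \<alpha> j f z * g z)
     = (LINT z|lborel. (1/2) * (frechet_derivative f (at z) (axis j 1) * g z) + (\<alpha>/2) * (frechet_derivative f (at z) (axis j \<i>) * g z))"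
    by (rule Bochner_Integration.integral_cong) (auto simp: wirtinger_def field_simps)
  also have "\<dots> = - ((1/2) * (LINT z|lborel. f z * frechet_derivative g (at z) (axis j 1)) + (\<alpha>/2) * (LINT z|lborel. f z * frechet_derivative g (at z) (axis j \<i>)))"
  proof -
    have "(LINT z|lborel. (1/2) * (frechet_derivative f (at z) (axis j 1) * g z) + (\<alpha>/2) * (frechet_derivative f (at z) (axis j \<i>) * g z))
      = (1/2) * (LINT z|lborel. frechet_derivative f (at z) (axis j 1) * g z) + (\<alpha>/2) * (LINT z|lborel. frechet_derivative f (at z) (axis j \<i>) * g z)"
      using i(2) by simp
    then show ?thesis unfolding i(1) by (simp only: mult_minus_right minus_add_distrib)
  qed
  also have "\<dots> = - (LINT z|lborel. (1/2) * (f z * frechet_derivative g (at z) (axis j 1)) + (\<alpha>/2) * (f z * frechet_derivative g (at z) (axis j \<i>)))"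
    using i(3) by simp
  also have "(LINT z|lborel. (1/2) * (f z * frechet_derivative g (at z) (axis j 1)) + (\<alpha>/2) * (f z * frechet_derivative g (at z) (axis j \<i>)))
     = (LINT z|lborel. f z * wirtinger \<alpha> j g z)"
    by (rule Bochner_Integration.integral_cong) (auto simp: wirtinger_def field_simps)
  finally show ?thesis .
qed

lemma integral_wirt_wirt_bar_mult:
  assumes f: "test_function \<Omega> f" and g: "test_function \<Omega> g"
  shows "(LINT z|lborel. wirt j (wirt_bar k f) z * g z) = (LINT z|lborel. f z * wirt j (wirt_bar k g) z)"
proof -
  have "(LINT z|lborel. wirtinger \<alpha> j (wirtinger \<beta> k f) z * g z) = (LINT z|lborel. f z * wirtinger \<beta> k (wirtinger \<alpha> j g) z)" for \<alpha> \<beta>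
    using integral_wirtinger_mult[OF test_function_wirtinger[OF f] g]
      integral_wirtinger_mult[OF f test_function_wirtinger[OF g]] by simp
  then show ?thesis by (simp add: wirt_eq wirt_bar_eq wirtinger_commute[OF test_function_smooth[OF g]])
qed

lemma iterated_wirtinger_swap:
  assumes "test_function \<Omega> f"
  shows "wirt l (wirt_bar m (wirt j (wirt_bar k f))) = wirt j (wirt_bar m (wirt l (wirt_bar k f)))"
proof -
  have s: "smooth_on UNIV (wirtinger \<alpha> i f)" "smooth_on UNIV (wirtinger \<beta> i' (wirtinger \<alpha> i f))" for \<alpha> \<beta> i i'
    by (intro smooth_wirtinger test_function_smooth[OF assms])+
  have "wirt l (wirt_bar m (wirt j (wirt_bar k f))) = wirt l (wirt j (wirt_bar m (wirt_bar k f)))"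
    unfolding wirt_eq wirt_bar_eq by (subst wirtinger_commute[OF s(1)]) (rule refl)
  also have "\<dots> = wirt j (wirt l (wirt_bar m (wirt_bar k f)))"
    unfolding wirt_eq wirt_bar_eq by (rule wirtinger_commute[OF s(2)])
  also have "\<dots> = wirt j (wirt_bar m (wirt l (wirt_bar k f)))"
    unfolding wirt_eq wirt_bar_eq by (subst wirtinger_commute[OF s(1)]) (rule refl)
  finally show ?thesis .
qed

section \<open>The weak operator on classes of forms\<close>

lemma sqint_compact_support:
  fixes f :: "'a::euclidean_space \<Rightarrow> 'b::euclidean_space"
  assumes f: "continuous_on UNIV f" and K: "compact K" "\<And>z. z \<notin> K \<Longrightarrow> f z = 0"
  shows "sqint f"
proof -
  have c: "continuous_on UNIV (\<lambda>z. (norm (f z))\<^sup>2)" by (intro continuous_intros f)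
  have "integrable lborel (\<lambda>z. (norm (f z))\<^sup>2)"
    by (rule integrable_compact_support[OF c K(1)]) (simp add: K(2))
  then have "integrable lebesgue (\<lambda>z. (norm (f z))\<^sup>2)"
    by (subst integrable_completion) (auto intro: borel_measurable_continuous_onI[OF c])
  then show ?thesis using continuous_lebesgue_measurable[OF f] by (simp add: sqint_def)
qed

lemma sqint_test_function: assumes "test_function \<Omega> \<phi>" shows "sqint \<phi>"
proof -
  obtain K where "compact K" "K \<subseteq> \<Omega>" "\<And>z. z \<notin> K \<Longrightarrow> \<phi> z = 0"
    by (rule test_function_support[OF assms]) (rule that)
  then show ?thesis by (intro sqint_compact_support[OF test_function_continuous[OF assms]])
qed

lemma sqint_norm: "sqint f \<Longrightarrow> sqint (\<lambda>z. norm (f z))" by (auto simp: sqint_def)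

lemma sqint_bounded_linear:
  assumes h: "bounded_linear h" "\<And>w. norm (h w) \<le> C * norm w" and f: "sqint f"
  shows "sqint (\<lambda>z. h (f z))"
  unfolding sqint_def
proof
  have [measurable]: "f \<in> borel_measurable lebesgue" using f by (simp add: sqint_def)
  have "h \<in> borel_measurable borel" using h(1) by (intro borel_measurable_continuous_onI linear_continuous_on)
  from measurable_compose[OF _ this, of f lebesgue]
  show m[measurable]: "(\<lambda>z. h (f z)) \<in> borel_measurable lebesgue" by simp
  show "integrable lebesgue (\<lambda>z. (norm (h (f z)))\<^sup>2)"
  proof (rule Bochner_Integration.integrable_bound)
    show "integrable lebesgue (\<lambda>z. C\<^sup>2 * (norm (f z))\<^sup>2)" using f by (simp add: sqint_def)
    show "AE z in lebesgue. norm ((norm (h (f z)))\<^sup>2) \<le> norm (C\<^sup>2 * (norm (f z))\<^sup>2)"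
      using h(2) power_mono[OF h(2), of _ 2] by (intro AE_I2) (simp add: power_mult_distrib)
  qed simp
qed

lemma sqint_cscale: "sqint f \<Longrightarrow> sqint (\<lambda>z. c *s (f z :: complex ^ 'i::finite))"
  by (rule sqint_bounded_linear[OF bounded_linear_cscale, of _ "norm c"]) (simp_all add: norm_cscale)

definition cmul :: "complex \<Rightarrow> ('a::euclidean_space, complex ^ 'i::finite) lsq \<Rightarrow> ('a, complex ^ 'i) lsq" where
  "cmul c x = abs_lsq (\<lambda>z. c *s rep_lsq x z)"

lemma cmul_abs_lsq: assumes "sqint f" shows "cmul c (abs_lsq f) = abs_lsq (\<lambda>z. c *s f z)"
proof -
  have "AE z in lebesgue. rep_lsq (abs_lsq f) z = f z"
    using rep_lsq[of "abs_lsq f"] assms abs_lsq_eq_iff by blast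
  then have "AE z in lebesgue. c *s rep_lsq (abs_lsq f) z = c *s f z" by eventually_elim simp
  then show ?thesis unfolding cmul_def using assms rep_lsq sqint_cscale by (subst abs_lsq_eq_iff) auto
qed

lemma cmul_add: "cmul c (x + y) = cmul c x + cmul c y"
proof -
  obtain f g where fg: "x = abs_lsq f" "sqint f" "y = abs_lsq g" "sqint g" using rep_lsq by metis
  then show ?thesis by (simp add: add_abs_lsq cmul_abs_lsq sqint_add sqint_cscale vector_add_ldistrib)
qed

lemma cmul_zero: "cmul c 0 = 0"
  using cmul_add[of c 0 0] by simp

lemma cmul_diff: "cmul c (x - y) = cmul c x - cmul c y"
  using cmul_add[of c "x - y" y] by simp

lemma cscale_inner: "(c *s v) \<bullet> w = v \<bullet> (cnj c *s w :: complex ^ 'i::finite)"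
  by (simp add: inner_vec_def inner_complex_def algebra_simps)

lemma inner_cmul: "cmul c x \<bullet> y = x \<bullet> cmul (cnj c) y"
proof -
  obtain f g where fg: "x = abs_lsq f" "sqint f" "y = abs_lsq g" "sqint g" using rep_lsq by metis
  then show ?thesis by (simp add: cmul_abs_lsq inner_abs_lsq sqint_cscale cscale_inner)
qed

lemma integrable_cscale_mult:
  fixes f :: "'a::euclidean_space \<Rightarrow> complex ^ 'i::finite"
  assumes "sqint \<phi>" "sqint f"
  shows "integrable lebesgue (\<lambda>z. \<phi> z *s f z)"
proof -
  have i: "integrable lebesgue (\<lambda>z. norm (\<phi> z) \<bullet> norm (f z))"
    by (intro sqint_inner sqint_norm assms)
  have [measurable]: "\<phi> \<in> borel_measurable lebesgue" "f \<in> borel_measurable lebesgue" using assms by (auto simp: sqint_def)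
  have "(\<lambda>p. fst p *s snd p :: complex ^ 'i) \<in> borel_measurable borel"
    by (rule borel_measurable_continuous_onI)
      (simp add: vector_scalar_mult_def continuous_intros continuous_on_vec_lambda)
  from measurable_compose[OF _ this, of "\<lambda>z. (\<phi> z, f z)" lebesgue]
  have "(\<lambda>z. \<phi> z *s f z) \<in> borel_measurable lebesgue" by (simp add: borel_measurable_Pair)
  then show ?thesis
    by (rule Bochner_Integration.integrable_bound[OF i]) (simp add: norm_cscale)
qed

text \<open>
  Integration against a fixed function; it is continuous in the class (\<open>bounded_linear_test_integral\<close>), which is why the
  distributional operator has a closed graph.
\<close>

definition test_integral :: "('a::euclidean_space \<Rightarrow> complex) \<Rightarrow> ('a, complex ^ 'i::finite) lsq \<Rightarrow> complex ^ 'i" where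
  "test_integral \<phi> x = (LINT z|lebesgue. \<phi> z *s rep_lsq x z)"

lemma test_integral_abs_lsq:
  assumes "sqint \<phi>" "sqint f" shows "test_integral \<phi> (abs_lsq f) = (LINT z|lebesgue. \<phi> z *s f z)"
proof -
  have "AE z in lebesgue. rep_lsq (abs_lsq f) z = f z"
    using rep_lsq[of "abs_lsq f"] assms abs_lsq_eq_iff by blast
  then have "AE z in lebesgue. \<phi> z *s rep_lsq (abs_lsq f) z = \<phi> z *s f z" by eventually_elim simp
  then show ?thesis unfolding test_integral_def
    by (intro integral_cong_AE borel_measurable_integrable integrable_cscale_mult assms rep_lsq(1))
qed

text \<open>
  The bound is the Cauchy--Schwarz inequality, applied to the classes of the real functions
  \<open>norm \<circ> \<phi>\<close> and \<open>norm \<circ> f\<close>.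
\<close>

lemma bounded_linear_test_integral:
  assumes \<phi>: "sqint \<phi>"
  shows "bounded_linear (test_integral \<phi> :: ('a::euclidean_space, complex ^ 'i::finite) lsq \<Rightarrow> complex ^ 'i)"
proof (rule bounded_linear_intro)
  fix x y :: "('a, complex ^ 'i) lsq" and r :: real
  obtain f g where fg: "x = abs_lsq f" "sqint f" "y = abs_lsq g" "sqint g" using rep_lsq by metis
  note i = integrable_cscale_mult[OF \<phi> fg(2)] integrable_cscale_mult[OF \<phi> fg(4)]
  show "test_integral \<phi> (x + y) = test_integral \<phi> x + test_integral \<phi> y"
    using i by (simp add: fg add_abs_lsq test_integral_abs_lsq \<phi> sqint_add vector_add_ldistrib)
  have "\<phi> z *s (r *\<^sub>R f z) = r *\<^sub>R (\<phi> z *s f z)" for z by (simp add: vec_eq_iff)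
  then show "test_integral \<phi> (r *\<^sub>R x) = r *\<^sub>R test_integral \<phi> x"
    by (simp add: fg scaleR_abs_lsq test_integral_abs_lsq \<phi> sqint_scale)
  have "norm (test_integral \<phi> x) \<le> (LINT z|lebesgue. norm (\<phi> z *s f z))"
    by (simp add: fg test_integral_abs_lsq \<phi>)
  also have "\<dots> = abs_lsq (\<lambda>z. norm (\<phi> z)) \<bullet> abs_lsq (\<lambda>z. norm (f z))"
    by (simp add: inner_abs_lsq sqint_norm \<phi> fg norm_cscale)
  also have "\<dots> \<le> norm (abs_lsq (\<lambda>z. norm (\<phi> z))) * norm (abs_lsq (\<lambda>z. norm (f z)))"
    by (rule norm_cauchy_schwarz)
  also have "norm (abs_lsq (\<lambda>z. norm (f z))) = norm x"
    by (simp add: fg norm_abs_lsq sqint_norm)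
  finally show "norm (test_integral \<phi> x) \<le> norm x * norm (abs_lsq (\<lambda>z. norm (\<phi> z)))" by (simp add: mult.commute)
qed

lemma test_integral_cmul: assumes \<phi>: "sqint \<phi>" shows "test_integral \<phi> (cmul c x) = c *s test_integral \<phi> x"
proof -
  obtain f where f: "x = abs_lsq f" "sqint f" using rep_lsq by metis
  have "test_integral \<phi> (cmul c x) = (LINT z|lebesgue. c *s (\<phi> z *s f z))"
    by (simp add: f cmul_abs_lsq test_integral_abs_lsq \<phi> sqint_cscale vec_eq_iff algebra_simps)
  also have "\<dots> = c *s test_integral \<phi> x"
    using integral_bounded_linear[OF bounded_linear_cscale integrable_cscale_mult[OF \<phi> f(2)], of c]
    by (simp add: f test_integral_abs_lsq \<phi>)
  finally show ?thesis .
qed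

type_synonym 'n form_class = "(complex^'n, 'n covec) lsq"

text \<open>
The relation \<open>weak_ddbar\<close>, transported to classes.
\<close>

definition weak_rel :: "(complex^'n::{finite,linorder}) set \<Rightarrow> 'n form_class \<Rightarrow> 'n form_class \<Rightarrow> bool" where
  "weak_rel \<Omega> x y \<longleftrightarrow> (\<forall>\<phi>. test_function \<Omega> \<phi> \<longrightarrow>
     test_integral \<phi> y = (\<Sum>j\<in>UNIV. \<Sum>k\<in>UNIV. dz_wedge j (dzbar_wedge k (test_integral (wirt j (wirt_bar k \<phi>)) x))))"

lemma test_function_wirt_wirt_bar: "test_function \<Omega> \<phi> \<Longrightarrow> test_function \<Omega> (wirt j (wirt_bar k \<phi>))"
  unfolding wirt_eq wirt_bar_eq by (intro test_function_wirtinger)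

lemma bounded_linear_weak_rel:
  assumes \<phi>: "test_function \<Omega> \<phi>"
  shows "bounded_linear (\<lambda>x. \<Sum>j\<in>UNIV. \<Sum>k\<in>UNIV. dz_wedge j (dzbar_wedge k (test_integral (wirt j (wirt_bar k \<phi>)) x)))"
  by (intro bounded_linear_sum bounded_linear_compose[OF bounded_linear_dz_wedge]
      bounded_linear_compose[OF bounded_linear_dzbar_wedge]
      bounded_linear_test_integral sqint_test_function[OF test_function_wirt_wirt_bar[OF \<phi>]])

lemma weak_rel_subspace: "subspace {(x, y). weak_rel \<Omega> x y}"
proof (rule subspaceI)
  note s = bounded_linear_weak_rel bounded_linear_test_integral[OF sqint_test_function]
  show "0 \<in> {(x, y). weak_rel \<Omega> x y}"
    by (simp add: weak_rel_def zero_prod_def linear_simps(3)[OF s(1)] linear_simps(3)[OF s(2)])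
  fix p q :: "'a form_class \<times> 'a form_class"
  assume "p \<in> {(x, y). weak_rel \<Omega> x y}" "q \<in> {(x, y). weak_rel \<Omega> x y}"
  then show "p + q \<in> {(x, y). weak_rel \<Omega> x y}"
    by (cases p; cases q) (simp add: weak_rel_def linear_simps(1)[OF s(1)] linear_simps(1)[OF s(2)])
next
  note s = bounded_linear_weak_rel bounded_linear_test_integral[OF sqint_test_function]
  fix c and p :: "'a form_class \<times> 'a form_class"
  assume "p \<in> {(x, y). weak_rel \<Omega> x y}"
  then show "c *\<^sub>R p \<in> {(x, y). weak_rel \<Omega> x y}"
    by (cases p) (simp add: weak_rel_def linear_simps(5)[OF s(1)] linear_simps(5)[OF s(2)])
qed

lemma weak_rel_closed: "closed {(x, y). weak_rel \<Omega> x y}"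
proof -
  have "{(x, y). weak_rel \<Omega> x y} = (\<Inter>\<phi>\<in>{\<phi>. test_function \<Omega> \<phi>}. {p. test_integral \<phi> (snd p) =
     (\<Sum>j\<in>UNIV. \<Sum>k\<in>UNIV. dz_wedge j (dzbar_wedge k (test_integral (wirt j (wirt_bar k \<phi>)) (fst p))))})"
    by (auto simp: weak_rel_def)
  also have "closed \<dots>"
  proof (intro closed_INT ballI closed_Collect_eq)
    fix \<phi> assume "\<phi> \<in> {\<phi>. test_function \<Omega> \<phi>}"
    then have \<phi>: "test_function \<Omega> \<phi>" by simp
    show "continuous_on UNIV (\<lambda>p :: 'a form_class \<times> 'a form_class. test_integral \<phi> (snd p))"
      by (intro bounded_linear.continuous_on[OF bounded_linear_test_integral[OF sqint_test_function[OF \<phi>]]] continuous_intros)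
    show "continuous_on UNIV (\<lambda>p :: 'a form_class \<times> 'a form_class.
      \<Sum>j\<in>UNIV. \<Sum>k\<in>UNIV. dz_wedge j (dzbar_wedge k (test_integral (wirt j (wirt_bar k \<phi>)) (fst p))))"
      by (intro bounded_linear.continuous_on[OF bounded_linear_weak_rel[OF \<phi>]] continuous_intros)
  qed
  finally show ?thesis .
qed

lemma weak_rel_cmul: assumes "weak_rel \<Omega> x y" shows "weak_rel \<Omega> (cmul c x) (cmul c y)"
  unfolding weak_rel_def
proof (intro allI impI)
  fix \<phi> assume \<phi>: "test_function \<Omega> \<phi>"
  note t = sqint_test_function[OF \<phi>] sqint_test_function[OF test_function_wirt_wirt_bar[OF \<phi>]]
  have "test_integral \<phi> (cmul c y) = c *s (\<Sum>j\<in>UNIV. \<Sum>k\<in>UNIV. dz_wedge j (dzbar_wedge k (test_integral (wirt j (wirt_bar k \<phi>)) x)))"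
    using assms \<phi> by (simp add: test_integral_cmul t weak_rel_def)
  also have "\<dots> = (\<Sum>j\<in>UNIV. \<Sum>k\<in>UNIV. dz_wedge j (dzbar_wedge k (test_integral (wirt j (wirt_bar k \<phi>)) (cmul c x))))"
    by (simp add: test_integral_cmul t dz_wedge_cscale dzbar_wedge_cscale
      bounded_linear.linear[OF bounded_linear_cscale, THEN linear_sum])
  finally show "test_integral \<phi> (cmul c y) = (\<Sum>j\<in>UNIV. \<Sum>k\<in>UNIV. dz_wedge j (dzbar_wedge k (test_integral (wirt j (wirt_bar k \<phi>)) (cmul c x))))" .
qed

text \<open>
  The square of \<open>\<partial>\<partial>\<close>-bar is zero.  Testing twice gives a fourfold sum of wedge products; exchanging the two
  holomorphic indices leaves the derivative of the test function unchanged and reverses the sign of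
  the wedge product.
\<close>

lemma weak_rel_square: assumes "weak_rel \<Omega> x y" shows "weak_rel \<Omega> y 0"
  unfolding weak_rel_def
proof (intro allI impI)
  fix \<phi> assume \<phi>: "test_function \<Omega> \<phi>"
  define B where "B j k l m = dz_wedge j (dzbar_wedge k (dz_wedge l (dzbar_wedge m
      (test_integral (wirt l (wirt_bar m (wirt j (wirt_bar k \<phi>)))) x))))" for j k l m
  have B_swap: "B j k l m = - B l k j m" for j k l m
    unfolding B_def iterated_wirtinger_swap[OF \<phi>, of l m j k] by (rule wedge_swap)
  define A where "A = (\<Sum>j\<in>UNIV. \<Sum>k\<in>UNIV. \<Sum>l\<in>UNIV. \<Sum>m\<in>UNIV. B j k l m)"
  have "(\<Sum>j\<in>UNIV. \<Sum>k\<in>UNIV. dz_wedge j (dzbar_wedge k (test_integral (wirt j (wirt_bar k \<phi>)) y))) = A"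
  proof -
    have "dz_wedge j (dzbar_wedge k (test_integral (wirt j (wirt_bar k \<phi>)) y)) = (\<Sum>l\<in>UNIV. \<Sum>m\<in>UNIV. B j k l m)" for j k
    proof -
      have "test_integral (wirt j (wirt_bar k \<phi>)) y = (\<Sum>l\<in>UNIV. \<Sum>m\<in>UNIV. dz_wedge l (dzbar_wedge m
          (test_integral (wirt l (wirt_bar m (wirt j (wirt_bar k \<phi>)))) x)))"
        using assms test_function_wirt_wirt_bar[OF \<phi>] unfolding weak_rel_def by blast
      then show ?thesis unfolding B_def
        by (simp only: bounded_linear.linear[OF bounded_linear_dz_wedge, THEN linear_sum]
            bounded_linear.linear[OF bounded_linear_dzbar_wedge, THEN linear_sum])
    qed
    then show ?thesis unfolding A_def by (simp only:)
  qed
  moreover have "A = - A"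
  proof -
    have "A = (\<Sum>k\<in>UNIV. \<Sum>j\<in>UNIV. \<Sum>l\<in>UNIV. \<Sum>m\<in>UNIV. B j k l m)"
      unfolding A_def by (rule sum.swap)
    also have "\<dots> = (\<Sum>k\<in>UNIV. \<Sum>l\<in>UNIV. \<Sum>j\<in>UNIV. \<Sum>m\<in>UNIV. B j k l m)"
      by (intro sum.cong refl sum.swap)
    also have "\<dots> = (\<Sum>k\<in>UNIV. \<Sum>l\<in>UNIV. \<Sum>j\<in>UNIV. \<Sum>m\<in>UNIV. - B l k j m)"
      by (intro sum.cong refl B_swap)
    also have "\<dots> = - (\<Sum>k\<in>UNIV. \<Sum>l\<in>UNIV. \<Sum>j\<in>UNIV. \<Sum>m\<in>UNIV. B l k j m)"
      by (simp only: sum_negf)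
    also have "\<dots> = - A" unfolding A_def by (subst sum.swap) (rule refl)
    finally show ?thesis .
  qed
  then have "A = 0" by (simp add: vec_eq_iff)
  moreover have "test_integral \<phi> 0 = 0"
    using linear_simps(3)[OF bounded_linear_test_integral[OF sqint_test_function[OF \<phi>]]] .
  ultimately show "test_integral \<phi> 0 = (\<Sum>j\<in>UNIV. \<Sum>k\<in>UNIV. dz_wedge j (dzbar_wedge k (test_integral (wirt j (wirt_bar k \<phi>)) y)))" by simp
qed

section \<open>Forms on a bounded domain\<close>

text \<open>
  Boundedness is used to make square-integrable coefficients integrable, so that
  \<open>test_functions_separate\<close> applies to them.
\<close>

locale bounded_domain =
  fixes \<Omega> :: "(complex^'n::{finite,linorder}) set"
  assumes open_domain: "open \<Omega>" and bounded_domain: "bounded \<Omega>"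
begin

lemma domain_measurable[simp]: "\<Omega> \<in> sets lebesgue" using open_domain by simp

definition extend :: "'n form \<Rightarrow> 'n form" where "extend f z = (if z \<in> \<Omega> then f z else 0)"
definition cls :: "'n form \<Rightarrow> 'n form_class" where "cls f = abs_lsq (extend f)"

lemma L2_iff: "f \<in> L2 \<Omega> p q \<longleftrightarrow> sqint (extend f) \<and> (\<forall>z\<in>\<Omega>. bidegree p q (f z))"
proof -
  have "f \<in> borel_measurable (lebesgue_on \<Omega>) \<longleftrightarrow> extend f \<in> borel_measurable lebesgue"
    unfolding extend_def[abs_def] by (rule borel_measurable_if[symmetric]) simp
  moreover have "integrable (lebesgue_on \<Omega>) (\<lambda>z. (norm (f z))\<^sup>2) \<longleftrightarrow> integrable lebesgue (\<lambda>z. (norm (extend f z))\<^sup>2)"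
    by (subst integrable_restrict_space) (auto simp: extend_def intro!: Bochner_Integration.integrable_cong)
  ultimately show ?thesis by (auto simp: L2_def sqint_def bidegree_def)
qed

lemma L2_sqint: "f \<in> L2 \<Omega> p q \<Longrightarrow> sqint (extend f)" by (simp add: L2_iff)

lemma cls_eq_iff: "sqint (extend f) \<Longrightarrow> sqint (extend g) \<Longrightarrow> cls f = cls g \<longleftrightarrow> ae_eq \<Omega> f g"
  unfolding cls_def ae_eq_def
  by (simp add: abs_lsq_eq_iff AE_restrict_space_iff extend_def)

lemma extend_add: "extend (\<lambda>z. f z + g z) = (\<lambda>z. extend f z + extend g z)"
  by (auto simp: extend_def)
lemma extend_diff: "extend (\<lambda>z. f z - g z) = (\<lambda>z. extend f z - extend g z)"
  by (auto simp: extend_def)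
lemma extend_cscale: "extend (\<lambda>z. c *s f z) = (\<lambda>z. c *s extend f z)"
  by (auto simp: extend_def vec_eq_iff)
lemma extend_scaleR: "extend (\<lambda>z. c *\<^sub>R f z) = (\<lambda>z. c *\<^sub>R extend f z)"
  by (auto simp: extend_def)
lemma extend_zero: "extend (\<lambda>z. 0) = (\<lambda>z. 0)" by (auto simp: extend_def)

lemma cls_add: "sqint (extend f) \<Longrightarrow> sqint (extend g) \<Longrightarrow> cls (\<lambda>z. f z + g z) = cls f + cls g"
  by (simp add: cls_def extend_add add_abs_lsq)
lemma cls_diff: "sqint (extend f) \<Longrightarrow> sqint (extend g) \<Longrightarrow> cls (\<lambda>z. f z - g z) = cls f - cls g"
  by (simp add: cls_def extend_diff diff_abs_lsq)
lemma cls_cscale: "sqint (extend f) \<Longrightarrow> cls (\<lambda>z. c *s f z) = cmul c (cls f)"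
  by (simp add: cls_def extend_cscale cmul_abs_lsq)
lemma cls_zero: "cls (\<lambda>z. 0) = 0"
  by (simp add: cls_def extend_zero zero_lsq.abs_eq)

lemma L2_zero: "(\<lambda>z. 0) \<in> L2 \<Omega> p q" by (simp add: L2_iff extend_zero sqint_zero bidegree_def)
lemma L2_add: "f \<in> L2 \<Omega> p q \<Longrightarrow> g \<in> L2 \<Omega> p q \<Longrightarrow> (\<lambda>z. f z + g z) \<in> L2 \<Omega> p q"
  by (simp add: L2_iff extend_add sqint_add bidegree_def)
lemma L2_diff: "f \<in> L2 \<Omega> p q \<Longrightarrow> g \<in> L2 \<Omega> p q \<Longrightarrow> (\<lambda>z. f z - g z) \<in> L2 \<Omega> p q"
  by (simp add: L2_iff extend_diff sqint_diff bidegree_def)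
lemma L2_cscale: "f \<in> L2 \<Omega> p q \<Longrightarrow> (\<lambda>z. c *s f z) \<in> L2 \<Omega> p q"
  by (simp add: L2_iff extend_cscale sqint_cscale bidegree_def)
lemma L2_scaleR: "f \<in> L2 \<Omega> p q \<Longrightarrow> (\<lambda>z. c *\<^sub>R f z) \<in> L2 \<Omega> p q"
  by (simp add: L2_iff extend_scaleR sqint_scale bidegree_def)

lemma norm_cls: assumes "sqint (extend f)" shows "norm (cls f) = L2_norm \<Omega> f"
proof -
  have "(LINT z|lebesgue_on \<Omega>. (norm (f z))\<^sup>2) = (LINT z|lebesgue. (norm (extend f z))\<^sup>2)"
    by (subst integral_restrict_space) (auto simp: extend_def intro!: Bochner_Integration.integral_cong)
  then show ?thesis using assms by (simp add: cls_def norm_abs_lsq L2_norm_def)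
qed

lemma Re_L2_inner: assumes f: "sqint (extend f)" and g: "sqint (extend g)"
  shows "Re (L2_inner \<Omega> f g) = cls f \<bullet> cls g"
proof -
  define F where "F z = (\<Sum>I\<in>UNIV. extend f z $ I * cnj (extend g z $ I))" for z
  have comp: "integrable lebesgue (\<lambda>z. extend f z $ I * cnj (extend g z $ I))" for I
  proof -
    have s: "sqint (\<lambda>z. h z $ I)" if "sqint h" for h :: "'n form"
      by (rule sqint_bounded_linear[OF bounded_linear_vec_nth _ that, of _ 1]) (simp add: Finite_Cartesian_Product.norm_nth_le)
    have [measurable]: "(\<lambda>z. extend f z $ I) \<in> borel_measurable lebesgue" "(\<lambda>z. extend g z $ I) \<in> borel_measurable lebesgue"
      using s[OF f] s[OF g] by (simp_all add: sqint_def)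
    have i: "integrable lebesgue (\<lambda>z. norm (extend f z $ I) \<bullet> norm (extend g z $ I))"
      by (intro sqint_inner sqint_norm s f g)
    show ?thesis
    proof (rule Bochner_Integration.integrable_bound[OF i])
      have [measurable]: "cnj \<in> borel_measurable borel" by (intro borel_measurable_continuous_onI continuous_intros)
      show "(\<lambda>z. extend f z $ I * cnj (extend g z $ I)) \<in> borel_measurable lebesgue" by measurable
    qed (simp add: norm_mult)
  qed
  have F: "integrable lebesgue F" unfolding F_def[abs_def] by (intro Bochner_Integration.integrable_sum comp)
  have "L2_inner \<Omega> f g = (LINT z|lebesgue. F z)" unfolding L2_inner_def
    by (subst integral_restrict_space) (auto simp: extend_def F_def indicator_def intro!: Bochner_Integration.integral_cong)
  then have "Re (L2_inner \<Omega> f g) = (LINT z|lebesgue. Re (F z))"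
    using integral_bounded_linear[OF bounded_linear_Re F] by simp
  also have "\<dots> = (LINT z|lebesgue. extend f z \<bullet> extend g z)"
    by (intro Bochner_Integration.integral_cong) (auto simp: F_def inner_vec_def inner_complex_def)
  finally show ?thesis using f g by (simp add: cls_def inner_abs_lsq)
qed

lemma L2_inner_cscale_right: "L2_inner \<Omega> f (\<lambda>z. c *s g z) = cnj c * L2_inner \<Omega> f g"
proof -
  have "L2_inner \<Omega> f (\<lambda>z. c *s g z) = (LINT z|lebesgue_on \<Omega>. cnj c * (\<Sum>I\<in>UNIV. f z $ I * cnj (g z $ I)))"
    unfolding L2_inner_def
    by (intro Bochner_Integration.integral_cong) (auto simp: sum_distrib_left mult_ac)
  then show ?thesis by (simp add: L2_inner_def)
qed

text \<open>
  The complex inner product is recovered from the real one.  This reduces complex orthogonality and the complex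
  adjoint to their real counterparts, as all subspaces and relations involved are stable under \<open>cmul\<close>.
\<close>

lemma L2_inner_eq: assumes f: "sqint (extend f)" and g: "sqint (extend g)"
  shows "L2_inner \<Omega> f g = Complex (cls f \<bullet> cls g) (cls f \<bullet> cmul \<i> (cls g))"
proof (rule complex_eqI)
  have "Im (L2_inner \<Omega> f g) = Re (L2_inner \<Omega> f (\<lambda>z. \<i> *s g z))"
    unfolding L2_inner_cscale_right by simp
  also have "\<dots> = cls f \<bullet> cmul \<i> (cls g)"
    using f g by (simp add: Re_L2_inner extend_cscale sqint_cscale cls_cscale)
  finally show "Im (L2_inner \<Omega> f g) = Im (Complex (cls f \<bullet> cls g) (cls f \<bullet> cmul \<i> (cls g)))" by simp
qed (simp add: Re_L2_inner f g)

definition forms :: "nat \<Rightarrow> nat \<Rightarrow> 'n form_class set" where "forms p q = cls ` L2 \<Omega> p q"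

lemma formsE: assumes "x \<in> forms p q" obtains f where "f \<in> L2 \<Omega> p q" "x = cls f"
  using assms by (auto simp: forms_def)

lemma subspace_forms: "subspace (forms p q)"
proof (rule subspaceI)
  show "0 \<in> forms p q" using L2_zero cls_zero unfolding forms_def by (metis image_eqI)
next
  fix x y assume "x \<in> forms p q" "y \<in> forms p q"
  then obtain f g where fg: "f \<in> L2 \<Omega> p q" "x = cls f" "g \<in> L2 \<Omega> p q" "y = cls g" by (metis formsE)
  then have "x + y = cls (\<lambda>z. f z + g z)" by (simp add: cls_add L2_sqint)
  then show "x + y \<in> forms p q" using L2_add fg by (auto simp: forms_def)
next
  fix c x assume "x \<in> forms p q"
  then obtain f where f: "f \<in> L2 \<Omega> p q" "x = cls f" by (rule formsE)
  then have "c *\<^sub>R x = cls (\<lambda>z. c *\<^sub>R f z)"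
    using L2_sqint[OF f(1)] by (simp add: cls_def extend_scaleR scaleR_abs_lsq)
  then show "c *\<^sub>R x \<in> forms p q" using L2_scaleR f by (auto simp: forms_def)
qed

lemma cmul_forms: assumes "x \<in> forms p q" shows "cmul c x \<in> forms p q"
proof -
  obtain f where f: "f \<in> L2 \<Omega> p q" "x = cls f" by (rule formsE[OF assms])
  then have "cmul c x = cls (\<lambda>z. c *s f z)" by (simp add: cls_cscale L2_sqint)
  then show ?thesis using L2_cscale f by (auto simp: forms_def)
qed

definition bideg_part :: "nat \<Rightarrow> nat \<Rightarrow> 'n covec \<Rightarrow> 'n covec" where
  "bideg_part p q w = (\<chi> I. if card (fst I) = p \<and> card (snd I) = q then w $ I else 0)"

text \<open>
  Restricting to \<open>\<Omega>\<close> and projecting to the bidegree \<open>(p, q)\<close> does not increase distances and fixes the members of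
  a sequence of forms; so the sequence also converges to the image of its limit.
\<close>

lemma closed_forms: "closed (forms p q)"
  unfolding closed_sequential_limits
proof (intro allI impI)
  fix X x assume X: "(\<forall>n. X n \<in> forms p q) \<and> X \<longlonglongrightarrow> x"
  define g where "g z = bideg_part p q (extend (rep_lsq x) z)" for z
  have bl: "bounded_linear (bideg_part p q)"
    unfolding linear_conv_bounded_linear[symmetric]
    by (rule linearI) (auto simp: bideg_part_def vec_eq_iff)
  have nle: "norm (bideg_part p q w) \<le> 1 * norm w" for w
    unfolding mult_1 by (rule norm_le_componentwise_cart) (simp add: bideg_part_def)
  have "sqint (extend (rep_lsq x))"
  proof -
    have "sqint (rep_lsq x)" by (rule rep_lsq)
    moreover from this have "extend (rep_lsq x) \<in> borel_measurable lebesgue"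
      unfolding extend_def[abs_def] by (intro measurable_If_set) (auto simp: sqint_def)
    moreover have "integrable lebesgue (\<lambda>z. (norm (extend (rep_lsq x) z))\<^sup>2)"
    proof (rule Bochner_Integration.integrable_bound)
      show "integrable lebesgue (\<lambda>z. (norm (rep_lsq x z))\<^sup>2)" using rep_lsq(1)[of x] by (simp add: sqint_def)
      note [measurable] = calculation(2)
      show "(\<lambda>z. (norm (extend (rep_lsq x) z))\<^sup>2) \<in> borel_measurable lebesgue" by measurable
    qed (simp add: extend_def)
    ultimately show ?thesis unfolding sqint_def by blast
  qed
  then have sg: "sqint g" unfolding g_def[abs_def] by (rule sqint_bounded_linear[OF bl nle])
  have eg: "extend g = g" by (auto simp: g_def extend_def linear_simps[OF bl])
  have gL2: "g \<in> L2 \<Omega> p q"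
    unfolding L2_iff eg using sg by (auto simp: g_def bidegree_def bideg_part_def)
  have le: "norm (X n - cls g) \<le> norm (X n - x)" for n
  proof -
    obtain f where f: "f \<in> L2 \<Omega> p q" "X n = cls f" using X formsE by metis
    note s = L2_sqint[OF f(1)]
    have pw: "norm (extend f z - g z) \<le> norm (extend f z - rep_lsq x z)" for z
    proof (cases "z \<in> \<Omega>")
      case True
      then have "f z = bideg_part p q (f z)" using f(1) by (auto simp: L2_iff bidegree_def bideg_part_def vec_eq_iff)
      then have "f z - g z = bideg_part p q (f z - rep_lsq x z)"
        using True linear_simps(2)[OF bl, of "f z" "rep_lsq x z"] by (simp add: g_def extend_def)
      then show ?thesis using nle[of "f z - rep_lsq x z"] True by (simp add: extend_def)
    next
      case False
      then show ?thesis by (simp add: g_def extend_def linear_simps[OF bl])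
    qed
    have "norm (X n - cls g) = sqrt (LINT z|lebesgue. (norm (extend f z - g z))\<^sup>2)"
      by (simp add: f cls_def eg diff_abs_lsq s sg norm_abs_lsq sqint_diff)
    also have "\<dots> \<le> sqrt (LINT z|lebesgue. (norm (extend f z - rep_lsq x z))\<^sup>2)"
      using sqint_diff[OF s sg] sqint_diff[OF s rep_lsq(1)[of x]]
      by (intro real_sqrt_le_mono integral_mono power_mono pw) (auto simp: sqint_def)
    also have "\<dots> = norm (X n - x)"
      using rep_lsq[of x] diff_abs_lsq[OF s rep_lsq(1)[of x]] norm_abs_lsq[OF sqint_diff[OF s rep_lsq(1)[of x]]]
      by (simp add: f cls_def)
    finally show ?thesis .
  qed
  have "(\<lambda>n. norm (X n - x)) \<longlonglongrightarrow> 0" using X by (simp add: LIM_zero_iff tendsto_norm_zero)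
  then have "(\<lambda>n. X n - cls g) \<longlonglongrightarrow> 0"
    by (rule Lim_null_comparison[rotated]) (simp add: le)
  then have "X \<longlonglongrightarrow> cls g" by (simp add: LIM_zero_iff)
  with X have "x = cls g" using LIMSEQ_unique by blast
  then show "x \<in> forms p q" using gL2 by (simp add: forms_def)
qed

lemma test_integral_cls: assumes "sqint (extend f)" "sqint \<phi>"
  shows "test_integral \<phi> (cls f) = (LINT z|lebesgue_on \<Omega>. \<phi> z *s f z)"
  unfolding cls_def test_integral_abs_lsq[OF assms(2,1)]
  by (subst integral_restrict_space)
    (auto simp: extend_def intro!: Bochner_Integration.integral_cong split: split_indicator)

lemma weak_rel_cls:
  assumes "sqint (extend f)" "sqint (extend g)" shows "weak_rel \<Omega> (cls f) (cls g) \<longleftrightarrow> weak_ddbar \<Omega> f g"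
  unfolding weak_rel_def weak_ddbar_def
  by (intro all_cong1 imp_cong refl)
    (simp add: test_integral_cls[OF assms(1)] test_integral_cls[OF assms(2)] sqint_test_function sqint_test_function[OF test_function_wirt_wirt_bar])

lemma integrable_component:
  assumes f: "f \<in> L2 \<Omega> p q" shows "integrable (lebesgue_on \<Omega>) (\<lambda>z. f z $ I)"
proof (rule Bochner_Integration.integrable_bound)
  have "emeasure lebesgue \<Omega> < \<infinity>"
    using emeasure_bounded_finite[OF bounded_domain] open_domain by simp
  then have "integrable (lebesgue_on \<Omega>) (\<lambda>z. 1 :: real)"
    by (simp add: integrable_restrict_space)
  then show "integrable (lebesgue_on \<Omega>) (\<lambda>z. 1 + (norm (f z))\<^sup>2)"
    using f by (auto simp: L2_def)
  have "f \<in> borel_measurable (lebesgue_on \<Omega>)" using f by (simp add: L2_def)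
  then show "(\<lambda>z. f z $ I) \<in> borel_measurable (lebesgue_on \<Omega>)"
    by (rule measurable_compose) (intro borel_measurable_continuous_onI linear_continuous_on bounded_linear_vec_nth)
  have "norm (w $ I) \<le> 1 + (norm w)\<^sup>2" for w :: "'n covec"
  proof -
    have "2 * norm w \<le> 1 + (norm w)\<^sup>2" using sum_squares_bound[of 1 "norm w"] by simp
    with Finite_Cartesian_Product.norm_nth_le[of w I] norm_ge_zero[of w] show ?thesis by linarith
  qed
  then show "AE z in lebesgue_on \<Omega>. norm (f z $ I) \<le> norm (1 + (norm (f z))\<^sup>2)"
    by (intro AE_I2) (smt (verit) real_norm_def zero_le_power2)
qed

lemma forms_separate:
  assumes x: "x \<in> forms p q" and zero: "\<And>\<phi>. test_function \<Omega> \<phi> \<Longrightarrow> test_integral \<phi> x = 0"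
  shows "x = 0"
proof -
  obtain f where f: "f \<in> L2 \<Omega> p q" "x = cls f" using x by (rule formsE)
  have "AE z in lebesgue_on \<Omega>. f z $ I = 0" for I
  proof (rule test_functions_separate[OF open_domain integrable_component[OF f(1)]])
    fix \<phi> assume \<phi>: "test_function \<Omega> \<phi>"
    have i: "integrable (lebesgue_on \<Omega>) (\<lambda>z. \<phi> z *s f z)"
    proof -
      have "(\<lambda>z. indicator \<Omega> z *\<^sub>R (\<phi> z *s f z)) = (\<lambda>z. \<phi> z *s extend f z)"
        by (auto simp: fun_eq_iff extend_def indicator_def vec_eq_iff)
      then show ?thesis
        using integrable_cscale_mult[OF sqint_test_function[OF \<phi>] L2_sqint[OF f(1)]]
        by (simp add: integrable_restrict_space)
    qed
    have "(LINT z|lebesgue_on \<Omega>. \<phi> z * f z $ I) = (LINT z|lebesgue_on \<Omega>. \<phi> z *s f z) $ I"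
      using integral_bounded_linear[OF bounded_linear_vec_nth i, of I] by simp
    also have "\<dots> = 0"
      using zero[OF \<phi>] by (simp add: f(2) test_integral_cls L2_sqint[OF f(1)] sqint_test_function[OF \<phi>])
    finally show "(LINT z|lebesgue_on \<Omega>. \<phi> z * f z $ I) = 0" .
  qed
  then have "AE z in lebesgue_on \<Omega>. \<forall>I\<in>UNIV. f z $ I = 0"
    by (intro AE_finite_allI) auto
  then have "ae_eq \<Omega> f (\<lambda>z. 0)" unfolding ae_eq_def by eventually_elim (simp add: vec_eq_iff)
  then have "cls f = cls (\<lambda>z. 0)" by (subst cls_eq_iff) (auto simp: L2_sqint[OF f(1)] extend_zero sqint_zero)
  then show ?thesis by (simp add: f cls_zero)
qed

definition ddbar_rel :: "nat \<Rightarrow> nat \<Rightarrow> ('n form_class \<times> 'n form_class) set" where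
  "ddbar_rel p q = {(x, y). x \<in> forms p q \<and> y \<in> forms (p + 1) (q + 1) \<and> weak_rel \<Omega> x y}"

lemma ddbar_rel_eq: "ddbar_rel p q = (forms p q \<times> forms (p + 1) (q + 1)) \<inter> {(x, y). weak_rel \<Omega> x y}"
  by (auto simp: ddbar_rel_def)

lemma subspace_ddbar_rel: "subspace (ddbar_rel p q)"
  unfolding ddbar_rel_eq by (intro subspace_inter subspace_Times subspace_forms weak_rel_subspace)

lemma closed_ddbar_rel: "closed (ddbar_rel p q)"
  unfolding ddbar_rel_eq by (intro closed_Int closed_Times closed_forms weak_rel_closed)

lemma ddbar_rel_exact: "(x, y) \<in> ddbar_rel p q \<Longrightarrow> (y, 0) \<in> ddbar_rel (p + 1) (q + 1)"
  using weak_rel_square subspace_0[OF subspace_forms] by (auto simp: ddbar_rel_def)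

lemma ddbar_rel_cmul: "(x, y) \<in> ddbar_rel p q \<Longrightarrow> (cmul c x, cmul c y) \<in> ddbar_rel p q"
  by (auto simp: ddbar_rel_def cmul_forms weak_rel_cmul)

lemma ddbar_rel_unique: assumes "(x, y) \<in> ddbar_rel p q" "(x, y') \<in> ddbar_rel p q" shows "y = y'"
proof -
  have "(0, y - y') \<in> ddbar_rel p q" using subspace_diff[OF subspace_ddbar_rel assms] by simp
  then have w: "weak_rel \<Omega> 0 (y - y')" and f: "y - y' \<in> forms (p + 1) (q + 1)" by (auto simp: ddbar_rel_def)
  have "test_integral \<phi> (y - y') = 0" if "test_function \<Omega> \<phi>" for \<phi>
    using w that linear_simps(3)[OF bounded_linear_weak_rel[OF that]] by (simp add: weak_rel_def)
  from forms_separate[OF f this] show ?thesis by simp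
qed

lemma integral_cscale_const:
  assumes "integrable M F" shows "(LINT z|M. F z *s (e :: complex ^ 'i::finite)) = (LINT z|M. F z) *s e"
  by (rule integral_bounded_linear[OF bounded_linear_cscale_left assms])

text \<open>
  On a test function times a constant covector the operator acts classically, by integrating by parts twice.
\<close>

lemma test_form_in_domain:
  fixes e :: "'n covec"
  assumes \<psi>: "test_function \<Omega> \<psi>" and e: "bidegree p q e"
  shows "\<exists>y. (cls (\<lambda>z. \<psi> z *s e), y) \<in> ddbar_rel p q"
proof -
  obtain K where K: "compact K" "K \<subseteq> \<Omega>" "\<And>z. z \<notin> K \<Longrightarrow> \<psi> z = 0"
    by (rule test_function_support[OF \<psi>]) (rule that)
  define f where "f z = \<psi> z *s e" for z
  define W where "W c = (\<Sum>j\<in>UNIV. \<Sum>k\<in>UNIV. dz_wedge j (dzbar_wedge k (c j k *s e)))" for c :: "'n \<Rightarrow> 'n \<Rightarrow> complex"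
  define g where "g z = W (\<lambda>j k. wirt j (wirt_bar k \<psi>) z)" for z
  note t = test_function_wirt_wirt_bar[OF \<psi>]
  have W_eq: "W c = (\<Sum>j\<in>UNIV. \<Sum>k\<in>UNIV. c j k *s dz_wedge j (dzbar_wedge k e))" for c
    unfolding W_def by (simp add: dz_wedge_cscale dzbar_wedge_cscale)
  have sc: "sqint (\<lambda>z. \<phi> z *s v)" if \<phi>: "test_function \<Omega> \<phi>" for \<phi> and v :: "'n covec"
    by (rule sqint_bounded_linear[OF bounded_linear_cscale_left _ sqint_test_function[OF \<phi>], of _ "norm v"])
      (simp add: norm_cscale mult.commute)
  have sf: "sqint f" unfolding f_def[abs_def] by (rule sc[OF \<psi>])
  have sum_sqint: "sqint (\<lambda>z. \<Sum>i\<in>A. F i z)" if "finite A" "\<And>i. i \<in> A \<Longrightarrow> sqint (F i)" for A :: "'n set" and F :: "'n \<Rightarrow> 'n form"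
    using that by (induction A rule: finite_induct) (auto simp: sqint_zero sqint_add)
  have sg: "sqint g" unfolding g_def[abs_def] W_eq by (intro sum_sqint finite sc t)
  have off: "\<phi> z = 0" if \<phi>: "test_function \<Omega> \<phi>" and z: "z \<notin> \<Omega>" for \<phi> z
  proof -
    obtain K' where "compact K'" "K' \<subseteq> \<Omega>" "\<And>z. z \<notin> K' \<Longrightarrow> \<phi> z = 0"
      by (rule test_function_support[OF \<phi>]) (rule that)
    then show ?thesis using z by blast
  qed
  have ef: "extend f = f" by (auto simp: extend_def f_def off[OF \<psi>])
  have eg: "extend g = g" by (auto simp: extend_def g_def W_eq off[OF t])
  have fL2: "f \<in> L2 \<Omega> p q" using sf e by (auto simp: L2_iff ef bidegree_def f_def)
  have gL2: "g \<in> L2 \<Omega> (p + 1) (q + 1)"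
    unfolding L2_iff eg using sg bidegree_wedge[OF e] by (auto simp: bidegree_def g_def W_eq)
  have "weak_rel \<Omega> (cls f) (cls g)" unfolding weak_rel_def
  proof (intro allI impI)
    fix \<phi> assume \<phi>: "test_function \<Omega> \<phi>"
    note t' = test_function_wirt_wirt_bar[OF \<phi>]
    have leb: "integrable lebesgue (\<lambda>z. \<alpha> z * \<beta> z)" "(LINT z|lebesgue. \<alpha> z * \<beta> z) = (LINT z|lborel. \<alpha> z * \<beta> z)"
      if "test_function \<Omega> \<alpha>" "test_function \<Omega> \<beta>" for \<alpha> \<beta>
    proof -
      have ab: "test_function \<Omega> (\<lambda>z. \<alpha> z * \<beta> z)" by (rule test_function_mult[OF that(1) test_function_smooth[OF that(2)]])
      have m: "(\<lambda>z. \<alpha> z * \<beta> z) \<in> borel_measurable lborel"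
        using test_function_continuous[OF ab] by (simp add: borel_measurable_continuous_onI)
      show "integrable lebesgue (\<lambda>z. \<alpha> z * \<beta> z)" using test_function_integrable[OF ab] by (simp add: integrable_completion[OF m])
      show "(LINT z|lebesgue. \<alpha> z * \<beta> z) = (LINT z|lborel. \<alpha> z * \<beta> z)" by (rule integral_completion[OF m])
    qed
    have "test_integral \<phi> (cls g) = (LINT z|lebesgue. \<phi> z *s g z)"
      unfolding cls_def eg by (rule test_integral_abs_lsq[OF sqint_test_function[OF \<phi>] sg])
    also have "\<dots> = (LINT z|lebesgue. (\<Sum>j\<in>UNIV. \<Sum>k\<in>UNIV. (\<phi> z * wirt j (wirt_bar k \<psi>) z) *s dz_wedge j (dzbar_wedge k e)))"
      by (simp add: g_def W_eq bounded_linear.linear[OF bounded_linear_cscale, THEN linear_sum] vector_smult_assoc)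
    also have "\<dots> = (\<Sum>j\<in>UNIV. \<Sum>k\<in>UNIV. (LINT z|lebesgue. \<phi> z * wirt j (wirt_bar k \<psi>) z) *s dz_wedge j (dzbar_wedge k e))"
    proof -
      note i = integrable_bounded_linear[OF bounded_linear_cscale_left leb(1)[OF \<phi> t]]
      have "(LINT z|lebesgue. (\<Sum>j\<in>UNIV. \<Sum>k\<in>UNIV. (\<phi> z * wirt j (wirt_bar k \<psi>) z) *s dz_wedge j (dzbar_wedge k e)))
        = (\<Sum>j\<in>UNIV. LINT z|lebesgue. (\<Sum>k\<in>UNIV. (\<phi> z * wirt j (wirt_bar k \<psi>) z) *s dz_wedge j (dzbar_wedge k e)))"
        by (rule Bochner_Integration.integral_sum) (intro Bochner_Integration.integrable_sum i)
      also have "\<dots> = (\<Sum>j\<in>UNIV. \<Sum>k\<in>UNIV. LINT z|lebesgue. (\<phi> z * wirt j (wirt_bar k \<psi>) z) *s dz_wedge j (dzbar_wedge k e))"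
        by (intro sum.cong refl Bochner_Integration.integral_sum i)
      finally show ?thesis by (simp only: integral_cscale_const[OF leb(1)[OF \<phi> t]])
    qed
    also have "\<dots> = (\<Sum>j\<in>UNIV. \<Sum>k\<in>UNIV. dz_wedge j (dzbar_wedge k ((LINT z|lebesgue. wirt j (wirt_bar k \<phi>) z * \<psi> z) *s e)))"
      by (simp add: leb(2)[OF \<phi> t] leb(2)[OF t' \<psi>] integral_wirt_wirt_bar_mult[OF \<phi> \<psi>] dz_wedge_cscale dzbar_wedge_cscale)
    also have "\<dots> = (\<Sum>j\<in>UNIV. \<Sum>k\<in>UNIV. dz_wedge j (dzbar_wedge k (test_integral (wirt j (wirt_bar k \<phi>)) (cls f))))"
      unfolding cls_def ef test_integral_abs_lsq[OF sqint_test_function[OF t'] sf]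
      by (simp add: f_def vector_smult_assoc integral_cscale_const[OF leb(1)[OF t' \<psi>]])
    finally show "test_integral \<phi> (cls g) = (\<Sum>j\<in>UNIV. \<Sum>k\<in>UNIV. dz_wedge j (dzbar_wedge k (test_integral (wirt j (wirt_bar k \<phi>)) (cls f))))" .
  qed
  then have "(cls f, cls g) \<in> ddbar_rel p q" using fL2 gL2 by (auto simp: ddbar_rel_def forms_def)
  then show ?thesis unfolding f_def[abs_def] by blast
qed

text \<open>
  The test forms of \<open>test_form_in_domain\<close> already determine a class: orthogonality to \<open>cnj \<phi>\<close> times
  a basis covector is the vanishing of the real part of a coefficient of \<open>test_integral \<phi> x\<close>, and
  replacing \<open>\<phi>\<close> by \<open>- \<i> \<phi>\<close> gives the imaginary part.
\<close>

lemma domain_dense: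
  assumes x: "x \<in> forms p q" and perp: "\<And>a b. (a, b) \<in> ddbar_rel p q \<Longrightarrow> a \<bullet> x = 0"
  shows "x = 0"
proof (rule forms_separate[OF x])
  obtain h where h: "h \<in> L2 \<Omega> p q" "x = cls h" using x by (rule formsE)
  note sh = L2_sqint[OF h(1)]
  have re: "Re (test_integral \<phi> x $ (K, L)) = 0" if \<phi>: "test_function \<Omega> \<phi>" and KL: "card K = p" "card L = q" for \<phi> K L
  proof -
    define e :: "'n covec" where "e = axis (K, L) 1"
    have e: "bidegree p q e" using KL by (auto simp: e_def bidegree_def axis_def)
    have t: "test_function \<Omega> (\<lambda>z. cnj (\<phi> z))"
    proof -
      obtain K' where K': "compact K'" "K' \<subseteq> \<Omega>" "\<And>z. z \<notin> K' \<Longrightarrow> \<phi> z = 0"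
        by (rule test_function_support[OF \<phi>]) (rule that)
      show ?thesis
      proof (rule test_functionI[OF _ K'(1,2)])
        show "smooth_on UNIV (\<lambda>z. cnj (\<phi> z))" unfolding smooth_on_def
          by (intro allI Ck_on_bounded_linear[OF bounded_linear_cnj] smooth_onD test_function_smooth[OF \<phi>])
      qed (simp add: K'(3))
    qed
    have off: "cnj (\<phi> z) = 0" if z: "z \<notin> \<Omega>" for z
    proof -
      obtain K' where "compact K'" "K' \<subseteq> \<Omega>" "\<And>z. z \<notin> K' \<Longrightarrow> \<phi> z = 0"
        by (rule test_function_support[OF \<phi>]) (rule that)
      then show ?thesis using z by auto
    qed
    have ext: "extend (\<lambda>z. cnj (\<phi> z) *s e) = (\<lambda>z. cnj (\<phi> z) *s e)"
      using off by (auto simp: extend_def)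
    have s: "sqint (\<lambda>z. cnj (\<phi> z) *s e)"
      by (rule sqint_bounded_linear[OF bounded_linear_cscale_left _ sqint_test_function[OF t], of _ "norm e"])
        (simp add: norm_cscale mult.commute)
    have i: "integrable lebesgue (\<lambda>z. \<phi> z *s extend h z)"
      by (rule integrable_cscale_mult[OF sqint_test_function[OF \<phi>] sh])
    obtain y where "(cls (\<lambda>z. cnj (\<phi> z) *s e), y) \<in> ddbar_rel p q" using test_form_in_domain[OF t e] by blast
    from perp[OF this] have "0 = (LINT z|lebesgue. (cnj (\<phi> z) *s e) \<bullet> extend h z)"
      by (simp add: h(2) cls_def ext inner_abs_lsq[OF s sh])
    also have "\<dots> = (LINT z|lebesgue. Re ((\<phi> z *s extend h z) $ (K, L)))"
    proof (intro Bochner_Integration.integral_cong refl)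
      fix z
      have "(cnj (\<phi> z) *s e) \<bullet> extend h z = e \<bullet> (\<phi> z *s extend h z)" by (simp add: cscale_inner)
      also have "\<dots> = Re ((\<phi> z *s extend h z) $ (K, L))" unfolding e_def inner_axis' by (simp add: inner_complex_def)
      finally show "(cnj (\<phi> z) *s e) \<bullet> extend h z = Re ((\<phi> z *s extend h z) $ (K, L))" .
    qed
    also have "\<dots> = Re ((LINT z|lebesgue. \<phi> z *s extend h z) $ (K, L))"
      by (rule integral_bounded_linear[OF bounded_linear_compose[OF bounded_linear_Re bounded_linear_vec_nth] i])
    finally show ?thesis by (simp add: h(2) cls_def test_integral_abs_lsq sh sqint_test_function[OF \<phi>])
  qed
  fix \<phi> assume \<phi>: "test_function \<Omega> \<phi>"
  note i = integrable_cscale_mult[OF sqint_test_function[OF \<phi>] sh]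
  have p: "test_integral \<phi> x = (LINT z|lebesgue. \<phi> z *s extend h z)"
    by (simp add: h(2) cls_def test_integral_abs_lsq sh sqint_test_function[OF \<phi>])
  have "test_integral \<phi> x $ (K, L) = 0" for K L
  proof (cases "card K = p \<and> card L = q")
    case True
    have t: "test_function \<Omega> (\<lambda>z. \<phi> z * - \<i>)"
      by (rule test_function_mult[OF \<phi>]) (simp add: smooth_on_def Ck_on_const)
    have "test_integral (\<lambda>z. \<phi> z * - \<i>) x = (LINT z|lebesgue. (- \<i>) *s (\<phi> z *s extend h z))"
    proof -
      have "(\<lambda>z. (\<phi> z * - \<i>) *s extend h z) = (\<lambda>z. (- \<i>) *s (\<phi> z *s extend h z))"
        by (simp add: fun_eq_iff vec_eq_iff)
      then show ?thesis unfolding h(2) cls_def test_integral_abs_lsq[OF sqint_test_function[OF t] sh] by (simp only:)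
    qed
    also have "\<dots> = (- \<i>) *s test_integral \<phi> x"
      unfolding p by (rule integral_bounded_linear[OF bounded_linear_cscale i])
    finally show ?thesis using re[OF \<phi>, of K L] re[OF t, of K L] True by (simp add: complex_eq_iff)
  next
    case False
    then have "extend h z $ (K, L) = 0" for z
      using h(1) by (auto simp: L2_iff bidegree_def extend_def)
    then have "(LINT z|lebesgue. (\<phi> z *s extend h z) $ (K, L)) = 0" by simp
    then show ?thesis unfolding p using integral_bounded_linear[OF bounded_linear_vec_nth i, of "(K, L)"] by simp
  qed
  then show "test_integral \<phi> x = 0" by (auto simp: vec_eq_iff)
qed

end

section \<open>The operators as relations\<close>

context bounded_domain
begin

abbreviation "adjoint_rel p q \<equiv> adj_rel (forms p q) (forms (p + 1) (q + 1)) (ddbar_rel p q)"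

lemma cls_in_forms: "f \<in> L2 \<Omega> p q \<Longrightarrow> cls f \<in> forms p q" by (simp add: forms_def)

text \<open>
  The facts \<open>..._clsD\<close> and \<open>dom_...D\<close> identify each operator, which is a choice of a representative,
  with the relation that it induces on classes.
\<close>

lemma ddbar_rel_clsD:
  assumes f: "f \<in> L2 \<Omega> p q" and y: "(cls f, y) \<in> ddbar_rel p q"
  shows "f \<in> dom_ddbar \<Omega> p q" "ddbar \<Omega> p q f \<in> L2 \<Omega> (p + 1) (q + 1)" "cls (ddbar \<Omega> p q f) = y"
proof -
  have "y \<in> forms (p + 1) (q + 1)" using y by (simp add: ddbar_rel_def)
  then obtain g where g: "g \<in> L2 \<Omega> (p + 1) (q + 1)" "y = cls g" by (rule formsE)
  then have w: "weak_ddbar \<Omega> f g" using y weak_rel_cls[OF L2_sqint[OF f] L2_sqint[OF g(1)]] by (simp add: ddbar_rel_def)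
  then show "f \<in> dom_ddbar \<Omega> p q" using f g by (auto simp: dom_ddbar_def)
  have *: "ddbar \<Omega> p q f \<in> L2 \<Omega> (p + 1) (q + 1) \<and> weak_ddbar \<Omega> f (ddbar \<Omega> p q f)"
    unfolding ddbar_def by (rule someI[of _ g]) (use g w in blast)
  then show d: "ddbar \<Omega> p q f \<in> L2 \<Omega> (p + 1) (q + 1)" by simp
  have "(cls f, cls (ddbar \<Omega> p q f)) \<in> ddbar_rel p q"
    using * weak_rel_cls[OF L2_sqint[OF f] L2_sqint[OF d]] f d by (simp add: ddbar_rel_def cls_in_forms)
  then show "cls (ddbar \<Omega> p q f) = y" using ddbar_rel_unique y by blast
qed

lemma dom_ddbarD:
  assumes "f \<in> dom_ddbar \<Omega> p q"
  shows "f \<in> L2 \<Omega> p q" "(cls f, cls (ddbar \<Omega> p q f)) \<in> ddbar_rel p q"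
proof -
  from assms obtain g where fg: "f \<in> L2 \<Omega> p q" "g \<in> L2 \<Omega> (p + 1) (q + 1)" "weak_ddbar \<Omega> f g"
    by (auto simp: dom_ddbar_def)
  show "f \<in> L2 \<Omega> p q" by fact
  have "(cls f, cls g) \<in> ddbar_rel p q"
    using fg weak_rel_cls[OF L2_sqint[OF fg(1)] L2_sqint[OF fg(2)]] by (simp add: ddbar_rel_def cls_in_forms)
  then show "(cls f, cls (ddbar \<Omega> p q f)) \<in> ddbar_rel p q" using ddbar_rel_clsD(3)[OF fg(1)] by simp
qed

lemma adjoint_cmul:
  assumes "(y, x) \<in> adjoint_rel p q" shows "(cmul c y, cmul c x) \<in> adjoint_rel p q"
proof -
  have "b \<bullet> cmul c y = a \<bullet> cmul c x" if "(a, b) \<in> ddbar_rel p q" for a b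
    using adj_relD[OF assms ddbar_rel_cmul[OF that, of "cnj c"]] by (simp add: inner_cmul)
  then show ?thesis using assms by (simp add: adj_rel_iff cmul_forms)
qed

lemma adjoint_unique:
  assumes "(y, x) \<in> adjoint_rel p q" "(y, x') \<in> adjoint_rel p q" shows "x = x'"
proof -
  have "x - x' \<in> forms p q" using assms by (simp add: adj_rel_iff subspace_diff[OF subspace_forms])
  moreover have "a \<bullet> (x - x') = 0" if "(a, b) \<in> ddbar_rel p q" for a b
    using adj_relD[OF assms(1) that] adj_relD[OF assms(2) that] by (simp add: inner_diff_right)
  ultimately have "x - x' = 0" by (rule domain_dense)
  then show ?thesis by simp
qed

text \<open>
  The real identity for the pairs \<open>(g, h)\<close> and \<open>(\<i> g, \<i> h)\<close> gives the real and the imaginary part of the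
  complex one.
\<close>

lemma is_ddbar_adj_iff:
  assumes g: "g \<in> L2 \<Omega> (p + 1) (q + 1)" and h: "h \<in> L2 \<Omega> p q"
  shows "is_ddbar_adj \<Omega> p q g h \<longleftrightarrow> (cls g, cls h) \<in> adjoint_rel p q"
proof
  assume *: "is_ddbar_adj \<Omega> p q g h"
  have "b \<bullet> cls g = a \<bullet> cls h" if ab: "(a, b) \<in> ddbar_rel p q" for a b
  proof -
    have "a \<in> forms p q" using ab by (simp add: ddbar_rel_def)
    then obtain f where f: "f \<in> L2 \<Omega> p q" "a = cls f" by (rule formsE)
    note d = ddbar_rel_clsD[OF f(1) ab[unfolded f(2)]]
    have "L2_inner \<Omega> (ddbar \<Omega> p q f) g = L2_inner \<Omega> f h" using * d(1) by (simp add: is_ddbar_adj_def)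
    then show ?thesis
      using Re_L2_inner[OF L2_sqint[OF d(2)] L2_sqint[OF g]] Re_L2_inner[OF L2_sqint[OF f(1)] L2_sqint[OF h]] d(3) f(2) by simp
  qed
  then show "(cls g, cls h) \<in> adjoint_rel p q" using g h by (simp add: adj_rel_iff cls_in_forms)
next
  assume *: "(cls g, cls h) \<in> adjoint_rel p q"
  show "is_ddbar_adj \<Omega> p q g h" unfolding is_ddbar_adj_def
  proof
    fix f assume f: "f \<in> dom_ddbar \<Omega> p q"
    note d = dom_ddbarD[OF f]
    have s: "sqint (extend (ddbar \<Omega> p q f))" using ddbar_rel_clsD(2)[OF d] by (rule L2_sqint)
    show "L2_inner \<Omega> (ddbar \<Omega> p q f) g = L2_inner \<Omega> f h"
      using adj_relD[OF * d(2)] adj_relD[OF adjoint_cmul[OF *, of \<i>] d(2)]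
      by (simp add: L2_inner_eq s L2_sqint[OF d(1)] L2_sqint[OF g] L2_sqint[OF h])
  qed
qed

lemma adjoint_rel_clsD:
  assumes g: "g \<in> L2 \<Omega> (p + 1) (q + 1)" and x: "(cls g, x) \<in> adjoint_rel p q"
  shows "g \<in> dom_ddbar_adj \<Omega> p q" "ddbar_adj \<Omega> p q g \<in> L2 \<Omega> p q" "cls (ddbar_adj \<Omega> p q g) = x"
proof -
  have "x \<in> forms p q" using x by (simp add: adj_rel_iff)
  then obtain h where h: "h \<in> L2 \<Omega> p q" "x = cls h" by (rule formsE)
  then have w: "is_ddbar_adj \<Omega> p q g h" using x is_ddbar_adj_iff[OF g h(1)] by simp
  then show "g \<in> dom_ddbar_adj \<Omega> p q" using g h by (auto simp: dom_ddbar_adj_def)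
  have *: "ddbar_adj \<Omega> p q g \<in> L2 \<Omega> p q \<and> is_ddbar_adj \<Omega> p q g (ddbar_adj \<Omega> p q g)"
    unfolding ddbar_adj_def by (rule someI[of _ h]) (use h w in blast)
  then show d: "ddbar_adj \<Omega> p q g \<in> L2 \<Omega> p q" by simp
  show "cls (ddbar_adj \<Omega> p q g) = x" using * is_ddbar_adj_iff[OF g d] adjoint_unique x by blast
qed

lemma dom_ddbar_adjD:
  assumes "g \<in> dom_ddbar_adj \<Omega> p q"
  shows "g \<in> L2 \<Omega> (p + 1) (q + 1)" "(cls g, cls (ddbar_adj \<Omega> p q g)) \<in> adjoint_rel p q"
proof -
  from assms obtain h where gh: "g \<in> L2 \<Omega> (p + 1) (q + 1)" "h \<in> L2 \<Omega> p q" "is_ddbar_adj \<Omega> p q g h"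
    by (auto simp: dom_ddbar_adj_def)
  show "g \<in> L2 \<Omega> (p + 1) (q + 1)" by fact
  have "(cls g, cls h) \<in> adjoint_rel p q" using is_ddbar_adj_iff[OF gh(1,2)] gh(3) by simp
  then show "(cls g, cls (ddbar_adj \<Omega> p q g)) \<in> adjoint_rel p q" using adjoint_rel_clsD(3)[OF gh(1)] by simp
qed

end

sublocale bounded_domain \<subseteq> hc: hilbert_complex "forms p q" "forms (p + 1) (q + 1)" "forms (p + 1 + 1) (q + 1 + 1)"
    "ddbar_rel p q" "ddbar_rel (p + 1) (q + 1)" for p q
proof
  show "ddbar_rel p q \<subseteq> forms p q \<times> forms (p + 1) (q + 1)"
    "ddbar_rel (p + 1) (q + 1) \<subseteq> forms (p + 1) (q + 1) \<times> forms (p + 1 + 1) (q + 1 + 1)"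
    by (auto simp: ddbar_rel_def)
qed (fact subspace_forms subspace_ddbar_rel closed_ddbar_rel ddbar_rel_exact)+

context bounded_domain
begin

lemma lap_clsD:
  assumes f: "f \<in> L2 \<Omega> (p + 1) (q + 1)" and w: "(cls f, w) \<in> hc.lap p q"
  shows "f \<in> dom_laplacian \<Omega> (p + 1) (q + 1)" "laplacian \<Omega> (p + 1) (q + 1) f \<in> L2 \<Omega> (p + 1) (q + 1)"
    "cls (laplacian \<Omega> (p + 1) (q + 1) f) = w"
proof -
  from w obtain s a t b where 1: "(cls f, s) \<in> adjoint_rel p q" "(s, a) \<in> ddbar_rel p q"
    "(cls f, t) \<in> ddbar_rel (p + 1) (q + 1)" "(t, b) \<in> adjoint_rel (p + 1) (q + 1)" "w = a + b"
    by (rule hc.lapE)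
  note A = adjoint_rel_clsD[OF f 1(1)]
  note B = ddbar_rel_clsD[OF A(2) 1(2)[folded A(3)]]
  note C = ddbar_rel_clsD[OF f 1(3)]
  note D = adjoint_rel_clsD[OF C(2) 1(4)[folded C(3)]]
  show "f \<in> dom_laplacian \<Omega> (p + 1) (q + 1)"
    unfolding dom_laplacian_def using A(1) B(1) C(1) D(1) by simp
  show "laplacian \<Omega> (p + 1) (q + 1) f \<in> L2 \<Omega> (p + 1) (q + 1)"
    unfolding laplacian_def using L2_add[OF B(2) D(2)] by simp
  show "cls (laplacian \<Omega> (p + 1) (q + 1) f) = w"
    unfolding laplacian_def using cls_add[OF L2_sqint[OF B(2)] L2_sqint[OF D(2)]] B(3) D(3) 1(5) by simp
qed

lemma dom_laplacianD:
  assumes "f \<in> dom_laplacian \<Omega> (p + 1) (q + 1)"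
  shows "f \<in> L2 \<Omega> (p + 1) (q + 1)" "(cls f, cls (laplacian \<Omega> (p + 1) (q + 1) f)) \<in> hc.lap p q"
proof -
  have m: "f \<in> dom_ddbar \<Omega> (p + 1) (q + 1)" "f \<in> dom_ddbar_adj \<Omega> p q"
    "ddbar \<Omega> (p + 1) (q + 1) f \<in> dom_ddbar_adj \<Omega> (p + 1) (q + 1)"
    "ddbar_adj \<Omega> p q f \<in> dom_ddbar \<Omega> p q" using assms by (simp_all add: dom_laplacian_def)
  show f: "f \<in> L2 \<Omega> (p + 1) (q + 1)" by (rule dom_ddbarD(1)[OF m(1)])
  have "(cls f, cls (ddbar \<Omega> p q (ddbar_adj \<Omega> p q f)) + cls (ddbar_adj \<Omega> (p + 1) (q + 1) (ddbar \<Omega> (p + 1) (q + 1) f))) \<in> hc.lap p q"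
    by (rule hc.lapI[OF dom_ddbar_adjD(2)[OF m(2)] dom_ddbarD(2)[OF m(4)] dom_ddbarD(2)[OF m(1)] dom_ddbar_adjD(2)[OF m(3)] refl])
  then show "(cls f, cls (laplacian \<Omega> (p + 1) (q + 1) f)) \<in> hc.lap p q" using lap_clsD(3)[OF f] by simp
qed

lemma ker_laplacian_iff:
  "u \<in> ker_laplacian \<Omega> (p + 1) (q + 1) \<longleftrightarrow> u \<in> L2 \<Omega> (p + 1) (q + 1) \<and> (cls u, 0) \<in> hc.lap p q"
proof -
  have "cls (laplacian \<Omega> (p + 1) (q + 1) u) = 0 \<longleftrightarrow> ae_eq \<Omega> (laplacian \<Omega> (p + 1) (q + 1) u) (\<lambda>z. 0)"
    if "u \<in> dom_laplacian \<Omega> (p + 1) (q + 1)"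
    using cls_eq_iff[OF L2_sqint[OF lap_clsD(2)[OF dom_laplacianD[OF that]]], of "\<lambda>z. 0"]
    by (simp add: cls_zero extend_zero sqint_zero)
  then show ?thesis unfolding ker_laplacian_def
    using dom_laplacianD lap_clsD by (metis (no_types, lifting) mem_Collect_eq)
qed

lemma range_laplacian_iff:
  "g \<in> range_laplacian \<Omega> (p + 1) (q + 1) \<longleftrightarrow> g \<in> L2 \<Omega> (p + 1) (q + 1) \<and> cls g \<in> Range (hc.lap p q)"
proof
  assume "g \<in> range_laplacian \<Omega> (p + 1) (q + 1)"
  then obtain f where g: "g \<in> L2 \<Omega> (p + 1) (q + 1)" and f: "f \<in> dom_laplacian \<Omega> (p + 1) (q + 1)"
    "ae_eq \<Omega> g (laplacian \<Omega> (p + 1) (q + 1) f)" by (auto simp: range_laplacian_def)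
  note d = dom_laplacianD[OF f(1)]
  have "cls g = cls (laplacian \<Omega> (p + 1) (q + 1) f)"
    using cls_eq_iff[OF L2_sqint[OF g] L2_sqint[OF lap_clsD(2)[OF d]]] f(2) by simp
  then show "g \<in> L2 \<Omega> (p + 1) (q + 1) \<and> cls g \<in> Range (hc.lap p q)" using g d(2) by auto
next
  assume *: "g \<in> L2 \<Omega> (p + 1) (q + 1) \<and> cls g \<in> Range (hc.lap p q)"
  then obtain u where u: "(u, cls g) \<in> hc.lap p q" by blast
  from hc.lap_in_H1(1)[OF u] obtain f where f: "f \<in> L2 \<Omega> (p + 1) (q + 1)" "u = cls f" by (rule formsE)
  note d = lap_clsD[OF f(1) u[unfolded f(2)]]
  have "ae_eq \<Omega> g (laplacian \<Omega> (p + 1) (q + 1) f)"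
    using cls_eq_iff[of g "laplacian \<Omega> (p + 1) (q + 1) f"] * d(2,3) L2_sqint by metis
  then show "g \<in> range_laplacian \<Omega> (p + 1) (q + 1)" using * d(1) by (auto simp: range_laplacian_def)
qed

lemma closed_range_lap:
  assumes "L2_closed \<Omega> (p + 1) (q + 1) (range_laplacian \<Omega> (p + 1) (q + 1))"
  shows "closed (Range (hc.lap p q))"
  unfolding closed_sequential_limits
proof (intro allI impI)
  fix X x assume X: "(\<forall>n. X n \<in> Range (hc.lap p q)) \<and> X \<longlonglongrightarrow> x"
  then have Xf: "X n \<in> forms (p + 1) (q + 1)" for n using hc.lap_in_H1(2) by blast
  then have "\<exists>f. f \<in> L2 \<Omega> (p + 1) (q + 1) \<and> X n = cls f" for n using formsE by metis
  then obtain u where u: "\<And>n. u n \<in> L2 \<Omega> (p + 1) (q + 1)" "\<And>n. X n = cls (u n)" by metis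
  have "x \<in> forms (p + 1) (q + 1)" using closed_forms X Xf closed_sequentially by blast
  then obtain f where f: "f \<in> L2 \<Omega> (p + 1) (q + 1)" "x = cls f" by (rule formsE)
  have "L2_norm \<Omega> (\<lambda>z. u m z - f z) = norm (X m - x)" for m
    using norm_cls[OF L2_sqint[OF L2_diff[OF u(1) f(1)]]] cls_diff[OF L2_sqint[OF u(1)] L2_sqint[OF f(1)]] u(2) f(2) by simp
  moreover have "(\<lambda>m. norm (X m - x)) \<longlonglongrightarrow> 0" using X by (simp add: LIM_zero_iff tendsto_norm_zero)
  ultimately have "(\<lambda>m. L2_norm \<Omega> (\<lambda>z. u m z - f z)) \<longlonglongrightarrow> 0" by simp
  moreover have "u m \<in> range_laplacian \<Omega> (p + 1) (q + 1)" for m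
    using range_laplacian_iff u X by auto
  ultimately have "f \<in> range_laplacian \<Omega> (p + 1) (q + 1)"
    using assms f(1) unfolding L2_closed_def by blast
  then show "x \<in> Range (hc.lap p q)" using range_laplacian_iff f by simp
qed

lemma lap_cmul: assumes "(u, w) \<in> hc.lap p q" shows "(cmul c u, cmul c w) \<in> hc.lap p q"
proof -
  from assms obtain s a t b where "(u, s) \<in> adjoint_rel p q" "(s, a) \<in> ddbar_rel p q"
    "(u, t) \<in> ddbar_rel (p + 1) (q + 1)" "(t, b) \<in> adjoint_rel (p + 1) (q + 1)" "w = a + b"
    by (rule hc.lapE)
  then show ?thesis
    using hc.lapI[OF adjoint_cmul ddbar_rel_cmul ddbar_rel_cmul adjoint_cmul] cmul_add by blast
qed

text \<open>
  A representative of the Green operator applied to the class of \<open>f\<close>.  The Laplacian in bidegree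
  \<open>(p, q)\<close> belongs to the complex that starts in bidegree \<open>(p - 1, q - 1)\<close>, hence the shift.
\<close>

definition neumann :: "nat \<Rightarrow> nat \<Rightarrow> 'n form \<Rightarrow> 'n form" where
  "neumann p q f = (SOME g. g \<in> L2 \<Omega> p q \<and> cls g = hc.green (p - 1) (q - 1) (cls f))"

end

section \<open>The Neumann operator\<close>

locale closed_range_domain = bounded_domain \<Omega> for \<Omega> :: "(complex^'n::{finite,linorder}) set" +
  fixes p q :: nat
  assumes L2_closed_range: "L2_closed \<Omega> (p + 1) (q + 1) (range_laplacian \<Omega> (p + 1) (q + 1))"

sublocale closed_range_domain \<subseteq> cr: hilbert_complex_closed_range "forms p q" "forms (p + 1) (q + 1)" "forms (p + 1 + 1) (q + 1 + 1)"
    "ddbar_rel p q" "ddbar_rel (p + 1) (q + 1)"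
  by unfold_locales (rule closed_range_lap[OF L2_closed_range])

(* Keeps the simplifier from rewriting bidegrees p + 1 to Suc p. *)
declare One_nat_def [simp del]

context closed_range_domain
begin

lemma neumann: "neumann (p + 1) (q + 1) f \<in> L2 \<Omega> (p + 1) (q + 1)" "cls (neumann (p + 1) (q + 1) f) = hc.green p q (cls f)"
proof -
  obtain u where "(u, hc.green p q (cls f)) \<in> hc.lap p q" using cr.green_range by (rule RangeE)
  then have "hc.green p q (cls f) \<in> forms (p + 1) (q + 1)" by (rule hc.lap_in_H1(2))
  then obtain g where "g \<in> L2 \<Omega> (p + 1) (q + 1)" "hc.green p q (cls f) = cls g" by (rule formsE)
  then have "\<exists>g. g \<in> L2 \<Omega> (p + 1) (q + 1) \<and> cls g = hc.green (p + 1 - 1) (q + 1 - 1) (cls f)" by auto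
  from someI_ex[OF this] have "neumann (p + 1) (q + 1) f \<in> L2 \<Omega> (p + 1) (q + 1) \<and>
      cls (neumann (p + 1) (q + 1) f) = hc.green (p + 1 - 1) (q + 1 - 1) (cls f)"
    by (simp only: neumann_def)
  then show "neumann (p + 1) (q + 1) f \<in> L2 \<Omega> (p + 1) (q + 1)" "cls (neumann (p + 1) (q + 1) f) = hc.green p q (cls f)" by simp_all
qed

text \<open>
  The Laplacian commutes with \<open>cmul c\<close>, and so does its inverse on the orthogonal complement of the kernel.
\<close>

lemma green_cmul: assumes "x \<in> forms (p + 1) (q + 1)" shows "hc.green p q (cmul c x) = cmul c (hc.green p q x)"
proof -
  obtain w where w: "(hc.green p q x, w) \<in> hc.lap p q" "(x - w, 0) \<in> hc.lap p q" using cr.green_decomposition[OF assms] by blast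
  have k: "(cmul c x - cmul c w, 0) \<in> hc.lap p q" using lap_cmul[OF w(2), of c] by (simp add: cmul_diff cmul_zero)
  have "hc.green p q (cmul c x) = hc.green p q (cmul c w)"
    using cr.green_kernel[OF k] linear_diff[OF cr.linear_green, of "cmul c x" "cmul c w"] by simp
  also have "\<dots> = cmul c (hc.green p q x)"
  proof (rule cr.green_lap[OF lap_cmul[OF w(1)]])
    fix k assume "(k, 0) \<in> hc.lap p q"
    from lap_cmul[OF this, of "cnj c"] have "(cmul (cnj c) k, 0) \<in> hc.lap p q" by (simp add: cmul_zero)
    then show "cmul c (hc.green p q x) \<bullet> k = 0"
      using cr.range_perp_kernel[OF cr.green_range] by (simp add: inner_cmul)
  qed
  finally show ?thesis .
qed

lemma ae_eqI_cls:
  assumes "f \<in> L2 \<Omega> p' q'" "g \<in> L2 \<Omega> p'' q''" "cls f = cls g" shows "ae_eq \<Omega> f g"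
  using cls_eq_iff[OF L2_sqint[OF assms(1)] L2_sqint[OF assms(2)]] assms(3) by simp

lemma neumann_operator: "L2_operator \<Omega> (p + 1) (q + 1) (neumann (p + 1) (q + 1))"
  unfolding L2_operator_def
proof (intro conjI ballI allI impI)
  fix f assume f: "f \<in> L2 \<Omega> (p + 1) (q + 1)"
  show "neumann (p + 1) (q + 1) f \<in> L2 \<Omega> (p + 1) (q + 1)" by (rule neumann)
  { fix g assume g: "g \<in> L2 \<Omega> (p + 1) (q + 1)"
    show "ae_eq \<Omega> (neumann (p + 1) (q + 1) f) (neumann (p + 1) (q + 1) g)" if "ae_eq \<Omega> f g"
      by (rule ae_eqI_cls[OF neumann(1) neumann(1)])
        (use that f g in \<open>simp add: neumann cls_eq_iff[symmetric] L2_sqint\<close>)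
    show "ae_eq \<Omega> (neumann (p + 1) (q + 1) (\<lambda>z. f z + g z)) (\<lambda>z. neumann (p + 1) (q + 1) f z + neumann (p + 1) (q + 1) g z)"
      by (rule ae_eqI_cls[OF neumann(1) L2_add[OF neumann(1) neumann(1)]])
        (simp add: neumann cls_add L2_sqint[OF f] L2_sqint[OF g] L2_sqint[OF neumann(1)] linear_add[OF cr.linear_green]) }
  fix c
  show "ae_eq \<Omega> (neumann (p + 1) (q + 1) (\<lambda>z. c *s f z)) (\<lambda>z. c *s neumann (p + 1) (q + 1) f z)"
    by (rule ae_eqI_cls[OF neumann(1) L2_cscale[OF neumann(1)]])
      (simp add: neumann cls_cscale L2_sqint[OF f] L2_sqint[OF neumann(1)] green_cmul[OF cls_in_forms[OF f]])
qed

lemma neumann_kernel: "u \<in> ker_laplacian \<Omega> (p + 1) (q + 1) \<Longrightarrow> ae_eq \<Omega> (neumann (p + 1) (q + 1) u) (\<lambda>z. 0)"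
  by (rule ae_eqI_cls[OF neumann(1) L2_zero]) (simp add: neumann ker_laplacian_iff cr.green_kernel cls_zero)

lemma neumann_lap: obtains w where "(cls (neumann (p + 1) (q + 1) f), w) \<in> hc.lap p q"
  using cr.is_green_green[of "cls f"] unfolding hc.is_green_def neumann(2) by blast

lemma neumann_range:
  "neumann (p + 1) (q + 1) f \<in> dom_laplacian \<Omega> (p + 1) (q + 1) \<inter> L2_perp \<Omega> (p + 1) (q + 1) (ker_laplacian \<Omega> (p + 1) (q + 1))"
proof
  obtain w where w: "(cls (neumann (p + 1) (q + 1) f), w) \<in> hc.lap p q" by (rule neumann_lap)
  show "neumann (p + 1) (q + 1) f \<in> dom_laplacian \<Omega> (p + 1) (q + 1)" by (rule lap_clsD(1)[OF neumann(1) w])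
  have "L2_inner \<Omega> (neumann (p + 1) (q + 1) f) u = 0" if "u \<in> ker_laplacian \<Omega> (p + 1) (q + 1)" for u
  proof -
    have u: "u \<in> L2 \<Omega> (p + 1) (q + 1)" "(cls u, 0) \<in> hc.lap p q" using that ker_laplacian_iff by auto
    have "(cmul \<i> (cls u), 0) \<in> hc.lap p q" using lap_cmul[OF u(2), of \<i>] by (simp add: cmul_zero)
    then show ?thesis using cr.range_perp_kernel[OF cr.green_range] u(2)
      by (simp add: L2_inner_eq L2_sqint[OF neumann(1)] L2_sqint[OF u(1)] neumann(2) complex_eq_iff)
  qed
  then show "neumann (p + 1) (q + 1) f \<in> L2_perp \<Omega> (p + 1) (q + 1) (ker_laplacian \<Omega> (p + 1) (q + 1))"
    using neumann(1) by (simp add: L2_perp_def)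
qed

lemma laplacian_neumann:
  assumes "f \<in> range_laplacian \<Omega> (p + 1) (q + 1)"
  shows "ae_eq \<Omega> (laplacian \<Omega> (p + 1) (q + 1) (neumann (p + 1) (q + 1) f)) f"
proof -
  have f: "f \<in> L2 \<Omega> (p + 1) (q + 1)" "cls f \<in> Range (hc.lap p q)" using assms range_laplacian_iff by auto
  obtain w where w: "(hc.green p q (cls f), w) \<in> hc.lap p q" "(cls f - w, 0) \<in> hc.lap p q"
    using cr.green_decomposition[OF cls_in_forms[OF f(1)]] by blast
  have "cls f - w \<in> Range (hc.lap p q)" using f(2) w(1) subspace_diff[OF hc.subspace_range_lap] by blast
  from cr.range_perp_kernel[OF this w(2)] have "w = cls f" by simp
  with w(1) have "(cls (neumann (p + 1) (q + 1) f), cls f) \<in> hc.lap p q" by (simp add: neumann(2))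
  note d = lap_clsD[OF neumann(1) this]
  show ?thesis by (rule ae_eqI_cls[OF d(2) f(1) d(3)])
qed

lemma neumann_laplacian:
  assumes "f \<in> range_laplacian \<Omega> (p + 1) (q + 1)" "f \<in> dom_laplacian \<Omega> (p + 1) (q + 1)"
  shows "ae_eq \<Omega> (neumann (p + 1) (q + 1) (laplacian \<Omega> (p + 1) (q + 1) f)) f"
proof -
  have f: "cls f \<in> Range (hc.lap p q)" using assms range_laplacian_iff by auto
  note d = dom_laplacianD[OF assms(2)]
  show ?thesis
    by (rule ae_eqI_cls[OF neumann(1) d(1)])
      (use cr.green_lap[OF d(2)] cr.range_perp_kernel[OF f] in \<open>simp add: neumann(2)\<close>)
qed

lemma neumann_energy:
  assumes f: "f \<in> L2 \<Omega> (p + 1) (q + 1)"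
  obtains s a t b where
    "(cls (neumann (p + 1) (q + 1) f), s) \<in> adjoint_rel p q" "(s, a) \<in> ddbar_rel p q"
    "(cls (neumann (p + 1) (q + 1) f), t) \<in> ddbar_rel (p + 1) (q + 1)" "(t, b) \<in> adjoint_rel (p + 1) (q + 1)"
    "(cls f - (a + b), 0) \<in> hc.lap p q" "a + b \<in> Range (hc.lap p q)"
    "(norm s)\<^sup>2 + (norm t)\<^sup>2 \<le> norm (hc.green p q (cls f)) * norm (cls f)"
proof (rule cr.green_energy[OF cls_in_forms[OF f]])
  fix s a t b
  assume *: "(hc.green p q (cls f), s) \<in> adjoint_rel p q" "(s, a) \<in> ddbar_rel p q"
    "(hc.green p q (cls f), t) \<in> ddbar_rel (p + 1) (q + 1)" "(t, b) \<in> adjoint_rel (p + 1) (q + 1)"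
    "(cls f - (a + b), 0) \<in> hc.lap p q" "(norm s)\<^sup>2 + (norm t)\<^sup>2 \<le> norm (hc.green p q (cls f)) * norm (cls f)"
  have "a + b \<in> Range (hc.lap p q)" using hc.lapI[OF *(1-4) refl] by blast
  then show thesis using * that by (simp add: neumann(2))
qed

text \<open>
  \<open>f1\<close> is the harmonic part of \<open>f\<close> and \<open>f2 = f - f1\<close> its projection to the range; the Neumann operator
  takes the same value at \<open>f\<close> and \<open>f2\<close>, since it annihilates \<open>f1\<close>.  The three summands are orthogonal because
  \<open>f1\<close> is in the kernels of the operator and of its adjoint, and the square of the operator is zero.
\<close>

lemma hodge_decomposition_forms:
  assumes f: "f \<in> L2 \<Omega> (p + 1) (q + 1)"
  shows "\<exists>f1\<in>ker_laplacian \<Omega> (p + 1) (q + 1). \<exists>f2\<in>range_laplacian \<Omega> (p + 1) (q + 1).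
     let g = ddbar \<Omega> p q (ddbar_adj \<Omega> p q (neumann (p + 1) (q + 1) f2));
         h = ddbar_adj \<Omega> (p + 1) (q + 1) (ddbar \<Omega> (p + 1) (q + 1) (neumann (p + 1) (q + 1) f2))
     in ae_eq \<Omega> f (\<lambda>z. f1 z + g z + h z) \<and>
        L2_inner \<Omega> f1 g = 0 \<and> L2_inner \<Omega> f1 h = 0 \<and> L2_inner \<Omega> g h = 0"
proof -
  obtain s a t b where 1: "(cls (neumann (p + 1) (q + 1) f), s) \<in> adjoint_rel p q" "(s, a) \<in> ddbar_rel p q"
    "(cls (neumann (p + 1) (q + 1) f), t) \<in> ddbar_rel (p + 1) (q + 1)" "(t, b) \<in> adjoint_rel (p + 1) (q + 1)"
    "(cls f - (a + b), 0) \<in> hc.lap p q" "a + b \<in> Range (hc.lap p q)"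
    by (rule neumann_energy[OF f])
  obtain f1 where f1: "f1 \<in> L2 \<Omega> (p + 1) (q + 1)" "cls f - (a + b) = cls f1"
    using hc.lap_in_H1(1)[OF 1(5)] by (rule formsE)
  have "a + b \<in> forms (p + 1) (q + 1)" using 1(6) hc.lap_in_H1(2) by blast
  then obtain f2 where f2: "f2 \<in> L2 \<Omega> (p + 1) (q + 1)" "a + b = cls f2" by (rule formsE)
  have "hc.green p q (cls f) = hc.green p q (cls f2)"
    using cr.green_kernel[OF 1(5)] linear_diff[OF cr.linear_green, of "cls f" "a + b"] f2(2) by simp
  then have N: "cls (neumann (p + 1) (q + 1) f) = cls (neumann (p + 1) (q + 1) f2)" by (simp add: neumann(2))
  note A = adjoint_rel_clsD[OF neumann(1) 1(1)[unfolded N]]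
  note B = ddbar_rel_clsD[OF A(2) 1(2)[folded A(3)]]
  note C = ddbar_rel_clsD[OF neumann(1) 1(3)[unfolded N]]
  note D = adjoint_rel_clsD[OF C(2) 1(4)[folded C(3)]]
  let ?g = "ddbar \<Omega> p q (ddbar_adj \<Omega> p q (neumann (p + 1) (q + 1) f2))"
  let ?h = "ddbar_adj \<Omega> (p + 1) (q + 1) (ddbar \<Omega> (p + 1) (q + 1) (neumann (p + 1) (q + 1) f2))"
  have k: "(cls f1, 0) \<in> hc.lap p q" using 1(5) f1(2) by simp
  then have kS: "(cls f1, 0) \<in> adjoint_rel p q" and kT: "(cls f1, 0) \<in> ddbar_rel (p + 1) (q + 1)"
    using hc.lap_kernel_iff by auto
  have "ae_eq \<Omega> f (\<lambda>z. f1 z + ?g z + ?h z)"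
    by (rule ae_eqI_cls[OF f L2_add[OF L2_add[OF f1(1) B(2)] D(2)]])
      (simp add: cls_add L2_sqint[OF f1(1)] L2_sqint[OF B(2)] L2_sqint[OF D(2)] L2_sqint[OF L2_add[OF f1(1) B(2)]]
        B(3) D(3) f1(2)[symmetric])
  moreover have "L2_inner \<Omega> f1 ?g = 0"
    using adj_relD[OF kS 1(2)] adj_relD[OF kS ddbar_rel_cmul[OF 1(2), of \<i>]]
    by (simp add: L2_inner_eq L2_sqint[OF f1(1)] L2_sqint[OF B(2)] B(3) complex_eq_iff inner_commute)
  moreover have "L2_inner \<Omega> f1 ?h = 0"
    using adj_relD[OF 1(4) kT] adj_relD[OF adjoint_cmul[OF 1(4), of \<i>] kT]
    by (simp add: L2_inner_eq L2_sqint[OF f1(1)] L2_sqint[OF D(2)] D(3) complex_eq_iff)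
  moreover have "L2_inner \<Omega> ?g ?h = 0"
    using adj_relD[OF 1(4) ddbar_rel_exact[OF 1(2)]] adj_relD[OF adjoint_cmul[OF 1(4), of \<i>] ddbar_rel_exact[OF 1(2)]]
    by (simp add: L2_inner_eq L2_sqint[OF B(2)] L2_sqint[OF D(2)] B(3) D(3) complex_eq_iff)
  moreover have "f1 \<in> ker_laplacian \<Omega> (p + 1) (q + 1)" using k f1(1) ker_laplacian_iff by blast
  moreover have "f2 \<in> range_laplacian \<Omega> (p + 1) (q + 1)" using 1(6) f2 range_laplacian_iff by simp
  ultimately show ?thesis unfolding Let_def by blast
qed

text \<open>
  A bound \<open>k\<close> of the Green operator serves for all three inequalities: the energy estimate bounds the squares of
  the two other norms by \<open>norm (N f) * norm f \<le> k * (norm f)\<^sup>2\<close>.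
\<close>

lemma neumann_bounds:
  "\<exists>k\<ge>0. \<forall>f\<in>L2 \<Omega> (p + 1) (q + 1).
     L2_norm \<Omega> (neumann (p + 1) (q + 1) f) \<le> k * L2_norm \<Omega> f \<and>
     L2_norm \<Omega> (ddbar \<Omega> (p + 1) (q + 1) (neumann (p + 1) (q + 1) f)) \<le> sqrt k * L2_norm \<Omega> f \<and>
     L2_norm \<Omega> (ddbar_adj \<Omega> p q (neumann (p + 1) (q + 1) f)) \<le> sqrt k * L2_norm \<Omega> f"
proof -
  obtain k where k: "k \<ge> 0" "\<And>x. norm (hc.green p q x) \<le> norm x * k"
    using bounded_linear.nonneg_bounded[OF cr.green_bounded] by blast
  show ?thesis
  proof (intro exI[of _ k] conjI ballI)
    fix f assume f: "f \<in> L2 \<Omega> (p + 1) (q + 1)"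
    obtain s a t b where 1: "(cls (neumann (p + 1) (q + 1) f), s) \<in> adjoint_rel p q" "(s, a) \<in> ddbar_rel p q"
      "(cls (neumann (p + 1) (q + 1) f), t) \<in> ddbar_rel (p + 1) (q + 1)" "(t, b) \<in> adjoint_rel (p + 1) (q + 1)"
      "(norm s)\<^sup>2 + (norm t)\<^sup>2 \<le> norm (hc.green p q (cls f)) * norm (cls f)"
      by (rule neumann_energy[OF f])
    note A = adjoint_rel_clsD[OF neumann(1) 1(1)] and C = ddbar_rel_clsD[OF neumann(1) 1(3)]
    show "L2_norm \<Omega> (neumann (p + 1) (q + 1) f) \<le> k * L2_norm \<Omega> f"
      using k(2)[of "cls f"] by (simp add: norm_cls[symmetric] L2_sqint[OF neumann(1)] L2_sqint[OF f] neumann(2) mult.commute)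
    have "norm (hc.green p q (cls f)) * norm (cls f) \<le> (norm (cls f) * k) * norm (cls f)"
      by (rule mult_right_mono[OF k(2)]) simp
    also have "\<dots> = (sqrt k * norm (cls f))\<^sup>2" using k(1) by (simp add: power_mult_distrib power2_eq_square)
    finally have le: "(norm s)\<^sup>2 + (norm t)\<^sup>2 \<le> (sqrt k * norm (cls f))\<^sup>2" using 1(5) by simp
    have "(norm s)\<^sup>2 \<le> (sqrt k * norm (cls f))\<^sup>2" "(norm t)\<^sup>2 \<le> (sqrt k * norm (cls f))\<^sup>2"
      using le zero_le_power2[of "norm s"] zero_le_power2[of "norm t"] by linarith+
    then have "norm s \<le> sqrt k * norm (cls f)" "norm t \<le> sqrt k * norm (cls f)"
      using k(1) by (auto intro: power2_le_imp_le)
    then show "L2_norm \<Omega> (ddbar \<Omega> (p + 1) (q + 1) (neumann (p + 1) (q + 1) f)) \<le> sqrt k * L2_norm \<Omega> f"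
      "L2_norm \<Omega> (ddbar_adj \<Omega> p q (neumann (p + 1) (q + 1) f)) \<le> sqrt k * L2_norm \<Omega> f"
      by (simp_all add: norm_cls[symmetric] L2_sqint[OF A(2)] L2_sqint[OF C(2)] L2_sqint[OF f] A(3) C(3))
  qed (rule k(1))
qed

end

context bounded_domain
begin

lemma neumann_ddbar:
  assumes 1: "L2_closed \<Omega> (p + 1) (q + 1) (range_laplacian \<Omega> (p + 1) (q + 1))"
    and 2: "L2_closed \<Omega> (p + 1 + 1) (q + 1 + 1) (range_laplacian \<Omega> (p + 1 + 1) (q + 1 + 1))"
    and f: "f \<in> dom_ddbar \<Omega> (p + 1) (q + 1)"
  shows "ae_eq \<Omega> (ddbar \<Omega> (p + 1) (q + 1) (neumann (p + 1) (q + 1) f))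
    (neumann (p + 1 + 1) (q + 1 + 1) (ddbar \<Omega> (p + 1) (q + 1) f))"
proof -
  interpret A: closed_range_domain \<Omega> p q by unfold_locales (rule 1)
  interpret B: closed_range_domain \<Omega> "p + 1" "q + 1" by unfold_locales (rule 2)
  note N = B.neumann[of "ddbar \<Omega> (p + 1) (q + 1) f"]
  have "(cls (neumann (p + 1) (q + 1) f), cls (neumann (p + 1 + 1) (q + 1 + 1) (ddbar \<Omega> (p + 1) (q + 1) f))) \<in> ddbar_rel (p + 1) (q + 1)"
    unfolding N(2) A.neumann(2)
    by (rule green_commutes[OF A.cr.hilbert_complex_closed_range_axioms B.cr.hilbert_complex_closed_range_axioms dom_ddbarD(2)[OF f]])
  note d = ddbar_rel_clsD[OF A.neumann(1) this]
  show ?thesis by (rule A.ae_eqI_cls[OF d(2) N(1) d(3)])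
qed

lemma neumann_ddbar_adj:
  assumes 1: "L2_closed \<Omega> (p + 1) (q + 1) (range_laplacian \<Omega> (p + 1) (q + 1))"
    and 2: "L2_closed \<Omega> (p + 1 + 1) (q + 1 + 1) (range_laplacian \<Omega> (p + 1 + 1) (q + 1 + 1))"
    and f: "f \<in> dom_ddbar_adj \<Omega> (p + 1) (q + 1)"
  shows "ae_eq \<Omega> (ddbar_adj \<Omega> (p + 1) (q + 1) (neumann (p + 1 + 1) (q + 1 + 1) f))
    (neumann (p + 1) (q + 1) (ddbar_adj \<Omega> (p + 1) (q + 1) f))"
proof -
  interpret A: closed_range_domain \<Omega> p q by unfold_locales (rule 1)
  interpret B: closed_range_domain \<Omega> "p + 1" "q + 1" by unfold_locales (rule 2)
  note N = A.neumann[of "ddbar_adj \<Omega> (p + 1) (q + 1) f"]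
  have "(cls (neumann (p + 1 + 1) (q + 1 + 1) f), cls (neumann (p + 1) (q + 1) (ddbar_adj \<Omega> (p + 1) (q + 1) f))) \<in> adjoint_rel (p + 1) (q + 1)"
    unfolding N(2) B.neumann(2)
    by (rule green_commutes_adjoint[OF A.cr.hilbert_complex_closed_range_axioms B.cr.hilbert_complex_closed_range_axioms dom_ddbar_adjD(2)[OF f]])
  note d = adjoint_rel_clsD[OF B.neumann(1) this]
  show ?thesis by (rule A.ae_eqI_cls[OF d(2) N(1) d(3)])
qed

end

theorem theorem1p2:
  fixes \<Omega> :: "(complex ^ 'n::{finite,linorder}) set"
  assumes dim: "CARD('n) \<ge> 2"
    and domain: "open \<Omega>" "connected \<Omega>" "\<Omega> \<noteq> {}"
    and bounded: "bounded \<Omega>"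
    and star: "starlike \<Omega>"
    and smooth: "smooth_boundary \<Omega>"
    and spsc: "strictly_pseudoconvex \<Omega>"
    and closed_range:
      "\<And>p q. p \<in> {1..CARD('n)} \<Longrightarrow> q \<in> {1..CARD('n)} \<Longrightarrow> L2_closed \<Omega> p q (range_laplacian \<Omega> p q)"
  shows "\<exists>N :: nat \<Rightarrow> nat \<Rightarrow> 'n form \<Rightarrow> 'n form.
    \<forall>p\<in>{1..CARD('n)}. \<forall>q\<in>{1..CARD('n)}.
      L2_operator \<Omega> p q (N p q) \<and>
      (\<forall>u\<in>ker_laplacian \<Omega> p q. ae_eq \<Omega> (N p q u) (\<lambda>z. 0)) \<and>
      \<comment> \<open>(1)\<close>
      N p q ` L2 \<Omega> p q \<subseteq> dom_laplacian \<Omega> p q \<inter> L2_perp \<Omega> p q (ker_laplacian \<Omega> p q) \<and>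
      \<comment> \<open>(2)\<close>
      (\<forall>f\<in>range_laplacian \<Omega> p q. ae_eq \<Omega> (laplacian \<Omega> p q (N p q f)) f) \<and>
      (\<forall>f\<in>range_laplacian \<Omega> p q \<inter> dom_laplacian \<Omega> p q. ae_eq \<Omega> (N p q (laplacian \<Omega> p q f)) f) \<and>
      \<comment> \<open>(3)\<close>
      (\<forall>f\<in>L2 \<Omega> p q. \<exists>f1\<in>ker_laplacian \<Omega> p q. \<exists>f2\<in>range_laplacian \<Omega> p q.
         let g = ddbar \<Omega> (p - 1) (q - 1) (ddbar_adj \<Omega> (p - 1) (q - 1) (N p q f2));
             h = ddbar_adj \<Omega> p q (ddbar \<Omega> p q (N p q f2))
         in ae_eq \<Omega> f (\<lambda>z. f1 z + g z + h z) \<and>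
            L2_inner \<Omega> f1 g = 0 \<and> L2_inner \<Omega> f1 h = 0 \<and> L2_inner \<Omega> g h = 0) \<and>
      \<comment> \<open>(4)\<close>
      (p \<le> CARD('n) - 1 \<and> q \<le> CARD('n) - 1 \<longrightarrow>
         (\<forall>f\<in>dom_ddbar \<Omega> p q.
            ae_eq \<Omega> (ddbar \<Omega> p q (N p q f)) (N (p + 1) (q + 1) (ddbar \<Omega> p q f)))) \<and>
      \<comment> \<open>(5)\<close>
      (2 \<le> p \<and> 2 \<le> q \<longrightarrow>
         (\<forall>f\<in>dom_ddbar_adj \<Omega> (p - 1) (q - 1).
            ae_eq \<Omega> (ddbar_adj \<Omega> (p - 1) (q - 1) (N p q f))
                    (N (p - 1) (q - 1) (ddbar_adj \<Omega> (p - 1) (q - 1) f)))) \<and>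
      \<comment> \<open>(6)\<close>
      (\<exists>k::real. k \<ge> 0 \<and>
         (\<forall>f\<in>L2 \<Omega> p q.
            L2_norm \<Omega> (N p q f) \<le> k * L2_norm \<Omega> f \<and>
            L2_norm \<Omega> (ddbar \<Omega> p q (N p q f)) \<le> sqrt k * L2_norm \<Omega> f \<and>
            L2_norm \<Omega> (ddbar_adj \<Omega> (p - 1) (q - 1) (N p q f)) \<le> sqrt k * L2_norm \<Omega> f))"
proof (intro exI ballI)
  interpret bounded_domain \<Omega> using domain bounded by unfold_locales
  fix p q assume "p \<in> {1..CARD('n)}" "q \<in> {1..CARD('n)}"
  moreover define p' q' where "p' = p - 1" and "q' = q - 1"
  ultimately have pq: "p = p' + 1" "q = q' + 1" "p' + 1 \<in> {1..CARD('n)}" "q' + 1 \<in> {1..CARD('n)}" by simp_all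
  note cl = closed_range[OF pq(3,4)]
  interpret closed_range_domain \<Omega> p' q' by unfold_locales (rule cl)
  have m1: "p' + 1 - 1 = p'" "q' + 1 - 1 = q'" by simp_all
  have ddbar_commutes: "ae_eq \<Omega> (ddbar \<Omega> (p' + 1) (q' + 1) (neumann (p' + 1) (q' + 1) f))
      (neumann (p' + 1 + 1) (q' + 1 + 1) (ddbar \<Omega> (p' + 1) (q' + 1) f))"
    if bd: "p' + 1 \<le> CARD('n) - 1 \<and> q' + 1 \<le> CARD('n) - 1" and f: "f \<in> dom_ddbar \<Omega> (p' + 1) (q' + 1)" for f
  proof (rule neumann_ddbar[OF cl _ f])
    show "L2_closed \<Omega> (p' + 1 + 1) (q' + 1 + 1) (range_laplacian \<Omega> (p' + 1 + 1) (q' + 1 + 1))"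
      by (rule closed_range) (use bd dim in auto)
  qed
  have adj_commutes: "ae_eq \<Omega> (ddbar_adj \<Omega> p' q' (neumann (p' + 1) (q' + 1) f)) (neumann p' q' (ddbar_adj \<Omega> p' q' f))"
    if bd: "2 \<le> p' + 1 \<and> 2 \<le> q' + 1" and f: "f \<in> dom_ddbar_adj \<Omega> p' q'" for f
  proof -
    define p'' q'' where "p'' = p' - 1" and "q'' = q' - 1"
    have pq'': "p' = p'' + 1" "q' = q'' + 1" using bd by (auto simp: p''_def q''_def)
    have "L2_closed \<Omega> (p'' + 1) (q'' + 1) (range_laplacian \<Omega> (p'' + 1) (q'' + 1))"
      by (rule closed_range) (use pq(3,4) pq'' in auto)
    from neumann_ddbar_adj[OF this cl[unfolded pq''] f[unfolded pq'']] show ?thesis unfolding pq'' .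
  qed
  show "L2_operator \<Omega> p q (neumann p q) \<and>
      (\<forall>u\<in>ker_laplacian \<Omega> p q. ae_eq \<Omega> (neumann p q u) (\<lambda>z. 0)) \<and>
      neumann p q ` L2 \<Omega> p q \<subseteq> dom_laplacian \<Omega> p q \<inter> L2_perp \<Omega> p q (ker_laplacian \<Omega> p q) \<and>
      (\<forall>f\<in>range_laplacian \<Omega> p q. ae_eq \<Omega> (laplacian \<Omega> p q (neumann p q f)) f) \<and>
      (\<forall>f\<in>range_laplacian \<Omega> p q \<inter> dom_laplacian \<Omega> p q. ae_eq \<Omega> (neumann p q (laplacian \<Omega> p q f)) f) \<and>
      (\<forall>f\<in>L2 \<Omega> p q. \<exists>f1\<in>ker_laplacian \<Omega> p q. \<exists>f2\<in>range_laplacian \<Omega> p q.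
         let g = ddbar \<Omega> (p - 1) (q - 1) (ddbar_adj \<Omega> (p - 1) (q - 1) (neumann p q f2));
             h = ddbar_adj \<Omega> p q (ddbar \<Omega> p q (neumann p q f2))
         in ae_eq \<Omega> f (\<lambda>z. f1 z + g z + h z) \<and>
            L2_inner \<Omega> f1 g = 0 \<and> L2_inner \<Omega> f1 h = 0 \<and> L2_inner \<Omega> g h = 0) \<and>
      (p \<le> CARD('n) - 1 \<and> q \<le> CARD('n) - 1 \<longrightarrow>
         (\<forall>f\<in>dom_ddbar \<Omega> p q.
            ae_eq \<Omega> (ddbar \<Omega> p q (neumann p q f)) (neumann (p + 1) (q + 1) (ddbar \<Omega> p q f)))) \<and>
      (2 \<le> p \<and> 2 \<le> q \<longrightarrow>
         (\<forall>f\<in>dom_ddbar_adj \<Omega> (p - 1) (q - 1).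
            ae_eq \<Omega> (ddbar_adj \<Omega> (p - 1) (q - 1) (neumann p q f))
                    (neumann (p - 1) (q - 1) (ddbar_adj \<Omega> (p - 1) (q - 1) f)))) \<and>
      (\<exists>k::real. k \<ge> 0 \<and>
         (\<forall>f\<in>L2 \<Omega> p q.
            L2_norm \<Omega> (neumann p q f) \<le> k * L2_norm \<Omega> f \<and>
            L2_norm \<Omega> (ddbar \<Omega> p q (neumann p q f)) \<le> sqrt k * L2_norm \<Omega> f \<and>
            L2_norm \<Omega> (ddbar_adj \<Omega> (p - 1) (q - 1) (neumann p q f)) \<le> sqrt k * L2_norm \<Omega> f))"
    unfolding pq(1,2) m1
  proof (intro conjI ballI impI image_subsetI)
    show "L2_operator \<Omega> (p' + 1) (q' + 1) (neumann (p' + 1) (q' + 1))" by (rule neumann_operator)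
  next
    fix u assume "u \<in> ker_laplacian \<Omega> (p' + 1) (q' + 1)"
    then show "ae_eq \<Omega> (neumann (p' + 1) (q' + 1) u) (\<lambda>z. 0)" by (rule neumann_kernel)
  next
    fix f
    show "neumann (p' + 1) (q' + 1) f
        \<in> dom_laplacian \<Omega> (p' + 1) (q' + 1) \<inter> L2_perp \<Omega> (p' + 1) (q' + 1) (ker_laplacian \<Omega> (p' + 1) (q' + 1))"
      by (rule neumann_range)
  next
    fix f assume "f \<in> range_laplacian \<Omega> (p' + 1) (q' + 1)"
    then show "ae_eq \<Omega> (laplacian \<Omega> (p' + 1) (q' + 1) (neumann (p' + 1) (q' + 1) f)) f" by (rule laplacian_neumann)
  next
    fix f assume "f \<in> range_laplacian \<Omega> (p' + 1) (q' + 1) \<inter> dom_laplacian \<Omega> (p' + 1) (q' + 1)"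
    then show "ae_eq \<Omega> (neumann (p' + 1) (q' + 1) (laplacian \<Omega> (p' + 1) (q' + 1) f)) f"
      unfolding Int_iff using neumann_laplacian by (elim conjE)
  next
    fix f assume "f \<in> L2 \<Omega> (p' + 1) (q' + 1)"
    then show "\<exists>f1\<in>ker_laplacian \<Omega> (p' + 1) (q' + 1). \<exists>f2\<in>range_laplacian \<Omega> (p' + 1) (q' + 1).
       let g = ddbar \<Omega> p' q' (ddbar_adj \<Omega> p' q' (neumann (p' + 1) (q' + 1) f2));
           h = ddbar_adj \<Omega> (p' + 1) (q' + 1) (ddbar \<Omega> (p' + 1) (q' + 1) (neumann (p' + 1) (q' + 1) f2))
       in ae_eq \<Omega> f (\<lambda>z. f1 z + g z + h z) \<and>
          L2_inner \<Omega> f1 g = 0 \<and> L2_inner \<Omega> f1 h = 0 \<and> L2_inner \<Omega> g h = 0"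
      by (rule hodge_decomposition_forms)
  next
    fix f assume "p' + 1 \<le> CARD('n) - 1 \<and> q' + 1 \<le> CARD('n) - 1" "f \<in> dom_ddbar \<Omega> (p' + 1) (q' + 1)"
    then show "ae_eq \<Omega> (ddbar \<Omega> (p' + 1) (q' + 1) (neumann (p' + 1) (q' + 1) f))
        (neumann (p' + 1 + 1) (q' + 1 + 1) (ddbar \<Omega> (p' + 1) (q' + 1) f))"
      by (rule ddbar_commutes)
  next
    fix f assume "2 \<le> p' + 1 \<and> 2 \<le> q' + 1" "f \<in> dom_ddbar_adj \<Omega> p' q'"
    then show "ae_eq \<Omega> (ddbar_adj \<Omega> p' q' (neumann (p' + 1) (q' + 1) f)) (neumann p' q' (ddbar_adj \<Omega> p' q' f))"
      by (rule adj_commutes)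
  next
    show "\<exists>k\<ge>0. \<forall>f\<in>L2 \<Omega> (p' + 1) (q' + 1).
       L2_norm \<Omega> (neumann (p' + 1) (q' + 1) f) \<le> k * L2_norm \<Omega> f \<and>
       L2_norm \<Omega> (ddbar \<Omega> (p' + 1) (q' + 1) (neumann (p' + 1) (q' + 1) f)) \<le> sqrt k * L2_norm \<Omega> f \<and>
       L2_norm \<Omega> (ddbar_adj \<Omega> p' q' (neumann (p' + 1) (q' + 1) f)) \<le> sqrt k * L2_norm \<Omega> f"
      by (rule neumann_bounds)
  qed
qed

end
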